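(* Let $\Delta$ be a list of closed definite clauses of $\mathcal{HH}^2$, $\mathcal{L}$ a list of atomic formulas, $G$ a goal formula, and $\Sigma$ a set of eigenvariables containing at least the free variables of $\Delta$, $\mathcal{L}$ and $G$. Suppose that all non-logical specification logic constants and types are represented by equivalent constants and types in $\mathcal{G}$, and that specification-logic $\forall$-quantification (eigenvariables) and meta-logic $\nabla$-quantification (nominal constants) are allowed only at inhabited types. Then $\Sigma:\Delta,\mathcal{L}\vdash G$ has a derivation in $\mathcal{HH}^2$ if and only if $\psi(\mathcal{L})\rhd\psi(G)$ is provable in $\mathcal{G}$ with the clauses for $\mathrm{nat}$, $\mathrm{member}$ and $\mathrm{seq}$ as described and the clauses for $\mathrm{prog}$ given by $\Psi(\Delta)$.
   Context: $\mathcal{HH}^2$: goal formulas $G ::= \top \mid A \mid A \supset G \mid \forall x.G \mid \exists x.G \mid G\land G \mid G \lor G$, definite clauses $D ::= A \mid G \supset D \mid \forall x.D$ written as $\forall\vec x.(G_1\supset\cdots\supset G_m\supset A)$; sequents $\Sigma:\Delta\vdash G$ derived by TRUE, OR$_i$, AND (right rules for $\top,\lor,\land$), INSTANCE (from $\Sigma:\Delta\vdash G[t/x]$, $t$ well-typed over $\Sigma$, infer $\Sigma:\Delta\vdash\exists x.G$), AUGMENT (from $\Sigma:\Delta,A\vdash G$ infer $\Sigma:\Delta\vdash A\supset G$), GENERIC (from $\Sigma\cup\{c\}:\Delta\vdash G[c/x]$, $c\notin\Sigma$, infer $\Sigma:\Delta\vdash\forall x.G$), BACKCHAIN (from $\Sigma:\Delta\vdash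 G_i[\vec t/\vec x]$ for all $i$ infer $\Sigma:\Delta\vdash A$ when $\forall\vec x.(G_1\supset\cdots\supset G_m\supset A')\in\Delta$ and $A'[\vec t/\vec x]=A$, $\vec t$ well-typed over $\Sigma$). Meta-logic $\mathcal{G}$: an intuitionistic sequent calculus over simply typed $\lambda$-terms with nominal constants, $\nabla$, nominal abstraction, cut, and fixed-point definitions (unfolding rules, induction and co-induction); "provable" means $\cdot\longrightarrow F$ derivable; multi-clause pattern definitions are understood via translation into single clauses using disjunction and nominal abstraction. Encoding $\psi$: types map to themselves except the specification type $o$ of formulas maps to $frm$; atomic specification formulas have type $atm$, with $\langle\cdot\rangle:atm\to frm$ and $\supset:atm\to frm\to frm$; constants map to constants of the same name; each eigenvariable $h$ maps bijectively to a nominal constant $a_h$ of the same type; $\psi$ commutes with variables, abstraction and application; $\psi(A_n,\ldots,A_1)=A_1::\cdots::A_n::nil$. $\Psi(\Delta)$ consists of, for each $\forall\vec x.(G_1\supset\cdots\supset G_n\supset A)\in\Delta$, the clause $\forall\vec x.\,\mathrm{prog}\,A\,(G_1\land\cdots\land G_n)\triangleq\top$ (and $\forall\vec x.\,\mathrm{prog}\,A\,\top\triangleq\top$ when $n=0$), formulas being translated by $\psi$. Definitions: $\mathrm{nat}\ z\stackrel{\mu}{=}\top$, $\mathrm{nat}\ (s\ N)\stackrel{\mu}{=}\mathrm{nat}\ N$; $\mathrm{member}\ A\ (A::L)\stackrel{\mu}{=}\top$, $\mathrm{member}\ A\ (B::L)\stackrel{\mu}{=}\mathrm{member}\ B\ L$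 (as printed); $\mathrm{seq}:nt\to atmlist\to frm\to o$ with $\mathrm{seq}\,(s\,N)\,L\,\top\stackrel{\mu}{=}\top$; $\mathrm{seq}\,(s\,N)\,L\,(B\lor C)\stackrel{\mu}{=}\mathrm{seq}\,N\,L\,B$; $\mathrm{seq}\,(s\,N)\,L\,(B\lor C)\stackrel{\mu}{=}\mathrm{seq}\,N\,L\,C$; $\mathrm{seq}\,(s\,N)\,L\,(B\land C)\stackrel{\mu}{=}\mathrm{seq}\,N\,L\,B\land\mathrm{seq}\,N\,L\,C$; $\mathrm{seq}\,(s\,N)\,L\,(A\supset B)\stackrel{\mu}{=}\mathrm{seq}\,N\,(A::L)\,B$; $\mathrm{seq}\,(s\,N)\,L\,(\forall B)\stackrel{\mu}{=}\nabla x.\mathrm{seq}\,N\,L\,(B\,x)$; $\mathrm{seq}\,(s\,N)\,L\,(\exists B)\stackrel{\mu}{=}\exists x.\mathrm{seq}\,N\,L\,(B\,x)$; $\mathrm{seq}\,(s\,N)\,L\,\langle A\rangle\stackrel{\mu}{=}\mathrm{member}\,A\,L$; $\mathrm{seq}\,(s\,N)\,L\,\langle A\rangle\stackrel{\mu}{=}\exists b.\,\mathrm{prog}\,A\,b\land\mathrm{seq}\,N\,L\,b$. Notation: $\ell\rhd g$ abbreviates $\exists n.\,\mathrm{nat}\,n\land\mathrm{seq}\,n\,\ell\,g$.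
   Formalization: The second member clause is read as member A (B::L) = member A L, since the printed member B L makes the claim false (e.g. for the list a, b and goal a); the set Σ of eigenvariables is taken finite, so that GENERIC always has a fresh eigenvariable. *)

theory Defs
  imports Main "HOL-Library.Multiset"
begin

section \<open>Simply typed terms, shared by both logics\<close>

datatype 'b ty = Base 'b | Fun "'b ty" "'b ty"  (infixr "\<rightarrow>\<^sub>t" 60)

text \<open>Eigenvariables and nominal constants carry their type, with a countably infinite
  supply at each type.\<close>
type_synonym 'b tvar = "nat \<times> 'b ty"

text \<open>Bound variables are de Bruijn indices. \<^term>\<open>Par\<close> is used for eigenvariables and, in the
  meta-logic, also for nominal constants.\<close>
datatype (cons: 'k, pars: 'v, 'b) tm =
    Con 'k
  | Par 'v
  | Bd nat
  | App "('k, 'v, 'b) tm" "('k, 'v, 'b) tm"  (infixl "\<cdot>" 90)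
  | Lam "'b ty" "('k, 'v, 'b) tm"

abbreviation fun_ty :: "'b ty list \<Rightarrow> 'b ty \<Rightarrow> 'b ty" where
  "fun_ty \<tau>s \<tau> \<equiv> foldr Fun \<tau>s \<tau>"

abbreviation apps :: "('k, 'v, 'b) tm \<Rightarrow> ('k, 'v, 'b) tm list \<Rightarrow> ('k, 'v, 'b) tm" where
  "apps t us \<equiv> foldl App t us"

primrec ren :: "(nat \<Rightarrow> nat) \<Rightarrow> ('k, 'v, 'b) tm \<Rightarrow> ('k, 'v, 'b) tm" where
  "ren r (Con c) = Con c"
| "ren r (Par v) = Par v"
| "ren r (Bd i) = Bd (r i)"
| "ren r (t \<cdot> u) = ren r t \<cdot> ren r u"
| "ren r (Lam \<tau> t) = Lam \<tau> (ren (case_nat 0 (\<lambda>i. Suc (r i))) t)"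

definition up :: "(nat \<Rightarrow> ('k, 'v, 'b) tm) \<Rightarrow> nat \<Rightarrow> ('k, 'v, 'b) tm" where
  "up \<sigma> = case_nat (Bd 0) (\<lambda>i. ren Suc (\<sigma> i))"

primrec sub :: "(nat \<Rightarrow> ('k, 'v, 'b) tm) \<Rightarrow> ('k, 'v, 'b) tm \<Rightarrow> ('k, 'v, 'b) tm" where
  "sub \<sigma> (Con c) = Con c"
| "sub \<sigma> (Par v) = Par v"
| "sub \<sigma> (Bd i) = \<sigma> i"
| "sub \<sigma> (t \<cdot> u) = sub \<sigma> t \<cdot> sub \<sigma> u"
| "sub \<sigma> (Lam \<tau> t) = Lam \<tau> (sub (up \<sigma>) t)"

text \<open>The substitution that removes the \<open>length ts\<close> innermost bound variables: index \<open>i\<close> is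
  replaced by \<open>ts ! i\<close>.\<close>
definition inst :: "('k, 'v, 'b) tm list \<Rightarrow> nat \<Rightarrow> ('k, 'v, 'b) tm" where
  "inst ts i = (if i < length ts then ts ! i else Bd (i - length ts))"

text \<open>Substitution for parameters; it is only used with terms without loose indices, so nothing
  is lifted.\<close>
primrec psub :: "('v \<Rightarrow> ('k, 'v, 'b) tm) \<Rightarrow> ('k, 'v, 'b) tm \<Rightarrow> ('k, 'v, 'b) tm" where
  "psub \<theta> (Con c) = Con c"
| "psub \<theta> (Par v) = \<theta> v"
| "psub \<theta> (Bd i) = Bd i"
| "psub \<theta> (t \<cdot> u) = psub \<theta> t \<cdot> psub \<theta> u"
| "psub \<theta> (Lam \<tau> t) = Lam \<tau> (psub \<theta> t)"

text \<open>\<open>Lam \<tau> (close_par v 0 t)\<close> is the abstraction of \<open>t\<close> over the parameter \<open>v\<close>.\<close>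
primrec close_par :: "'v \<Rightarrow> nat \<Rightarrow> ('k, 'v, 'b) tm \<Rightarrow> ('k, 'v, 'b) tm" where
  "close_par v k (Con c) = Con c"
| "close_par v k (Par w) = (if w = v then Bd k else Par w)"
| "close_par v k (Bd i) = (if i < k then Bd i else Bd (Suc i))"
| "close_par v k (t \<cdot> u) = close_par v k t \<cdot> close_par v k u"
| "close_par v k (Lam \<tau> t) = Lam \<tau> (close_par v (Suc k) t)"

text \<open>\<open>ct\<close> and \<open>vt\<close> give the types of the constants and parameters that are available;
  \<open>E ! i\<close> is the type of the bound variable \<open>Bd i\<close>.\<close>
inductive has_type ::
  "('k \<Rightarrow> 'b ty option) \<Rightarrow> ('v \<Rightarrow> 'b ty option) \<Rightarrow> 'b ty list \<Rightarrow> ('k, 'v, 'b) tm \<Rightarrow> 'b ty \<Rightarrow> bool"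
  for ct vt where
  "ct c = Some \<tau> \<Longrightarrow> has_type ct vt E (Con c) \<tau>"
| "vt v = Some \<tau> \<Longrightarrow> has_type ct vt E (Par v) \<tau>"
| "i < length E \<Longrightarrow> has_type ct vt E (Bd i) (E ! i)"
| "has_type ct vt E t (\<sigma> \<rightarrow>\<^sub>t \<tau>) \<Longrightarrow> has_type ct vt E u \<sigma> \<Longrightarrow> has_type ct vt E (t \<cdot> u) \<tau>"
| "has_type ct vt (\<sigma> # E) t \<tau> \<Longrightarrow> has_type ct vt E (Lam \<sigma> t) (\<sigma> \<rightarrow>\<^sub>t \<tau>)"

text \<open>\<open>\<beta>\<eta>\<close>-conversion between well-typed terms.\<close>
inductive conv ::
  "('k \<Rightarrow> 'b ty option) \<Rightarrow> ('v \<Rightarrow> 'b ty option) \<Rightarrow> 'b ty list \<Rightarrow>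
   ('k, 'v, 'b) tm \<Rightarrow> ('k, 'v, 'b) tm \<Rightarrow> 'b ty \<Rightarrow> bool"
  for ct vt where
  refl: "has_type ct vt E t \<tau> \<Longrightarrow> conv ct vt E t t \<tau>"
| sym: "conv ct vt E t u \<tau> \<Longrightarrow> conv ct vt E u t \<tau>"
| trans: "conv ct vt E t u \<tau> \<Longrightarrow> conv ct vt E u v \<tau> \<Longrightarrow> conv ct vt E t v \<tau>"
| app: "conv ct vt E t t' (\<sigma> \<rightarrow>\<^sub>t \<tau>) \<Longrightarrow> conv ct vt E u u' \<sigma> \<Longrightarrow> conv ct vt E (t \<cdot> u) (t' \<cdot> u') \<tau>"
| lam: "conv ct vt (\<sigma> # E) t t' \<tau> \<Longrightarrow> conv ct vt E (Lam \<sigma> t) (Lam \<sigma> t') (\<sigma> \<rightarrow>\<^sub>t \<tau>)"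
| beta: "has_type ct vt (\<sigma> # E) t \<tau> \<Longrightarrow> has_type ct vt E u \<sigma> \<Longrightarrow>
    conv ct vt E (Lam \<sigma> t \<cdot> u) (sub (inst [u]) t) \<tau>"
| eta: "has_type ct vt E t (\<sigma> \<rightarrow>\<^sub>t \<tau>) \<Longrightarrow>
    conv ct vt E (Lam \<sigma> (ren Suc t \<cdot> Bd 0)) t (\<sigma> \<rightarrow>\<^sub>t \<tau>)"

definition inhabited :: "('k \<Rightarrow> 'b ty option) \<Rightarrow> 'b ty \<Rightarrow> bool" where
  "inhabited ct \<tau> \<longleftrightarrow> (\<exists>t :: ('k, unit, 'b) tm. has_type ct (\<lambda>_. None) [] t \<tau>)"


section \<open>The specification logic\<close>

text \<open>Formulas, the objects of the specification type \<open>o\<close>, are the elements of the datatype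
  \<open>goal\<close> (and \<open>dclause\<close>) below; the only \<open>\<lambda>\<close>-terms among them are the atomic formulas, which are
  the terms of type \<open>SAtm\<close>.\<close>
datatype 'b sbase = SBase 'b | SAtm

type_synonym 'b sty = "'b sbase ty"
type_synonym 'b evar = "'b sbase tvar"
type_synonym ('c, 'b) stm = "('c, 'b evar, 'b sbase) tm"

datatype ('c, 'b) goal =
    GTop
  | GAtom "('c, 'b) stm"
  | GImp "('c, 'b) stm" "('c, 'b) goal"
  | GAll "'b sty" "('c, 'b) goal"
  | GEx "'b sty" "('c, 'b) goal"
  | GAnd "('c, 'b) goal" "('c, 'b) goal"
  | GOr "('c, 'b) goal" "('c, 'b) goal"

datatype ('c, 'b) dclause =
    DAtom "('c, 'b) stm"
  | DImp "('c, 'b) goal" "('c, 'b) dclause"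
  | DAll "'b sty" "('c, 'b) dclause"

primrec gsub :: "(nat \<Rightarrow> ('c, 'b) stm) \<Rightarrow> ('c, 'b) goal \<Rightarrow> ('c, 'b) goal" where
  "gsub \<sigma> GTop = GTop"
| "gsub \<sigma> (GAtom A) = GAtom (sub \<sigma> A)"
| "gsub \<sigma> (GImp A G) = GImp (sub \<sigma> A) (gsub \<sigma> G)"
| "gsub \<sigma> (GAll \<tau> G) = GAll \<tau> (gsub (up \<sigma>) G)"
| "gsub \<sigma> (GEx \<tau> G) = GEx \<tau> (gsub (up \<sigma>) G)"
| "gsub \<sigma> (GAnd G H) = GAnd (gsub \<sigma> G) (gsub \<sigma> H)"
| "gsub \<sigma> (GOr G H) = GOr (gsub \<sigma> G) (gsub \<sigma> H)"

text \<open>The form \<open>\<forall>x\<^sub>1 \<dots> x\<^sub>n. G\<^sub>1 \<supset> \<dots> \<supset> G\<^sub>m \<supset> A\<close> of a clause. The types of the quantified variables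
  are listed innermost first, so \<open>Bd i\<close> has the \<open>i\<close>-th type of the list in the \<open>G\<^sub>j\<close> and \<open>A\<close>.\<close>
primrec flat :: "('c, 'b) dclause \<Rightarrow> 'b sty list \<times> ('c, 'b) goal list \<times> ('c, 'b) stm" where
  "flat (DAtom A) = ([], [], A)"
| "flat (DImp G D) =
    (case flat D of (\<tau>s, Gs, A) \<Rightarrow> (\<tau>s, gsub (\<lambda>i. Bd (i + length \<tau>s)) G # Gs, A))"
| "flat (DAll \<tau> D) = (case flat D of (\<tau>s, Gs, A) \<Rightarrow> (\<tau>s @ [\<tau>], Gs, A))"

definition svt :: "'b evar set \<Rightarrow> 'b evar \<Rightarrow> 'b sty option" where
  "svt \<Sigma> h = (if h \<in> \<Sigma> then Some (snd h) else None)"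

primrec obj_ty :: "'b sty \<Rightarrow> bool" where
  "obj_ty (Base b) \<longleftrightarrow> b \<noteq> SAtm"
| "obj_ty (\<sigma> \<rightarrow>\<^sub>t \<tau>) \<longleftrightarrow> obj_ty \<sigma> \<and> obj_ty \<tau>"

text \<open>A non-logical constant may have formulas as results (it is then a predicate) but not as
  arguments.\<close>
primrec const_ty :: "'b sty \<Rightarrow> bool" where
  "const_ty (Base b) \<longleftrightarrow> True"
| "const_ty (\<sigma> \<rightarrow>\<^sub>t \<tau>) \<longleftrightarrow> obj_ty \<sigma> \<and> const_ty \<tau>"

definition spec_sig :: "('c \<Rightarrow> 'b sty option) \<Rightarrow> bool" where
  "spec_sig sg \<longleftrightarrow> (\<forall>c \<tau>. sg c = Some \<tau> \<longrightarrow> const_ty \<tau>)"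

text \<open>\<open>us\<close> and \<open>es\<close> are the types at which universal and existential quantification over goals
  is available.\<close>
primrec wf_goal ::
  "('c \<Rightarrow> 'b sty option) \<Rightarrow> 'b sty set \<Rightarrow> 'b sty set \<Rightarrow> 'b evar set \<Rightarrow> 'b sty list \<Rightarrow>
   ('c, 'b) goal \<Rightarrow> bool" where
  "wf_goal sg us es \<Sigma> E GTop \<longleftrightarrow> True"
| "wf_goal sg us es \<Sigma> E (GAtom A) \<longleftrightarrow> has_type sg (svt \<Sigma>) E A (Base SAtm)"
| "wf_goal sg us es \<Sigma> E (GImp A G) \<longleftrightarrow>
    has_type sg (svt \<Sigma>) E A (Base SAtm) \<and> wf_goal sg us es \<Sigma> E G"
| "wf_goal sg us es \<Sigma> E (GAll \<tau> G) \<longleftrightarrow> \<tau> \<in> us \<and> wf_goal sg us es \<Sigma> (\<tau> # E) G"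
| "wf_goal sg us es \<Sigma> E (GEx \<tau> G) \<longleftrightarrow> \<tau> \<in> es \<and> wf_goal sg us es \<Sigma> (\<tau> # E) G"
| "wf_goal sg us es \<Sigma> E (GAnd G H) \<longleftrightarrow> wf_goal sg us es \<Sigma> E G \<and> wf_goal sg us es \<Sigma> E H"
| "wf_goal sg us es \<Sigma> E (GOr G H) \<longleftrightarrow> wf_goal sg us es \<Sigma> E G \<and> wf_goal sg us es \<Sigma> E H"

primrec wf_clause ::
  "('c \<Rightarrow> 'b sty option) \<Rightarrow> 'b sty set \<Rightarrow> 'b sty set \<Rightarrow> 'b evar set \<Rightarrow> 'b sty list \<Rightarrow>
   ('c, 'b) dclause \<Rightarrow> bool" where
  "wf_clause sg us es \<Sigma> E (DAtom A) \<longleftrightarrow> has_type sg (svt \<Sigma>) E A (Base SAtm)"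
| "wf_clause sg us es \<Sigma> E (DImp G D) \<longleftrightarrow>
    wf_goal sg us es \<Sigma> E G \<and> wf_clause sg us es \<Sigma> E D"
| "wf_clause sg us es \<Sigma> E (DAll \<tau> D) \<longleftrightarrow> obj_ty \<tau> \<and> wf_clause sg us es \<Sigma> (\<tau> # E) D"

inductive hh ::
  "('c \<Rightarrow> 'b sty option) \<Rightarrow> 'b evar set \<Rightarrow> ('c, 'b) dclause list \<Rightarrow> ('c, 'b) goal \<Rightarrow> bool"
  for sg where
  TRUE: "hh sg \<Sigma> \<Delta> GTop"
| OR1: "hh sg \<Sigma> \<Delta> G \<Longrightarrow> hh sg \<Sigma> \<Delta> (GOr G H)"
| OR2: "hh sg \<Sigma> \<Delta> H \<Longrightarrow> hh sg \<Sigma> \<Delta> (GOr G H)"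
| AND: "hh sg \<Sigma> \<Delta> G \<Longrightarrow> hh sg \<Sigma> \<Delta> H \<Longrightarrow> hh sg \<Sigma> \<Delta> (GAnd G H)"
| INSTANCE: "has_type sg (svt \<Sigma>) [] t \<tau> \<Longrightarrow> hh sg \<Sigma> \<Delta> (gsub (inst [t]) G) \<Longrightarrow>
    hh sg \<Sigma> \<Delta> (GEx \<tau> G)"
| AUGMENT: "hh sg \<Sigma> (\<Delta> @ [DAtom A]) G \<Longrightarrow> hh sg \<Sigma> \<Delta> (GImp A G)"
| GENERIC: "c \<notin> \<Sigma> \<Longrightarrow> snd c = \<tau> \<Longrightarrow> hh sg (insert c \<Sigma>) \<Delta> (gsub (inst [Par c]) G) \<Longrightarrow>
    hh sg \<Sigma> \<Delta> (GAll \<tau> G)"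
| BACKCHAIN: "D \<in> set \<Delta> \<Longrightarrow> flat D = (\<tau>s, Gs, A') \<Longrightarrow>
    list_all2 (has_type sg (svt \<Sigma>) []) ts \<tau>s \<Longrightarrow>
    conv sg (svt \<Sigma>) [] (sub (inst ts) A') A (Base SAtm) \<Longrightarrow>
    (\<forall>G \<in> set Gs. hh sg \<Sigma> \<Delta> (gsub (inst ts) G)) \<Longrightarrow>
    hh sg \<Sigma> \<Delta> (GAtom A)"


section \<open>The meta-logic\<close>

datatype 'b mvar = Nom "'b tvar" | Eig "'b tvar"

type_synonym ('k, 'b) mtm = "('k, 'b mvar, 'b) tm"

text \<open>\<open>FNA n s t\<close> is the nominal abstraction of degree \<open>n\<close>, which for \<open>n = 0\<close> is equality.\<close>
datatype (preds: 'p, tms: 't, dead 'b) form =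
    FTop
  | FBot
  | FAnd "('p, 't, 'b) form" "('p, 't, 'b) form"
  | FOr "('p, 't, 'b) form" "('p, 't, 'b) form"
  | FImp "('p, 't, 'b) form" "('p, 't, 'b) form"
  | FAll "'b ty" "('p, 't, 'b) form"
  | FEx "'b ty" "('p, 't, 'b) form"
  | FNab "'b ty" "('p, 't, 'b) form"
  | FNA nat 't 't
  | FAt 'p "'t list"

type_synonym ('p, 'k, 'b) mform = "('p, ('k, 'b) mtm, 'b) form"

primrec fsub :: "(nat \<Rightarrow> ('k, 'b) mtm) \<Rightarrow> ('p, 'k, 'b) mform \<Rightarrow> ('p, 'k, 'b) mform" where
  "fsub \<sigma> FTop = FTop"
| "fsub \<sigma> FBot = FBot"
| "fsub \<sigma> (FAnd F G) = FAnd (fsub \<sigma> F) (fsub \<sigma> G)"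
| "fsub \<sigma> (FOr F G) = FOr (fsub \<sigma> F) (fsub \<sigma> G)"
| "fsub \<sigma> (FImp F G) = FImp (fsub \<sigma> F) (fsub \<sigma> G)"
| "fsub \<sigma> (FAll \<tau> F) = FAll \<tau> (fsub (up \<sigma>) F)"
| "fsub \<sigma> (FEx \<tau> F) = FEx \<tau> (fsub (up \<sigma>) F)"
| "fsub \<sigma> (FNab \<tau> F) = FNab \<tau> (fsub (up \<sigma>) F)"
| "fsub \<sigma> (FNA n s t) = FNA n (sub \<sigma> s) (sub \<sigma> t)"
| "fsub \<sigma> (FAt p ts) = FAt p (map (sub \<sigma>) ts)"

text \<open>Replaces the predicate \<open>p\<close> by \<open>S\<close>, whose arguments are the indices \<open>0, 1, \<dots>\<close> and which
  has no other loose indices.\<close>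
primrec pred_subst ::
  "'p \<Rightarrow> ('p, 'k, 'b) mform \<Rightarrow> ('p, 'k, 'b) mform \<Rightarrow> ('p, 'k, 'b) mform" where
  "pred_subst p S FTop = FTop"
| "pred_subst p S FBot = FBot"
| "pred_subst p S (FAnd F G) = FAnd (pred_subst p S F) (pred_subst p S G)"
| "pred_subst p S (FOr F G) = FOr (pred_subst p S F) (pred_subst p S G)"
| "pred_subst p S (FImp F G) = FImp (pred_subst p S F) (pred_subst p S G)"
| "pred_subst p S (FAll \<tau> F) = FAll \<tau> (pred_subst p S F)"
| "pred_subst p S (FEx \<tau> F) = FEx \<tau> (pred_subst p S F)"
| "pred_subst p S (FNab \<tau> F) = FNab \<tau> (pred_subst p S F)"
| "pred_subst p S (FNA n s t) = FNA n s t"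
| "pred_subst p S (FAt q ts) = (if q = p then fsub (inst ts) S else FAt q ts)"

text \<open>Nominal constants exist only at inhabited types.\<close>
definition mvt :: "('k \<Rightarrow> 'b ty option) \<Rightarrow> 'b tvar set \<Rightarrow> 'b mvar \<Rightarrow> 'b ty option" where
  "mvt ct \<Sigma> v = (case v of
      Nom a \<Rightarrow> if inhabited ct (snd a) then Some (snd a) else None
    | Eig h \<Rightarrow> if h \<in> \<Sigma> then Some (snd h) else None)"

text \<open>A definition assigns to each predicate \<open>p\<close> its argument types and the body \<open>B\<close> of its single
  clause \<open>\<forall>x\<^sub>0 \<dots> x\<^sub>n. p x\<^sub>0 \<dots> x\<^sub>n \<triangleq> B\<close>, with \<open>Bd i\<close> for \<open>x\<^sub>i\<close>. The usual stratification condition on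
  definitions is vacuous for bodies without implication, and is not made part of the type.\<close>
datatype fixkind = Plain | Mu | Nu

type_synonym ('p, 'k, 'b) defn = "'p \<Rightarrow> fixkind \<times> 'b ty list \<times> ('p, 'k, 'b) mform"

abbreviation arg_types :: "('p, 'k, 'b) defn \<Rightarrow> 'p \<Rightarrow> 'b ty list" where
  "arg_types D p \<equiv> fst (snd (D p))"

primrec wf_form ::
  "('k \<Rightarrow> 'b ty option) \<Rightarrow> ('p, 'k, 'b) defn \<Rightarrow> 'b tvar set \<Rightarrow> 'b ty list \<Rightarrow>
   ('p, 'k, 'b) mform \<Rightarrow> bool" where
  "wf_form ct D \<Sigma> E FTop \<longleftrightarrow> True"
| "wf_form ct D \<Sigma> E FBot \<longleftrightarrow> True"
| "wf_form ct D \<Sigma> E (FAnd F G) \<longleftrightarrow> wf_form ct D \<Sigma> E F \<and> wf_form ct D \<Sigma> E G"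
| "wf_form ct D \<Sigma> E (FOr F G) \<longleftrightarrow> wf_form ct D \<Sigma> E F \<and> wf_form ct D \<Sigma> E G"
| "wf_form ct D \<Sigma> E (FImp F G) \<longleftrightarrow> wf_form ct D \<Sigma> E F \<and> wf_form ct D \<Sigma> E G"
| "wf_form ct D \<Sigma> E (FAll \<tau> F) \<longleftrightarrow> wf_form ct D \<Sigma> (\<tau> # E) F"
| "wf_form ct D \<Sigma> E (FEx \<tau> F) \<longleftrightarrow> wf_form ct D \<Sigma> (\<tau> # E) F"
| "wf_form ct D \<Sigma> E (FNab \<tau> F) \<longleftrightarrow> inhabited ct \<tau> \<and> wf_form ct D \<Sigma> (\<tau> # E) F"
| "wf_form ct D \<Sigma> E (FNA n s t) \<longleftrightarrow> (\<exists>\<tau>s \<tau>. length \<tau>s = n \<and>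
    has_type ct (mvt ct \<Sigma>) E s (fun_ty \<tau>s \<tau>) \<and> has_type ct (mvt ct \<Sigma>) E t \<tau>)"
| "wf_form ct D \<Sigma> E (FAt p ts) \<longleftrightarrow> list_all2 (has_type ct (mvt ct \<Sigma>) E) ts (arg_types D p)"

inductive fconv ::
  "('k \<Rightarrow> 'b ty option) \<Rightarrow> 'b tvar set \<Rightarrow> 'b ty list \<Rightarrow>
   ('p, 'k, 'b) mform \<Rightarrow> ('p, 'k, 'b) mform \<Rightarrow> bool"
  for ct \<Sigma> where
  "fconv ct \<Sigma> E FTop FTop"
| "fconv ct \<Sigma> E FBot FBot"
| "fconv ct \<Sigma> E F F' \<Longrightarrow> fconv ct \<Sigma> E G G' \<Longrightarrow> fconv ct \<Sigma> E (FAnd F G) (FAnd F' G')"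
| "fconv ct \<Sigma> E F F' \<Longrightarrow> fconv ct \<Sigma> E G G' \<Longrightarrow> fconv ct \<Sigma> E (FOr F G) (FOr F' G')"
| "fconv ct \<Sigma> E F F' \<Longrightarrow> fconv ct \<Sigma> E G G' \<Longrightarrow> fconv ct \<Sigma> E (FImp F G) (FImp F' G')"
| "fconv ct \<Sigma> (\<tau> # E) F F' \<Longrightarrow> fconv ct \<Sigma> E (FAll \<tau> F) (FAll \<tau> F')"
| "fconv ct \<Sigma> (\<tau> # E) F F' \<Longrightarrow> fconv ct \<Sigma> E (FEx \<tau> F) (FEx \<tau> F')"
| "fconv ct \<Sigma> (\<tau> # E) F F' \<Longrightarrow> fconv ct \<Sigma> E (FNab \<tau> F) (FNab \<tau> F')"
| "conv ct (mvt ct \<Sigma>) E s s' \<sigma> \<Longrightarrow> conv ct (mvt ct \<Sigma>) E t t' \<tau> \<Longrightarrow>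
    fconv ct \<Sigma> E (FNA n s t) (FNA n s' t')"
| "list_all2 (\<lambda>t t'. \<exists>\<tau>. conv ct (mvt ct \<Sigma>) E t t' \<tau>) ts ts' \<Longrightarrow>
    fconv ct \<Sigma> E (FAt p ts) (FAt p ts')"

definition noms :: "('k, 'b) mtm \<Rightarrow> 'b tvar set" where
  "noms t = {a. Nom a \<in> pars t}"

definition eigs :: "('k, 'b) mtm \<Rightarrow> 'b tvar set" where
  "eigs t = {h. Eig h \<in> pars t}"

definition supp :: "('p, 'k, 'b) mform \<Rightarrow> 'b tvar set" where
  "supp F = (\<Union>t \<in> tms F. noms t)"

definition nom_perm :: "('b tvar \<Rightarrow> 'b tvar) \<Rightarrow> bool" where
  "nom_perm \<pi> \<longleftrightarrow> bij \<pi> \<and> finite {a. \<pi> a \<noteq> a} \<and> (\<forall>a. snd (\<pi> a) = snd a)"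

definition permute :: "('b tvar \<Rightarrow> 'b tvar) \<Rightarrow> ('p, 'k, 'b) mform \<Rightarrow> ('p, 'k, 'b) mform" where
  "permute \<pi> = map_form id (map_tm id (case_mvar (\<lambda>a. Nom (\<pi> a)) Eig) id)"

text \<open>Nominal capture avoiding substitution. It is determined only up to a permutation of the
  nominal constants, which the initial rule does not distinguish.\<close>
definition ncas ::
  "'b tvar set \<Rightarrow> ('b tvar \<Rightarrow> ('k, 'b) mtm) \<Rightarrow> ('p, 'k, 'b) mform \<Rightarrow> ('p, 'k, 'b) mform" where
  "ncas \<Sigma> \<theta> F =
    (let \<pi> = (SOME \<pi>. nom_perm \<pi> \<and> supp (permute \<pi> F) \<inter> (\<Union>h \<in> \<Sigma>. noms (\<theta> h)) = {})
     in map_form id (psub (case_mvar (\<lambda>a. Par (Nom a)) \<theta>)) (permute \<pi> F))"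

definition sig_subst :: "'b tvar set \<Rightarrow> ('b tvar \<Rightarrow> ('k, 'b) mtm) \<Rightarrow> 'b tvar set" where
  "sig_subst \<Sigma> \<theta> = (\<Union>h \<in> \<Sigma>. eigs (\<theta> h))"

definition wf_subst ::
  "('k \<Rightarrow> 'b ty option) \<Rightarrow> 'b tvar set \<Rightarrow> ('b tvar \<Rightarrow> ('k, 'b) mtm) \<Rightarrow> bool" where
  "wf_subst ct \<Sigma> \<theta> \<longleftrightarrow>
    (\<forall>h \<in> \<Sigma>. has_type ct (mvt ct (sig_subst \<Sigma> \<theta>)) [] (\<theta> h) (snd h))"

definition abs_noms :: "'b tvar list \<Rightarrow> ('k, 'b) mtm \<Rightarrow> ('k, 'b) mtm" where
  "abs_noms cs t = foldr (\<lambda>c u. Lam (snd c) (close_par (Nom c) 0 u)) cs t"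

definition na_holds :: "('k \<Rightarrow> 'b ty option) \<Rightarrow> 'b tvar set \<Rightarrow> ('p, 'k, 'b) mform \<Rightarrow> bool" where
  "na_holds ct \<Sigma> F \<longleftrightarrow> (\<exists>n s t cs \<tau>. F = FNA n s t \<and> length cs = n \<and>
    (\<forall>c \<in> set cs. inhabited ct (snd c)) \<and> conv ct (mvt ct \<Sigma>) [] s (abs_noms cs t) \<tau>)"

text \<open>Sequents are taken to be well-formed: the side conditions below guarantee that the premises
  of a rule are well-formed whenever its conclusion is. Formulas are identified up to
  \<open>\<beta>\<eta>\<close>-conversion; this is the purpose of the rules \<open>convL\<close> and \<open>convR\<close>, in the presence of which it
  makes no difference that \<open>supp\<close> counts occurrences in terms that need not be normal.

  In \<open>IL\<close> and \<open>CIR\<close> the (co-)invariant \<open>S\<close> is closed and free of nominal constants; without the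
  latter restriction the logic is inconsistent.\<close>
inductive gder ::
  "('k \<Rightarrow> 'b ty option) \<Rightarrow> ('p, 'k, 'b) defn \<Rightarrow> 'b tvar set \<Rightarrow>
   ('p, 'k, 'b) mform multiset \<Rightarrow> ('p, 'k, 'b) mform \<Rightarrow> bool"
  for ct D where
  convL: "fconv ct \<Sigma> [] B B' \<Longrightarrow> gder ct D \<Sigma> (add_mset B \<Gamma>) C \<Longrightarrow> gder ct D \<Sigma> (add_mset B' \<Gamma>) C"
| convR: "fconv ct \<Sigma> [] B B' \<Longrightarrow> gder ct D \<Sigma> \<Gamma> B \<Longrightarrow> gder ct D \<Sigma> \<Gamma> B'"
| ident: "nom_perm \<pi> \<Longrightarrow> gder ct D \<Sigma> (add_mset B \<Gamma>) (permute \<pi> B)"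
| cut: "wf_form ct D \<Sigma> [] B \<Longrightarrow> gder ct D \<Sigma> \<Gamma> B \<Longrightarrow> gder ct D \<Sigma> (add_mset B \<Gamma>') C \<Longrightarrow>
    gder ct D \<Sigma> (\<Gamma> + \<Gamma>') C"
| contrL: "gder ct D \<Sigma> (add_mset B (add_mset B \<Gamma>)) C \<Longrightarrow> gder ct D \<Sigma> (add_mset B \<Gamma>) C"
| topR: "gder ct D \<Sigma> \<Gamma> FTop"
| botL: "gder ct D \<Sigma> (add_mset FBot \<Gamma>) C"
| andL1: "gder ct D \<Sigma> (add_mset A \<Gamma>) C \<Longrightarrow> gder ct D \<Sigma> (add_mset (FAnd A B) \<Gamma>) C"
| andL2: "gder ct D \<Sigma> (add_mset B \<Gamma>) C \<Longrightarrow> gder ct D \<Sigma> (add_mset (FAnd A B) \<Gamma>) C"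
| andR: "gder ct D \<Sigma> \<Gamma> A \<Longrightarrow> gder ct D \<Sigma> \<Gamma> B \<Longrightarrow> gder ct D \<Sigma> \<Gamma> (FAnd A B)"
| orL: "gder ct D \<Sigma> (add_mset A \<Gamma>) C \<Longrightarrow> gder ct D \<Sigma> (add_mset B \<Gamma>) C \<Longrightarrow>
    gder ct D \<Sigma> (add_mset (FOr A B) \<Gamma>) C"
| orR1: "gder ct D \<Sigma> \<Gamma> A \<Longrightarrow> gder ct D \<Sigma> \<Gamma> (FOr A B)"
| orR2: "gder ct D \<Sigma> \<Gamma> B \<Longrightarrow> gder ct D \<Sigma> \<Gamma> (FOr A B)"
| impL: "gder ct D \<Sigma> \<Gamma> A \<Longrightarrow> gder ct D \<Sigma> (add_mset B \<Gamma>) C \<Longrightarrow>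
    gder ct D \<Sigma> (add_mset (FImp A B) \<Gamma>) C"
| impR: "gder ct D \<Sigma> (add_mset A \<Gamma>) B \<Longrightarrow> gder ct D \<Sigma> \<Gamma> (FImp A B)"
| allL: "has_type ct (mvt ct \<Sigma>) [] t \<tau> \<Longrightarrow> gder ct D \<Sigma> (add_mset (fsub (inst [t]) B) \<Gamma>) C \<Longrightarrow>
    gder ct D \<Sigma> (add_mset (FAll \<tau> B) \<Gamma>) C"
| allR: "distinct cs \<Longrightarrow> set cs = supp B \<Longrightarrow> h \<notin> \<Sigma> \<Longrightarrow> snd h = fun_ty (map snd cs) \<tau> \<Longrightarrow>
    gder ct D (insert h \<Sigma>) \<Gamma>
      (fsub (inst [apps (Par (Eig h)) (map (\<lambda>c. Par (Nom c)) cs)]) B) \<Longrightarrow>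
    gder ct D \<Sigma> \<Gamma> (FAll \<tau> B)"
| exL: "distinct cs \<Longrightarrow> set cs = supp B \<Longrightarrow> h \<notin> \<Sigma> \<Longrightarrow> snd h = fun_ty (map snd cs) \<tau> \<Longrightarrow>
    gder ct D (insert h \<Sigma>)
      (add_mset (fsub (inst [apps (Par (Eig h)) (map (\<lambda>c. Par (Nom c)) cs)]) B) \<Gamma>) C \<Longrightarrow>
    gder ct D \<Sigma> (add_mset (FEx \<tau> B) \<Gamma>) C"
| exR: "has_type ct (mvt ct \<Sigma>) [] t \<tau> \<Longrightarrow> gder ct D \<Sigma> \<Gamma> (fsub (inst [t]) B) \<Longrightarrow>
    gder ct D \<Sigma> \<Gamma> (FEx \<tau> B)"
| nabL: "a \<notin> supp B \<Longrightarrow> snd a = \<tau> \<Longrightarrow>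
    gder ct D \<Sigma> (add_mset (fsub (inst [Par (Nom a)]) B) \<Gamma>) C \<Longrightarrow>
    gder ct D \<Sigma> (add_mset (FNab \<tau> B) \<Gamma>) C"
| nabR: "a \<notin> supp B \<Longrightarrow> snd a = \<tau> \<Longrightarrow> gder ct D \<Sigma> \<Gamma> (fsub (inst [Par (Nom a)]) B) \<Longrightarrow>
    gder ct D \<Sigma> \<Gamma> (FNab \<tau> B)"
| naL: "N = FNA n s t \<Longrightarrow>
    (\<And>\<theta>. wf_subst ct \<Sigma> \<theta> \<Longrightarrow> na_holds ct (sig_subst \<Sigma> \<theta>) (ncas \<Sigma> \<theta> N) \<Longrightarrow>
      gder ct D (sig_subst \<Sigma> \<theta>) (image_mset (ncas \<Sigma> \<theta>) \<Gamma>) (ncas \<Sigma> \<theta> C)) \<Longrightarrow>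
    gder ct D \<Sigma> (add_mset N \<Gamma>) C"
| naR: "na_holds ct \<Sigma> N \<Longrightarrow> gder ct D \<Sigma> \<Gamma> N"
| defL: "D p = (k, \<tau>s, B) \<Longrightarrow> gder ct D \<Sigma> (add_mset (fsub (inst ts) B) \<Gamma>) C \<Longrightarrow>
    gder ct D \<Sigma> (add_mset (FAt p ts) \<Gamma>) C"
| defR: "D p = (k, \<tau>s, B) \<Longrightarrow> gder ct D \<Sigma> \<Gamma> (fsub (inst ts) B) \<Longrightarrow> gder ct D \<Sigma> \<Gamma> (FAt p ts)"
| IL: "D p = (Mu, \<tau>s, B) \<Longrightarrow> wf_form ct D {} \<tau>s S \<Longrightarrow> supp S = {} \<Longrightarrow>
    distinct hs \<Longrightarrow> map snd hs = \<tau>s \<Longrightarrow> xs = map (\<lambda>h. Par (Eig h)) hs \<Longrightarrow>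
    gder ct D (set hs) {#fsub (inst xs) (pred_subst p S B)#} (fsub (inst xs) S) \<Longrightarrow>
    gder ct D \<Sigma> (add_mset (fsub (inst ts) S) \<Gamma>) C \<Longrightarrow>
    gder ct D \<Sigma> (add_mset (FAt p ts) \<Gamma>) C"
| CIR: "D p = (Nu, \<tau>s, B) \<Longrightarrow> wf_form ct D {} \<tau>s S \<Longrightarrow> supp S = {} \<Longrightarrow>
    distinct hs \<Longrightarrow> map snd hs = \<tau>s \<Longrightarrow> xs = map (\<lambda>h. Par (Eig h)) hs \<Longrightarrow>
    gder ct D \<Sigma> \<Gamma> (fsub (inst ts) S) \<Longrightarrow>
    gder ct D (set hs) {#fsub (inst xs) S#} (fsub (inst xs) (pred_subst p S B)) \<Longrightarrow>
    gder ct D \<Sigma> \<Gamma> (FAt p ts)"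

definition provable ::
  "('k \<Rightarrow> 'b ty option) \<Rightarrow> ('p, 'k, 'b) defn \<Rightarrow> ('p, 'k, 'b) mform \<Rightarrow> bool" where
  "provable ct D F \<longleftrightarrow> gder ct D {} {#} F"

text \<open>A pattern clause \<open>(\<tau>s, ts, B)\<close> for \<open>p\<close> is \<open>\<forall>x\<^sub>0 \<dots>. p ts \<triangleq> B\<close>, where \<open>x\<^sub>i\<close> is \<open>Bd i\<close> and has
  type \<open>\<tau>s ! i\<close>. A list of such clauses is read as the single clause whose body is the disjunction
  of the formulas \<open>\<exists>x\<^sub>0 \<dots>. (t\<^sub>0 \<unrhd> y\<^sub>0 \<and> t\<^sub>1 \<unrhd> y\<^sub>1 \<and> \<dots>) \<and> B\<close>, the \<open>y\<^sub>j\<close> being the arguments of \<open>p\<close>.\<close>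
type_synonym ('p, 'k, 'b) pclause = "'b ty list \<times> ('k, 'b) mtm list \<times> ('p, 'k, 'b) mform"

definition clause_body :: "('p, 'k, 'b) pclause \<Rightarrow> ('p, 'k, 'b) mform" where
  "clause_body = (\<lambda>(\<tau>s, ts, B). fold FEx \<tau>s
    (FAnd (foldr FAnd (map (\<lambda>j. FNA 0 (ts ! j) (Bd (length \<tau>s + j))) [0..<length ts]) FTop) B))"

definition clauses_body :: "('p, 'k, 'b) pclause list \<Rightarrow> ('p, 'k, 'b) mform" where
  "clauses_body cls = foldr (\<lambda>cl F. FOr (clause_body cl) F) cls FBot"


section \<open>The encoding of the specification logic\<close>

datatype 'b mbase = Spec "'b sbase" | Frm | Nt | AtmList

type_synonym 'b mty = "'b mbase ty"

abbreviation atm :: "'b mty" where "atm \<equiv> Base (Spec SAtm)"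
abbreviation frm :: "'b mty" where "frm \<equiv> Base Frm"
abbreviation nt :: "'b mty" where "nt \<equiv> Base Nt"
abbreviation atmlist :: "'b mty" where "atmlist \<equiv> Base AtmList"

abbreviation psi_ty :: "'b sty \<Rightarrow> 'b mty" where
  "psi_ty \<equiv> map_ty Spec"

datatype ('c, 'b) mcon =
    SpecC 'c
  | CTop | COr | CAnd | CImp | CAll "'b sty" | CEx "'b sty" | CAt
  | CZ | CS | CNil | CCons

type_synonym ('c, 'b) gtm = "(('c, 'b) mcon, 'b mbase) mtm"

primrec msig ::
  "('c \<Rightarrow> 'b sty option) \<Rightarrow> 'b sty set \<Rightarrow> 'b sty set \<Rightarrow> ('c, 'b) mcon \<Rightarrow> 'b mty option" where
  "msig sg us es (SpecC c) = map_option psi_ty (sg c)"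
| "msig sg us es CTop = Some frm"
| "msig sg us es COr = Some (frm \<rightarrow>\<^sub>t frm \<rightarrow>\<^sub>t frm)"
| "msig sg us es CAnd = Some (frm \<rightarrow>\<^sub>t frm \<rightarrow>\<^sub>t frm)"
| "msig sg us es CImp = Some (atm \<rightarrow>\<^sub>t frm \<rightarrow>\<^sub>t frm)"
| "msig sg us es (CAll \<tau>) = (if \<tau> \<in> us then Some ((psi_ty \<tau> \<rightarrow>\<^sub>t frm) \<rightarrow>\<^sub>t frm) else None)"
| "msig sg us es (CEx \<tau>) = (if \<tau> \<in> es then Some ((psi_ty \<tau> \<rightarrow>\<^sub>t frm) \<rightarrow>\<^sub>t frm) else None)"
| "msig sg us es CAt = Some (atm \<rightarrow>\<^sub>t frm)"
| "msig sg us es CZ = Some nt"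
| "msig sg us es CS = Some (nt \<rightarrow>\<^sub>t nt)"
| "msig sg us es CNil = Some atmlist"
| "msig sg us es CCons = Some (atm \<rightarrow>\<^sub>t atmlist \<rightarrow>\<^sub>t atmlist)"

text \<open>The eigenvariable \<open>(i, \<tau>)\<close> is mapped to the nominal constant number \<open>\<nu> \<tau> i\<close> of type \<open>\<tau>\<close>.\<close>
definition psi_tm :: "('b sty \<Rightarrow> nat \<Rightarrow> nat) \<Rightarrow> ('c, 'b) stm \<Rightarrow> ('c, 'b) gtm" where
  "psi_tm \<nu> = map_tm SpecC (\<lambda>(i, \<tau>). Nom (\<nu> \<tau> i, psi_ty \<tau>)) Spec"

primrec psi_goal :: "('b sty \<Rightarrow> nat \<Rightarrow> nat) \<Rightarrow> ('c, 'b) goal \<Rightarrow> ('c, 'b) gtm" where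
  "psi_goal \<nu> GTop = Con CTop"
| "psi_goal \<nu> (GAtom A) = Con CAt \<cdot> psi_tm \<nu> A"
| "psi_goal \<nu> (GImp A G) = Con CImp \<cdot> psi_tm \<nu> A \<cdot> psi_goal \<nu> G"
| "psi_goal \<nu> (GAll \<tau> G) = Con (CAll \<tau>) \<cdot> Lam (psi_ty \<tau>) (psi_goal \<nu> G)"
| "psi_goal \<nu> (GEx \<tau> G) = Con (CEx \<tau>) \<cdot> Lam (psi_ty \<tau>) (psi_goal \<nu> G)"
| "psi_goal \<nu> (GAnd G H) = Con CAnd \<cdot> psi_goal \<nu> G \<cdot> psi_goal \<nu> H"
| "psi_goal \<nu> (GOr G H) = Con COr \<cdot> psi_goal \<nu> G \<cdot> psi_goal \<nu> H"

text \<open>The last element of the list ends up at the head.\<close>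
definition psi_atoms :: "('b sty \<Rightarrow> nat \<Rightarrow> nat) \<Rightarrow> ('c, 'b) stm list \<Rightarrow> ('c, 'b) gtm" where
  "psi_atoms \<nu> As = foldl (\<lambda>l A. Con CCons \<cdot> psi_tm \<nu> A \<cdot> l) (Con CNil) As"

fun conj_goals :: "('c, 'b) goal list \<Rightarrow> ('c, 'b) goal" where
  "conj_goals [] = GTop"
| "conj_goals [G] = G"
| "conj_goals (G # Gs) = GAnd G (conj_goals Gs)"

datatype pred = Nat | Member | Seq | Prog

type_synonym ('c, 'b) gclause = "(pred, ('c, 'b) mcon, 'b mbase) pclause"

definition nat_clauses :: "('c, 'b) gclause list" where
  "nat_clauses =
    [([], [Con CZ], FTop),
     ([nt], [Con CS \<cdot> Bd 0], FAt Nat [Bd 0])]"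

text \<open>The second clause is the list membership clause \<open>member A (B :: L) = member A L\<close>. With
  \<open>member B L\<close> on the right, \<open>member A\<close> would fail on \<open>B :: A :: nil\<close> for \<open>A \<noteq> B\<close> and succeed on
  \<open>B :: B :: nil\<close>, and the encoding would be neither complete nor sound.\<close>
definition member_clauses :: "('c, 'b) gclause list" where
  "member_clauses =
    [([atm, atmlist], [Bd 0, Con CCons \<cdot> Bd 0 \<cdot> Bd 1], FTop),
     ([atm, atm, atmlist], [Bd 0, Con CCons \<cdot> Bd 1 \<cdot> Bd 2], FAt Member [Bd 0, Bd 2])]"

text \<open>In all clauses \<open>Bd 0\<close> is \<open>N\<close> and \<open>Bd 1\<close> is \<open>L\<close>, shifted by one below a quantifier. The clauses
  for the quantifiers of the specification logic are schematic in the type of the quantified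
  variable; there is one instance for each of the listed types.\<close>
definition seq_clauses :: "'b sty list \<Rightarrow> 'b sty list \<Rightarrow> ('c, 'b) gclause list" where
  "seq_clauses us es =
    [([nt, atmlist], [Con CS \<cdot> Bd 0, Bd 1, Con CTop], FTop),
     ([nt, atmlist, frm, frm], [Con CS \<cdot> Bd 0, Bd 1, Con COr \<cdot> Bd 2 \<cdot> Bd 3],
       FAt Seq [Bd 0, Bd 1, Bd 2]),
     ([nt, atmlist, frm, frm], [Con CS \<cdot> Bd 0, Bd 1, Con COr \<cdot> Bd 2 \<cdot> Bd 3],
       FAt Seq [Bd 0, Bd 1, Bd 3]),
     ([nt, atmlist, frm, frm], [Con CS \<cdot> Bd 0, Bd 1, Con CAnd \<cdot> Bd 2 \<cdot> Bd 3],
       FAnd (FAt Seq [Bd 0, Bd 1, Bd 2]) (FAt Seq [Bd 0, Bd 1, Bd 3])),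
     ([nt, atmlist, atm, frm], [Con CS \<cdot> Bd 0, Bd 1, Con CImp \<cdot> Bd 2 \<cdot> Bd 3],
       FAt Seq [Bd 0, Con CCons \<cdot> Bd 2 \<cdot> Bd 1, Bd 3])] @
    map (\<lambda>\<tau>. ([nt, atmlist, psi_ty \<tau> \<rightarrow>\<^sub>t frm], [Con CS \<cdot> Bd 0, Bd 1, Con (CAll \<tau>) \<cdot> Bd 2],
       FNab (psi_ty \<tau>) (FAt Seq [Bd 1, Bd 2, Bd 3 \<cdot> Bd 0]))) us @
    map (\<lambda>\<tau>. ([nt, atmlist, psi_ty \<tau> \<rightarrow>\<^sub>t frm], [Con CS \<cdot> Bd 0, Bd 1, Con (CEx \<tau>) \<cdot> Bd 2],
       FEx (psi_ty \<tau>) (FAt Seq [Bd 1, Bd 2, Bd 3 \<cdot> Bd 0]))) es @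
    [([nt, atmlist, atm], [Con CS \<cdot> Bd 0, Bd 1, Con CAt \<cdot> Bd 2], FAt Member [Bd 2, Bd 1]),
     ([nt, atmlist, atm], [Con CS \<cdot> Bd 0, Bd 1, Con CAt \<cdot> Bd 2],
       FEx frm (FAnd (FAt Prog [Bd 3, Bd 0]) (FAt Seq [Bd 1, Bd 2, Bd 0])))]"

definition prog_clauses ::
  "('b sty \<Rightarrow> nat \<Rightarrow> nat) \<Rightarrow> ('c, 'b) dclause list \<Rightarrow> ('c, 'b) gclause list" where
  "prog_clauses \<nu> \<Delta> = map (\<lambda>D. case flat D of (\<tau>s, Gs, A) \<Rightarrow>
      (map psi_ty \<tau>s, [psi_tm \<nu> A, psi_goal \<nu> (conj_goals Gs)], FTop)) \<Delta>"

primrec spec_defn ::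
  "('b sty \<Rightarrow> nat \<Rightarrow> nat) \<Rightarrow> 'b sty list \<Rightarrow> 'b sty list \<Rightarrow> ('c, 'b) dclause list \<Rightarrow>
   (pred, ('c, 'b) mcon, 'b mbase) defn" where
  "spec_defn \<nu> us es \<Delta> Nat = (Mu, [nt], clauses_body nat_clauses)"
| "spec_defn \<nu> us es \<Delta> Member = (Mu, [atm, atmlist], clauses_body member_clauses)"
| "spec_defn \<nu> us es \<Delta> Seq = (Mu, [nt, atmlist, frm], clauses_body (seq_clauses us es))"
| "spec_defn \<nu> us es \<Delta> Prog = (Plain, [atm, frm], clauses_body (prog_clauses \<nu> \<Delta>))"

definition entails ::
  "('c, 'b) gtm \<Rightarrow> ('c, 'b) gtm \<Rightarrow> (pred, ('c, 'b) mcon, 'b mbase) mform"  (infix "\<rhd>" 50) where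
  "l \<rhd> g = FEx nt (FAnd (FAt Nat [Bd 0]) (FAt Seq [Bd 0, ren Suc l, ren Suc g]))"

end

theory Submission
  imports Defs
begin

text \<open>Completeness of the encoding is an induction on the derivation in the specification logic: a goal
  is derivable by \<open>seq\<close> with every sufficiently large height.

  Soundness avoids cut elimination for the meta-logic. Formulas are interpreted classically in a term
  model: quantifiers range over closed terms, which may contain nominal constants, \<open>\<nabla>\<close> means truth for
  cofinitely many nominal constants, and the defined predicates denote the least fixed point of their
  clauses. All rules preserve truth, cut trivially and the induction rule because the fixed point is the
  least one. By induction on that fixed point, truth of \<open>seq\<close> for an encoded goal yields a derivation in
  the specification logic; here a retraction maps the terms of the meta-logic back to terms of the
  specification logic, and constants are shown to be injective modulo conversion by a logical relation.\<close>

section \<open>Homomorphisms of terms\<close>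

text \<open>The eigenvariables of a sequent are assigned closed terms, and these may contain nominal
  constants that also occur in its formulas. Literal substitution would capture them, so the
  constants of a formula are renamed away from the assigned terms. The initial rule relates a
  formula to its permuted copies, so the renaming is chosen formula by formula; equivariance of the
  model makes all fresh choices agree, and one choice can then serve a whole sequent. Truth must
  respect conversion too: an eigenvariable raised over the support is interpreted by an abstraction,
  which returns the intended value only after \<beta>-steps. The way back meets a mismatch: an
  instance found in the model may contain nominal constants that stand for no eigenvariable.
  Specification goals are therefore kept as syntax with a valuation of their bound indices, and only
  the values are retracted. For \<forall>, a fresh constant is redirected to a fresh eigenvariable.
  The extra base types go to \<open>SAtm \<rightarrow>\<^sub>t SAtm\<close> because this type is
  inhabited whatever the signature is.\<close>

primrec bind_ty :: "('b \<Rightarrow> 'd ty) \<Rightarrow> 'b ty \<Rightarrow> 'd ty" where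
  "bind_ty \<beta> (Base b) = \<beta> b"
| "bind_ty \<beta> (\<sigma> \<rightarrow>\<^sub>t \<tau>) = bind_ty \<beta> \<sigma> \<rightarrow>\<^sub>t bind_ty \<beta> \<tau>"

lemma bind_ty_Base [simp]: "bind_ty Base \<tau> = \<tau>"
  by (induction \<tau>) auto

lemma bind_ty_bind_ty: "bind_ty \<gamma> (bind_ty \<beta> \<tau>) = bind_ty (\<lambda>b. bind_ty \<gamma> (\<beta> b)) \<tau>"
  by (induction \<tau>) auto

lemma map_ty_eq_bind_ty: "map_ty f \<tau> = bind_ty (\<lambda>b. Base (f b)) \<tau>"
  by (induction \<tau>) auto

text \<open>Renaming, substitution, abstraction over a parameter, the encoding and the retraction
  are all instances, so typing, conversion and fusion are treated once. Base types may go to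
  compound types, as the retraction requires. Images of constants and parameters are lifted below
  \<open>Lam\<close> because they may contain loose indices.\<close>

primrec hom :: "('b \<Rightarrow> 'd ty) \<Rightarrow> ('k \<Rightarrow> ('l, 'w, 'd) tm) \<Rightarrow> ('v \<Rightarrow> ('l, 'w, 'd) tm) \<Rightarrow>
    (nat \<Rightarrow> ('l, 'w, 'd) tm) \<Rightarrow> ('k, 'v, 'b) tm \<Rightarrow> ('l, 'w, 'd) tm" where
  "hom \<beta> \<kappa> \<theta> \<sigma> (Con c) = \<kappa> c"
| "hom \<beta> \<kappa> \<theta> \<sigma> (Par v) = \<theta> v"
| "hom \<beta> \<kappa> \<theta> \<sigma> (Bd i) = \<sigma> i"
| "hom \<beta> \<kappa> \<theta> \<sigma> (t \<cdot> u) = hom \<beta> \<kappa> \<theta> \<sigma> t \<cdot> hom \<beta> \<kappa> \<theta> \<sigma> u"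
| "hom \<beta> \<kappa> \<theta> \<sigma> (Lam \<tau> t) = Lam (bind_ty \<beta> \<tau>)
    (hom \<beta> (\<lambda>c. ren Suc (\<kappa> c)) (\<lambda>v. ren Suc (\<theta> v)) (up \<sigma>) t)"

lemma up_0 [simp]: "up \<sigma> 0 = Bd 0"
  and up_Suc [simp]: "up \<sigma> (Suc i) = ren Suc (\<sigma> i)"
  by (simp_all add: up_def)

section \<open>Fusion laws for homomorphisms\<close>

lemma up_Bd_comp: "up (\<lambda>i. Bd (r i)) = (\<lambda>i. Bd (case_nat 0 (\<lambda>i. Suc (r i)) i))"
  by (auto simp: up_def fun_eq_iff split: nat.split)

lemma up_Bd [simp]: "up Bd = Bd"
  by (auto simp: up_def fun_eq_iff split: nat.split)

lemma ren_eq_hom: "ren r t = hom Base Con Par (\<lambda>i. Bd (r i)) t"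
  by (induction t arbitrary: r) (simp_all add: up_Bd_comp)

lemma sub_eq_hom: "sub \<sigma> t = hom Base Con Par \<sigma> t"
  by (induction t arbitrary: \<sigma>) simp_all

lemma hom_ren: "hom \<beta> \<kappa> \<theta> \<sigma> (ren r t) = hom \<beta> \<kappa> \<theta> (\<lambda>i. \<sigma> (r i)) t"
proof (induction t arbitrary: \<kappa> \<theta> \<sigma> r)
  case (Lam \<tau> t)
  have "(\<lambda>i. up \<sigma> (case_nat 0 (\<lambda>i. Suc (r i)) i)) = up (\<lambda>i. \<sigma> (r i))"
    by (auto simp: up_def fun_eq_iff split: nat.split)
  then show ?case by (simp add: Lam)
qed simp_all

lemma ren_ren: "ren r (ren s t) = ren (\<lambda>i. r (s i)) t"
  unfolding ren_eq_hom[of r] ren_eq_hom[of "\<lambda>i. r (s i)"] by (rule hom_ren)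

lemma ren_hom:
  "ren r (hom \<beta> \<kappa> \<theta> \<sigma> t) = hom \<beta> (\<lambda>c. ren r (\<kappa> c)) (\<lambda>v. ren r (\<theta> v)) (\<lambda>i. ren r (\<sigma> i)) t"
proof (induction t arbitrary: \<kappa> \<theta> \<sigma> r)
  case (Lam \<tau> t)
  have "(\<lambda>i. ren (case_nat 0 (\<lambda>i. Suc (r i))) (up \<sigma> i)) = up (\<lambda>i. ren r (\<sigma> i))"
    by (auto simp: up_def fun_eq_iff ren_ren split: nat.split)
  then show ?case by (simp add: Lam ren_ren)
qed simp_all

text \<open>The binder case of fusion and of \<eta>: a lifted homomorphism applied to a shifted term
  never meets the new index.\<close>

lemma hom_lift_ren_Suc:
  "hom \<beta> (\<lambda>c. ren Suc (\<kappa> c)) (\<lambda>v. ren Suc (\<theta> v)) (up \<sigma>) (ren Suc t) = ren Suc (hom \<beta> \<kappa> \<theta> \<sigma> t)"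
  by (simp add: hom_ren ren_hom)

text \<open>The composition law behind the commutation lemmas below. Renaming has to be fused
  beforehand, in both orders, because lifting is itself defined by renaming.\<close>

lemma hom_hom:
  "hom \<gamma> \<kappa>' \<theta>' \<sigma>' (hom \<beta> \<kappa> \<theta> \<sigma> t) =
    hom (\<lambda>b. bind_ty \<gamma> (\<beta> b)) (\<lambda>c. hom \<gamma> \<kappa>' \<theta>' \<sigma>' (\<kappa> c)) (\<lambda>v. hom \<gamma> \<kappa>' \<theta>' \<sigma>' (\<theta> v))
      (\<lambda>i. hom \<gamma> \<kappa>' \<theta>' \<sigma>' (\<sigma> i)) t"
proof (induction t arbitrary: \<kappa> \<theta> \<sigma> \<kappa>' \<theta>' \<sigma>')
  case (Lam \<tau> t)
  have "(\<lambda>i. hom \<gamma> (\<lambda>c. ren Suc (\<kappa>' c)) (\<lambda>v. ren Suc (\<theta>' v)) (up \<sigma>') (up \<sigma> i)) =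
      up (\<lambda>i. hom \<gamma> \<kappa>' \<theta>' \<sigma>' (\<sigma> i))"
    by (auto simp: up_def fun_eq_iff hom_lift_ren_Suc[unfolded up_def] split: nat.split)
  then show ?case by (simp add: Lam hom_lift_ren_Suc bind_ty_bind_ty)
qed simp_all

lemma hom_sub: "hom \<beta> \<kappa> \<theta> \<sigma> (sub \<tau> t) = hom \<beta> \<kappa> \<theta> (\<lambda>i. hom \<beta> \<kappa> \<theta> \<sigma> (\<tau> i)) t"
  by (simp add: sub_eq_hom hom_hom)

lemma sub_hom:
  "sub \<tau> (hom \<beta> \<kappa> \<theta> \<sigma> t) = hom \<beta> (\<lambda>c. sub \<tau> (\<kappa> c)) (\<lambda>v. sub \<tau> (\<theta> v)) (\<lambda>i. sub \<tau> (\<sigma> i)) t"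
  by (simp add: sub_eq_hom hom_hom)

lemma sub_sub: "sub \<tau> (sub \<sigma> t) = sub (\<lambda>i. sub \<tau> (\<sigma> i)) t"
  by (simp add: sub_eq_hom hom_hom)

lemma sub_ren: "sub \<sigma> (ren r t) = sub (\<lambda>i. \<sigma> (r i)) t"
  by (simp add: sub_eq_hom hom_ren)

lemma ren_sub: "ren r (sub \<sigma> t) = sub (\<lambda>i. ren r (\<sigma> i)) t"
  by (simp add: sub_eq_hom ren_hom)

lemma sub_Bd [simp]: "sub Bd t = t"
  by (induction t) simp_all

lemma hom_id [simp]: "hom Base Con Par Bd t = t"
  using sub_Bd by (simp add: sub_eq_hom)

lemma ren_eq_sub: "ren r t = sub (\<lambda>i. Bd (r i)) t"
  by (simp add: ren_eq_hom sub_eq_hom)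

lemma inst_Nil [simp]: "inst [] = Bd"
  by (auto simp: inst_def)

lemma inst_Cons: "inst (t # ts) = case_nat t (inst ts)"
  by (auto simp: inst_def fun_eq_iff split: nat.split)

lemma sub_inst_ren_Suc [simp]: "sub (inst [u]) (ren Suc t) = t"
  by (simp add: sub_ren inst_Cons)

text \<open>Homomorphisms commute with the contraction of a \<beta>-redex; this is the case that
  makes them preserve conversion.\<close>

lemma hom_inst:
  "hom \<beta> \<kappa> \<theta> \<sigma> (sub (inst [u]) t) =
    sub (inst [hom \<beta> \<kappa> \<theta> \<sigma> u]) (hom \<beta> (\<lambda>c. ren Suc (\<kappa> c)) (\<lambda>v. ren Suc (\<theta> v)) (up \<sigma>) t)"
proof -
  have "(\<lambda>i. hom \<beta> \<kappa> \<theta> \<sigma> (inst [u] i)) = (\<lambda>i. sub (inst [hom \<beta> \<kappa> \<theta> \<sigma> u]) (up \<sigma> i))"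
    by (auto simp: fun_eq_iff inst_Cons up_def sub_ren split: nat.split)
  then show ?thesis by (simp add: hom_sub sub_hom)
qed

lemma sub_inst_up: "sub (inst [u]) (sub (up \<sigma>) t) = sub (case_nat u \<sigma>) t"
proof -
  have "(\<lambda>i. sub (inst [u]) (up \<sigma> i)) = case_nat u \<sigma>"
    by (auto simp: fun_eq_iff inst_Cons up_def sub_ren split: nat.split)
  then show ?thesis by (simp add: sub_sub)
qed

lemma map_tm_eq_hom: "map_tm f g h t = hom (\<lambda>b. Base (h b)) (\<lambda>c. Con (f c)) (\<lambda>v. Par (g v)) Bd t"
  by (induction t) (simp_all add: map_ty_eq_bind_ty)

lemma up_shift_at:
  "up (\<lambda>i. if i < k then Bd i else Bd (Suc i)) = (\<lambda>i. if i < Suc k then Bd i else Bd (Suc i))"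
  by (auto simp: up_def fun_eq_iff split: nat.split)

lemma ren_Suc_Par_upd:
  "(\<lambda>w. ren Suc (if w = v then Bd k else Par w)) = (\<lambda>w. if w = v then Bd (Suc k) else Par w)"
  by auto

text \<open>As a homomorphism, abstraction over a parameter inherits compatibility with conversion
  and fusion with valuations. The parameter goes to an open term, the index
  \<open>k\<close>.\<close>

lemma close_par_eq_hom:
  "close_par v k t = hom Base Con (\<lambda>w. if w = v then Bd k else Par w)
    (\<lambda>i. if i < k then Bd i else Bd (Suc i)) t"
proof (induction t arbitrary: k)
  case (Lam \<tau> t)
  show ?case
    by (simp only: Lam close_par.simps hom.simps bind_ty_Base ren.simps up_shift_at ren_Suc_Par_upd)
qed auto


section \<open>Typing\<close>

inductive_cases has_type_ConE: "has_type ct vt E (Con c) \<tau>"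
inductive_cases has_type_ParE: "has_type ct vt E (Par v) \<tau>"
inductive_cases has_type_BdE: "has_type ct vt E (Bd i) \<tau>"
inductive_cases has_type_AppE: "has_type ct vt E (t \<cdot> u) \<tau>"
inductive_cases has_type_LamE: "has_type ct vt E (Lam \<sigma> t) \<tau>"

lemma has_type_Bd_iff: "has_type ct vt E (Bd i) \<tau> \<longleftrightarrow> i < length E \<and> \<tau> = E ! i"
  by (auto intro: has_type.intros elim: has_type.cases)

lemma has_type_Con_iff: "has_type ct vt E (Con c) \<tau> \<longleftrightarrow> ct c = Some \<tau>"
  by (auto intro: has_type.intros elim: has_type.cases)

lemma has_type_Par_iff: "has_type ct vt E (Par v) \<tau> \<longleftrightarrow> vt v = Some \<tau>"
  by (auto intro: has_type.intros elim: has_type.cases)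

lemma has_type_App_iff:
  "has_type ct vt E (t \<cdot> u) \<tau> \<longleftrightarrow> (\<exists>\<sigma>. has_type ct vt E t (\<sigma> \<rightarrow>\<^sub>t \<tau>) \<and> has_type ct vt E u \<sigma>)"
  by (auto intro: has_type.intros elim: has_type.cases)

lemma has_type_Lam_iff:
  "has_type ct vt E (Lam \<sigma> t) \<tau> \<longleftrightarrow> (\<exists>\<tau>'. \<tau> = \<sigma> \<rightarrow>\<^sub>t \<tau>' \<and> has_type ct vt (\<sigma> # E) t \<tau>')"
  by (auto intro: has_type.intros elim: has_type.cases)

lemmas has_type_iffs =
  has_type_Bd_iff has_type_Con_iff has_type_Par_iff has_type_App_iff has_type_Lam_iff

lemma has_type_unique: "has_type ct vt E t \<tau> \<Longrightarrow> has_type ct vt E t \<tau>' \<Longrightarrow> \<tau> = \<tau>'"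
proof (induction arbitrary: \<tau>' rule: has_type.induct)
  case (4 E t \<sigma> \<tau> u)
  then show ?case by (metis has_type_AppE ty.inject(2))
next
  case (5 \<sigma> E t \<tau>)
  then show ?case by (metis has_type_LamE)
qed (auto simp: has_type_Bd_iff has_type_Con_iff has_type_Par_iff)

lemma has_type_pars: "has_type ct vt E t \<tau> \<Longrightarrow> v \<in> pars t \<Longrightarrow> vt v \<noteq> None"
  by (induction rule: has_type.induct) auto

lemma has_type_ren:
  "has_type ct vt E t \<tau> \<Longrightarrow> (\<And>i. i < length E \<Longrightarrow> r i < length E' \<and> E' ! r i = E ! i) \<Longrightarrow>
    has_type ct vt E' (ren r t) \<tau>"
proof (induction arbitrary: E' r rule: has_type.induct)
  case (4 E t \<sigma> \<tau> u)
  show ?case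
    unfolding ren.simps using 4(3)[of r E'] 4(4)[of r E'] 4(5) has_type.intros(4) by blast
next
  case (5 \<sigma> E t \<tau>)
  show ?case
    using 5(3) by (auto simp: has_type_Lam_iff less_Suc_eq_0_disj intro!: 5(2) split: nat.split)
qed (auto simp: has_type_iffs)

lemma has_type_ren_Suc: "has_type ct vt E t \<tau> \<Longrightarrow> has_type ct vt (\<sigma> # E) (ren Suc t) \<tau>"
  by (erule has_type_ren) auto

text \<open>Typing bounds the loose indices: only those below \<open>length E\<close> are inspected,
  so terms typed in the empty context ignore the index environment altogether.\<close>

lemma hom_cong_typed:
  assumes "has_type ct vt E t \<tau>"
    and "\<And>c. c \<in> cons t \<Longrightarrow> \<kappa> c = \<kappa>' c" and "\<And>v. v \<in> pars t \<Longrightarrow> \<theta> v = \<theta>' v"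
    and "\<And>i. i < length E \<Longrightarrow> \<sigma> i = \<sigma>' i"
  shows "hom \<beta> \<kappa> \<theta> \<sigma> t = hom \<beta> \<kappa>' \<theta>' \<sigma>' t"
  using assms
proof (induction arbitrary: \<kappa> \<theta> \<sigma> \<kappa>' \<theta>' \<sigma>' rule: has_type.induct)
  case (4 E t \<sigma>'' \<tau> u)
  show ?case unfolding hom.simps using 4(3)[of \<kappa> \<kappa>' \<theta> \<theta>' \<sigma> \<sigma>'] 4(4)[of \<kappa> \<kappa>' \<theta> \<theta>' \<sigma> \<sigma>'] 4(5-) by simp
next
  case (5 \<sigma>'' E t \<tau>)
  show ?case
    using 5(3-) by (auto simp: less_Suc_eq_0_disj up_def intro!: 5(2) split: nat.split)
qed auto

lemma hom_cong_pars:
  "(\<And>v. v \<in> pars t \<Longrightarrow> \<theta> v = \<theta>' v) \<Longrightarrow> hom \<beta> \<kappa> \<theta> \<sigma> t = hom \<beta> \<kappa> \<theta>' \<sigma> t"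
proof (induction t arbitrary: \<kappa> \<theta> \<sigma> \<theta>')
  case (Lam \<tau> t)
  show ?case by (auto intro!: Lam.IH simp: Lam.prems)
next
  case (App t u)
  show ?case
    unfolding hom.simps using App(1)[of \<theta> \<theta>' \<kappa> \<sigma>] App(2)[of \<theta> \<theta>' \<kappa> \<sigma>] App(3) by simp
qed auto

lemma sub_cong_typed:
  "has_type ct vt E t \<tau> \<Longrightarrow> (\<And>i. i < length E \<Longrightarrow> \<sigma> i = \<sigma>' i) \<Longrightarrow> sub \<sigma> t = sub \<sigma>' t"
  unfolding sub_eq_hom by (rule hom_cong_typed) auto

lemma ren_closed: "has_type ct vt [] t \<tau> \<Longrightarrow> ren r t = t"
  unfolding ren_eq_sub using sub_cong_typed[of ct vt "[]" t \<tau> _ Bd] by simp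

lemma has_type_append: "has_type ct vt E t \<tau> \<Longrightarrow> has_type ct vt (E @ E') t \<tau>"
  using has_type_ren[of ct vt E t \<tau> "\<lambda>i. i" "E @ E'"] by (simp add: ren_eq_sub nth_append)

lemma has_type_weaken_closed: "has_type ct vt [] t \<tau> \<Longrightarrow> has_type ct vt E t \<tau>"
  using has_type_append[of ct vt "[]" t \<tau> E] by simp

lemma has_type_mono:
  "has_type ct vt E t \<tau> \<Longrightarrow> (\<And>v \<tau>. vt v = Some \<tau> \<Longrightarrow> vt' v = Some \<tau>) \<Longrightarrow> has_type ct vt' E t \<tau>"
  by (induction rule: has_type.induct) (auto intro: has_type.intros)

lemma has_type_hom:
  assumes "has_type ct vt E t \<tau>"
    and "\<And>c \<tau>. ct c = Some \<tau> \<Longrightarrow> has_type ct' vt' E' (\<kappa> c) (bind_ty \<beta> \<tau>)"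
    and "\<And>v \<tau>. vt v = Some \<tau> \<Longrightarrow> has_type ct' vt' E' (\<theta> v) (bind_ty \<beta> \<tau>)"
    and "\<And>i. i < length E \<Longrightarrow> has_type ct' vt' E' (\<sigma> i) (bind_ty \<beta> (E ! i))"
  shows "has_type ct' vt' E' (hom \<beta> \<kappa> \<theta> \<sigma> t) (bind_ty \<beta> \<tau>)"
  using assms
proof (induction arbitrary: E' \<kappa> \<theta> \<sigma> rule: has_type.induct)
  case (4 E t \<sigma>' \<tau> u)
  show ?case
    unfolding hom.simps has_type_App_iff
    using 4(3)[of E' \<kappa> \<theta> \<sigma>] 4(4)[of E' \<kappa> \<theta> \<sigma>] 4(5-) by auto
next
  case (5 \<sigma>' E t \<tau>)
  show ?case
    using 5(3-) by (auto simp: has_type_iffs less_Suc_eq_0_disj up_def intro!: 5(2) has_type_ren_Suc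
        split: nat.split)
qed auto

lemma has_type_sub:
  assumes "has_type ct vt E t \<tau>" and "\<And>i. i < length E \<Longrightarrow> has_type ct vt E' (\<sigma> i) (E ! i)"
  shows "has_type ct vt E' (sub \<sigma> t) \<tau>"
  using has_type_hom[of ct vt E t \<tau> ct vt E' Con Base Par \<sigma>] assms
  by (simp add: sub_eq_hom has_type_iffs)

lemma has_type_inst:
  "has_type ct vt (\<sigma> # E) t \<tau> \<Longrightarrow> has_type ct vt E u \<sigma> \<Longrightarrow> has_type ct vt E (sub (inst [u]) t) \<tau>"
  by (erule has_type_sub) (auto simp: inst_def less_Suc_eq_0_disj has_type_Bd_iff)

section \<open>Conversion and its preservation by homomorphisms\<close>

lemma conv_has_type: "conv ct vt E t u \<tau> \<Longrightarrow> has_type ct vt E t \<tau> \<and> has_type ct vt E u \<tau>"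
proof (induction rule: conv.induct)
  case (app E t t' \<sigma> \<tau> u u')
  then show ?case by (auto intro: has_type.intros)
next
  case (beta \<sigma> E t \<tau> u)
  then show ?case by (auto simp: has_type_iffs intro: has_type_inst)
next
  case (eta E t \<sigma> \<tau>)
  then show ?case by (auto simp: has_type_iffs intro!: exI[of _ \<sigma>] has_type_ren_Suc)
qed (auto simp: has_type_iffs)

lemma conv_type_unique:
  "conv ct vt E t u \<tau> \<Longrightarrow> has_type ct vt E t \<sigma> \<or> has_type ct vt E u \<sigma> \<Longrightarrow> \<sigma> = \<tau>"
  using conv_has_type has_type_unique by metis

lemma conv_ren:
  "conv ct vt E t u \<tau> \<Longrightarrow> (\<And>i. i < length E \<Longrightarrow> r i < length E' \<and> E' ! r i = E ! i) \<Longrightarrow>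
    conv ct vt E' (ren r t) (ren r u) \<tau>"
proof (induction arbitrary: E' r rule: conv.induct)
  case (refl E t \<tau>)
  show ?case by (rule conv.refl, rule has_type_ren[OF refl(1)]) (use refl(2) in auto)
next
  case (sym E t u \<tau>)
  show ?case by (rule conv.sym, rule sym.IH) (use sym.prems in auto)
next
  case (trans E t u \<tau> v)
  show ?case
    by (rule conv.trans, rule trans.IH(1), use trans.prems in auto, rule trans.IH(2), use trans.prems in auto)
next
  case (app E t t' \<sigma> \<tau> u u')
  show ?case
    unfolding ren.simps using app.IH(1)[of r E'] app.IH(2)[of r E'] app.prems conv.app by blast
next
  case (lam \<sigma> E t t' \<tau>)
  show ?case
    using lam.prems by (auto simp: less_Suc_eq_0_disj intro!: conv.lam lam.IH split: nat.split)
next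
  case (beta \<sigma> E t \<tau> u)
  let ?r = "case_nat 0 (\<lambda>i. Suc (r i))"
  have "has_type ct vt (\<sigma> # E') (ren ?r t) \<tau>"
    using beta by (auto simp: less_Suc_eq_0_disj elim!: has_type_ren split: nat.split)
  moreover have "has_type ct vt E' (ren r u) \<sigma>"
    using beta(3-) by (auto intro!: has_type_ren[OF beta(2)])
  ultimately have "conv ct vt E' (Lam \<sigma> (ren ?r t) \<cdot> ren r u) (sub (inst [ren r u]) (ren ?r t)) \<tau>"
    by (rule conv.beta)
  moreover have "sub (inst [ren r u]) (ren ?r t) = ren r (sub (inst [u]) t)"
    using hom_inst[of Base Con Par "\<lambda>i. Bd (r i)" u t]
    by (simp add: ren_eq_hom up_Bd_comp)
  ultimately show ?case by simp
next
  case (eta E t \<sigma> \<tau>)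
  then have "has_type ct vt E' (ren r t) (\<sigma> \<rightarrow>\<^sub>t \<tau>)" by (intro has_type_ren)
  from conv.eta[OF this] show ?case by (simp add: ren_ren)
qed

lemma conv_ren_Suc: "conv ct vt E t u \<tau> \<Longrightarrow> conv ct vt (\<sigma> # E) (ren Suc t) (ren Suc u) \<tau>"
  by (erule conv_ren) auto

text \<open>The term is fixed and the images vary up to conversion, so an induction on typing
  suffices. In \<open>hom_conv\<close> the roles are exchanged.\<close>

lemma hom_conv_cong:
  assumes "has_type ct vt E t \<tau>"
    and "\<And>c \<tau>. ct c = Some \<tau> \<Longrightarrow> conv ct' vt' E' (\<kappa> c) (\<kappa>' c) (bind_ty \<beta> \<tau>)"
    and "\<And>v \<tau>. vt v = Some \<tau> \<Longrightarrow> conv ct' vt' E' (\<theta> v) (\<theta>' v) (bind_ty \<beta> \<tau>)"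
    and "\<And>i. i < length E \<Longrightarrow> conv ct' vt' E' (\<sigma> i) (\<sigma>' i) (bind_ty \<beta> (E ! i))"
  shows "conv ct' vt' E' (hom \<beta> \<kappa> \<theta> \<sigma> t) (hom \<beta> \<kappa>' \<theta>' \<sigma>' t) (bind_ty \<beta> \<tau>)"
  using assms
proof (induction arbitrary: E' \<kappa> \<theta> \<sigma> \<kappa>' \<theta>' \<sigma>' rule: has_type.induct)
  case (4 E t \<sigma>'' \<tau> u)
  show ?case
    unfolding hom.simps
    by (rule conv.app[where \<sigma> = "bind_ty \<beta> \<sigma>''"], rule 4(3)[unfolded bind_ty.simps], use 4(5-) in auto,
        rule 4(4), use 4(5-) in auto)
next
  case (5 \<sigma>'' E t \<tau>)
  show ?case
    using 5(3-) by (auto simp: less_Suc_eq_0_disj up_def has_type_Bd_iff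
        intro!: 5(2) conv_ren_Suc conv.lam conv.refl split: nat.split)
qed auto

text \<open>Each conversion step is mapped to a step of the same kind: \<beta> by
  \<open>hom_inst\<close>, \<eta> by \<open>hom_lift_ren_Suc\<close>. Preservation by permutations,
  the encoding and the retraction are special cases.\<close>

lemma hom_conv:
  assumes "conv ct vt E t u \<tau>"
    and "\<And>c \<tau>. ct c = Some \<tau> \<Longrightarrow> has_type ct' vt' E' (\<kappa> c) (bind_ty \<beta> \<tau>)"
    and "\<And>v \<tau>. vt v = Some \<tau> \<Longrightarrow> has_type ct' vt' E' (\<theta> v) (bind_ty \<beta> \<tau>)"
    and "\<And>i. i < length E \<Longrightarrow> has_type ct' vt' E' (\<sigma> i) (bind_ty \<beta> (E ! i))"
  shows "conv ct' vt' E' (hom \<beta> \<kappa> \<theta> \<sigma> t) (hom \<beta> \<kappa> \<theta> \<sigma> u) (bind_ty \<beta> \<tau>)"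
  using assms
proof (induction arbitrary: E' \<kappa> \<theta> \<sigma> rule: conv.induct)
  case (refl E t \<tau>)
  show ?case by (rule conv.refl, rule has_type_hom[OF refl(1)]) (use refl(2-) in auto)
next
  case (sym E t u \<tau>)
  show ?case by (rule conv.sym, rule sym.IH) (use sym.prems in auto)
next
  case (trans E t u \<tau> v)
  show ?case
    by (rule conv.trans, rule trans.IH(1), use trans.prems in auto, rule trans.IH(2), use trans.prems in auto)
next
  case (app E t t' \<sigma>' \<tau> u u')
  show ?case
    unfolding hom.simps
    by (rule conv.app[where \<sigma> = "bind_ty \<beta> \<sigma>'"], rule app.IH(1)[unfolded bind_ty.simps], use app.prems in auto,
        rule app.IH(2), use app.prems in auto)
next
  case (lam \<sigma>' E t t' \<tau>)
  show ?case
    using lam(3-) by (auto simp: less_Suc_eq_0_disj up_def has_type_Bd_iff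
        intro!: lam(2) conv.lam has_type_ren_Suc split: nat.split)
next
  case (beta \<sigma>' E t \<tau> u)
  have "has_type ct' vt' (bind_ty \<beta> \<sigma>' # E')
      (hom \<beta> (\<lambda>c. ren Suc (\<kappa> c)) (\<lambda>v. ren Suc (\<theta> v)) (up \<sigma>) t) (bind_ty \<beta> \<tau>)"
    using beta(3-) by (auto simp: less_Suc_eq_0_disj up_def has_type_Bd_iff
        intro!: has_type_hom[OF beta(1)] has_type_ren_Suc split: nat.split)
  moreover have "has_type ct' vt' E' (hom \<beta> \<kappa> \<theta> \<sigma> u) (bind_ty \<beta> \<sigma>')"
    using beta(3-) by (auto intro!: has_type_hom[OF beta(2)])
  ultimately show ?case by (simp add: hom_inst conv.beta)
next
  case (eta E t \<sigma>' \<tau>)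
  then have "has_type ct' vt' E' (hom \<beta> \<kappa> \<theta> \<sigma> t) (bind_ty \<beta> (\<sigma>' \<rightarrow>\<^sub>t \<tau>))"
    by (intro has_type_hom)
  then show ?case by (simp add: hom_lift_ren_Suc conv.eta)
qed

lemma hom_conv_both:
  assumes "conv ct vt E t u \<tau>"
    and "\<And>c \<tau>. ct c = Some \<tau> \<Longrightarrow> has_type ct' vt' E' (\<kappa> c) (bind_ty \<beta> \<tau>)"
    and "\<And>v \<tau>. vt v = Some \<tau> \<Longrightarrow> has_type ct' vt' E' (\<theta> v) (bind_ty \<beta> \<tau>)"
    and "\<And>i. i < length E \<Longrightarrow> conv ct' vt' E' (\<sigma> i) (\<sigma>' i) (bind_ty \<beta> (E ! i))"
  shows "conv ct' vt' E' (hom \<beta> \<kappa> \<theta> \<sigma> t) (hom \<beta> \<kappa> \<theta> \<sigma>' u) (bind_ty \<beta> \<tau>)"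
proof (rule conv.trans)
  show "conv ct' vt' E' (hom \<beta> \<kappa> \<theta> \<sigma> t) (hom \<beta> \<kappa> \<theta> \<sigma> u) (bind_ty \<beta> \<tau>)"
    using assms(2-) conv_has_type by (intro hom_conv[OF assms(1)]) blast+
  show "conv ct' vt' E' (hom \<beta> \<kappa> \<theta> \<sigma> u) (hom \<beta> \<kappa> \<theta> \<sigma>' u) (bind_ty \<beta> \<tau>)"
    using assms(2-) conv_has_type[OF assms(1)] by (intro hom_conv_cong[where ct = ct and vt = vt and E = E]) (auto intro: conv.refl)
qed

lemma sub_conv_both:
  assumes "conv ct vt E t u \<tau>" and "\<And>i. i < length E \<Longrightarrow> conv ct vt E' (\<sigma> i) (\<sigma>' i) (E ! i)"
  shows "conv ct vt E' (sub \<sigma> t) (sub \<sigma>' u) \<tau>"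
  using hom_conv_both[OF assms(1), of ct vt E' Con Base Par \<sigma> \<sigma>'] assms(2)
  by (simp add: sub_eq_hom has_type_iffs)

section \<open>Injectivity of constants modulo conversion\<close>

inductive whr :: "('k, 'v, 'b) tm \<Rightarrow> ('k, 'v, 'b) tm \<Rightarrow> bool" where
  whr_beta: "whr (Lam \<sigma> t \<cdot> u) (sub (inst [u]) t)"
| whr_app: "whr t t' \<Longrightarrow> whr (t \<cdot> u) (t' \<cdot> u)"

text \<open>The neutral terms: an application spine headed by a constant or a parameter, on which
  weak head reduction is stuck.\<close>

inductive rigid :: "('k, 'v, 'b) tm \<Rightarrow> bool" where
  rigid_Con [simp, intro]: "rigid (Con c)"
| rigid_Par [simp, intro]: "rigid (Par v)"
| rigid_App [intro]: "rigid t \<Longrightarrow> rigid (t \<cdot> u)"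

text \<open>Same head and pairwise convertible arguments. Arguments are compared by plain conversion
  rather than recursively, which is exactly what injectivity of constants asks for.\<close>

inductive nsim :: "('k \<Rightarrow> 'b ty option) \<Rightarrow> ('v \<Rightarrow> 'b ty option) \<Rightarrow>
    ('k, 'v, 'b) tm \<Rightarrow> ('k, 'v, 'b) tm \<Rightarrow> bool" for ct vt where
  nsim_Con: "nsim ct vt (Con c) (Con c)"
| nsim_Par: "nsim ct vt (Par v) (Par v)"
| nsim_App: "nsim ct vt t t' \<Longrightarrow> conv ct vt [] u u' \<sigma> \<Longrightarrow> nsim ct vt (t \<cdot> u) (t' \<cdot> u')"

inductive_cases whr_AppE: "whr (t \<cdot> u) v"
inductive_cases whr_LamE: "whr (Lam \<sigma> t) v"
inductive_cases whr_ConE: "whr (Con c) v"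
inductive_cases whr_ParE: "whr (Par w) v"
inductive_cases nsim_ConE: "nsim ct vt (Con c) v"
inductive_cases nsim_ParE: "nsim ct vt (Par w) v"
inductive_cases nsim_AppE: "nsim ct vt (t \<cdot> u) v"

lemma whr_unique: "whr t u \<Longrightarrow> whr t v \<Longrightarrow> u = v"
proof (induction arbitrary: v rule: whr.induct)
  case (whr_beta \<sigma> t u)
  then show ?case by (auto elim: whr_AppE whr_LamE)
next
  case (whr_app t t' u)
  from whr_app.prems show ?case
  proof (rule whr_AppE)
    fix t'' assume "v = t'' \<cdot> u" "whr t t''"
    then show ?thesis using whr_app.IH by blast
  next
    fix \<sigma> s assume "t = Lam \<sigma> s"
    then show ?thesis using whr_app.hyps whr_LamE by blast
  qed
qed

lemma rigid_not_whr: "rigid t \<Longrightarrow> \<not> whr t u"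
proof (induction arbitrary: u rule: rigid.induct)
  case (rigid_App t u')
  then show ?case by (auto elim!: whr_AppE elim: rigid.cases)
qed (auto elim: whr_ConE whr_ParE)

lemma rigid_whr_rtranclp: "whr\<^sup>*\<^sup>* t u \<Longrightarrow> rigid t \<Longrightarrow> u = t"
  by (erule converse_rtranclpE) (auto dest: rigid_not_whr)

text \<open>Weak head reduction is deterministic and stops at rigid terms. Transitivity of the
  logical relation rests on this.\<close>

lemma whr_rtranclp_rigid_unique:
  "whr\<^sup>*\<^sup>* t u \<Longrightarrow> whr\<^sup>*\<^sup>* t v \<Longrightarrow> rigid u \<Longrightarrow> rigid v \<Longrightarrow> u = v"
proof (induction rule: converse_rtranclp_induct)
  case base
  then show ?case using rigid_whr_rtranclp by metis
next
  case (step t t')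
  from step.prems(1) show ?case
  proof (cases rule: converse_rtranclpE)
    case base
    then show ?thesis using step rigid_not_whr by metis
  next
    case (step t'')
    then show ?thesis using step.IH step.prems step.hyps whr_unique by metis
  qed
qed

lemma nsim_rigid: "nsim ct vt t u \<Longrightarrow> rigid t \<and> rigid u"
  by (induction rule: nsim.induct) auto

lemma nsim_sym: "nsim ct vt t u \<Longrightarrow> nsim ct vt u t"
  by (induction rule: nsim.induct) (auto intro: nsim.intros conv.sym)

lemma nsim_trans: "nsim ct vt t u \<Longrightarrow> nsim ct vt u v \<Longrightarrow> nsim ct vt t v"
proof (induction arbitrary: v rule: nsim.induct)
  case (nsim_App t t' u u' \<sigma>)
  from nsim_App.prems obtain t'' u'' \<sigma>' where
    *: "v = t'' \<cdot> u''" "nsim ct vt t' t''" "conv ct vt [] u' u'' \<sigma>'" by (auto elim: nsim_AppE)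
  then have "\<sigma>' = \<sigma>" using conv_has_type nsim_App.hyps(2) has_type_unique by metis
  then show ?case using * nsim_App by (auto intro: nsim.intros conv.trans)
qed

section \<open>A logical relation for conversion\<close>

lemma whr_conv: "whr t u \<Longrightarrow> has_type ct vt E t \<tau> \<Longrightarrow> conv ct vt E t u \<tau>"
proof (induction arbitrary: \<tau> rule: whr.induct)
  case (whr_beta \<sigma> t u)
  then show ?case by (auto simp: has_type_iffs intro: conv.beta)
next
  case (whr_app t t' u)
  from whr_app.prems show ?case
    by (rule has_type_AppE) (use whr_app.IH in \<open>auto intro: conv.app conv.refl\<close>)
qed

text \<open>A binary relation in the style of Tait. Conversion is a conjunct at every type, so that
  related arguments can be appended to similar neutral terms. No worlds are needed: only terms
  without loose indices are related, and parameters count as neutral.\<close>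

primrec lrel :: "('k \<Rightarrow> 'b ty option) \<Rightarrow> ('v \<Rightarrow> 'b ty option) \<Rightarrow> 'b ty \<Rightarrow>
    ('k, 'v, 'b) tm \<Rightarrow> ('k, 'v, 'b) tm \<Rightarrow> bool" where
  "lrel ct vt (Base b) t t' \<longleftrightarrow> conv ct vt [] t t' (Base b) \<and>
    (\<exists>n n'. whr\<^sup>*\<^sup>* t n \<and> whr\<^sup>*\<^sup>* t' n' \<and> nsim ct vt n n')"
| "lrel ct vt (\<sigma> \<rightarrow>\<^sub>t \<tau>) t t' \<longleftrightarrow> conv ct vt [] t t' (\<sigma> \<rightarrow>\<^sub>t \<tau>) \<and>
    (\<forall>u u'. lrel ct vt \<sigma> u u' \<longrightarrow> lrel ct vt \<tau> (t \<cdot> u) (t' \<cdot> u'))"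

lemma lrel_conv: "lrel ct vt \<tau> t t' \<Longrightarrow> conv ct vt [] t t' \<tau>"
  by (cases \<tau>) auto

lemma lrel_sym: "lrel ct vt \<tau> t t' \<Longrightarrow> lrel ct vt \<tau> t' t"
proof (induction \<tau> arbitrary: t t')
  case (Base b)
  then show ?case by (auto intro: conv.sym dest: nsim_sym)
next
  case (Fun \<sigma> \<tau>)
  then show ?case by (auto intro: conv.sym)
qed

text \<open>At base type the middle term has a unique rigid reduct. At arrow type the first half
  needs the argument related to itself, which symmetry and transitivity at the smaller type
  provide.\<close>

lemma lrel_trans: "lrel ct vt \<tau> t u \<Longrightarrow> lrel ct vt \<tau> u v \<Longrightarrow> lrel ct vt \<tau> t v"
proof (induction \<tau> arbitrary: t u v)
  case (Base b)
  from Base obtain n m where 1: "whr\<^sup>*\<^sup>* t n" "whr\<^sup>*\<^sup>* u m" "nsim ct vt n m" by auto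
  from Base obtain m' k where 2: "whr\<^sup>*\<^sup>* u m'" "whr\<^sup>*\<^sup>* v k" "nsim ct vt m' k" by auto
  from 1 2 have "m' = m" using whr_rtranclp_rigid_unique nsim_rigid by metis
  then have "nsim ct vt n k" using 1 2 nsim_trans by metis
  moreover have "conv ct vt [] t v (Base b)"
    using Base lrel_conv conv.trans by metis
  ultimately show ?case using 1 2 by auto
next
  case (Fun \<sigma> \<tau>)
  have "lrel ct vt \<tau> (t \<cdot> x) (v \<cdot> x')" if "lrel ct vt \<sigma> x x'" for x x'
  proof -
    have "lrel ct vt \<sigma> x x" using that Fun.IH(1) lrel_sym by metis
    then show ?thesis using that Fun.prems by (intro Fun.IH(2)[of "t \<cdot> x" "u \<cdot> x" "v \<cdot> x'"]) simp_all
  qed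
  moreover have "conv ct vt [] t v (\<sigma> \<rightarrow>\<^sub>t \<tau>)"
    using Fun.prems lrel_conv conv.trans by metis
  ultimately show ?case by simp
qed

text \<open>At arrow type the reduction step is pushed into the head of an application. Expansion on
  the right follows by symmetry.\<close>

lemma lrel_whr_expand:
  "lrel ct vt \<tau> t t' \<Longrightarrow> whr t\<^sub>0 t \<Longrightarrow> has_type ct vt [] t\<^sub>0 \<tau> \<Longrightarrow> lrel ct vt \<tau> t\<^sub>0 t'"
proof (induction \<tau> arbitrary: t t' t\<^sub>0)
  case (Base b)
  then have "conv ct vt [] t\<^sub>0 t' (Base b)"
    using lrel_conv whr_conv conv.trans by metis
  with Base show ?case by (auto intro: converse_rtranclp_into_rtranclp)
next
  case (Fun \<sigma> \<tau>)
  then have "conv ct vt [] t\<^sub>0 t' (\<sigma> \<rightarrow>\<^sub>t \<tau>)"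
    using lrel_conv whr_conv conv.trans by metis
  moreover have "lrel ct vt \<tau> (t\<^sub>0 \<cdot> u) (t' \<cdot> u')" if "lrel ct vt \<sigma> u u'" for u u'
  proof (rule Fun.IH(2))
    show "lrel ct vt \<tau> (t \<cdot> u) (t' \<cdot> u')" using Fun.prems that by simp
    show "whr (t\<^sub>0 \<cdot> u) (t \<cdot> u)" by (rule whr_app) (rule Fun.prems)
    show "has_type ct vt [] (t\<^sub>0 \<cdot> u) \<tau>"
      using Fun.prems(3) conv_has_type[OF lrel_conv[OF that]] has_type.intros(4) by metis
  qed
  ultimately show ?case by simp
qed

text \<open>Similar neutral terms stay neutral and similar when applied to related arguments, so no
  condition arises beyond conversion.\<close>

lemma nsim_lrel: "nsim ct vt t t' \<Longrightarrow> conv ct vt [] t t' \<tau> \<Longrightarrow> lrel ct vt \<tau> t t'"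
proof (induction \<tau> arbitrary: t t')
  case (Fun \<sigma> \<tau>)
  have "lrel ct vt \<tau> (t \<cdot> u) (t' \<cdot> u')" if "lrel ct vt \<sigma> u u'" for u u'
    using Fun.prems lrel_conv[OF that] by (intro Fun.IH(2) nsim_App conv.app)
  then show ?case using Fun.prems by simp
qed auto

lemma lrel_Lam:
  assumes c: "conv ct vt [] (Lam \<sigma> t) (Lam \<sigma> t') (\<sigma> \<rightarrow>\<^sub>t \<tau>)"
    and b: "\<And>u u'. lrel ct vt \<sigma> u u' \<Longrightarrow> lrel ct vt \<tau> (sub (inst [u]) t) (sub (inst [u']) t')"
  shows "lrel ct vt (\<sigma> \<rightarrow>\<^sub>t \<tau>) (Lam \<sigma> t) (Lam \<sigma> t')"
proof -
  have "lrel ct vt \<tau> (Lam \<sigma> t \<cdot> u) (Lam \<sigma> t' \<cdot> u')" if u: "lrel ct vt \<sigma> u u'" for u u'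
  proof -
    note ht = conv_has_type[OF c] conv_has_type[OF lrel_conv[OF u]]
    have "lrel ct vt \<tau> (Lam \<sigma> t \<cdot> u) (sub (inst [u']) t')"
      by (rule lrel_whr_expand[OF b[OF u] whr_beta]) (use ht in \<open>auto intro: has_type.intros\<close>)
    from lrel_sym[OF this] have "lrel ct vt \<tau> (Lam \<sigma> t' \<cdot> u') (Lam \<sigma> t \<cdot> u)"
      by (rule lrel_whr_expand[OF _ whr_beta]) (use ht in \<open>auto intro: has_type.intros\<close>)
    then show ?thesis by (rule lrel_sym)
  qed
  with c show ?thesis by simp
qed

text \<open>The reflexive instance of the fundamental lemma, kept separate because the \<beta> and
  \<eta> cases of conversion need it for their typed components.\<close>

lemma lrel_has_type:
  "has_type ct vt E t \<tau> \<Longrightarrow> (\<And>i. i < length E \<Longrightarrow> lrel ct vt (E ! i) (e i) (e' i)) \<Longrightarrow>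
    lrel ct vt \<tau> (sub e t) (sub e' t)"
proof (induction arbitrary: e e' rule: has_type.induct)
  case (1 c \<tau> E)
  then show ?case by (auto intro!: nsim_lrel nsim_Con conv.refl simp: has_type_Con_iff)
next
  case (2 v \<tau> E)
  then show ?case by (auto intro!: nsim_lrel nsim_Par conv.refl simp: has_type_Par_iff)
next
  case (4 E t \<sigma> \<tau> u)
  show ?case
    using 4(3)[of e e'] 4(4)[of e e'] 4(5) by simp
next
  case (5 \<sigma> E t \<tau>)
  have c: "conv ct vt [] (sub e (Lam \<sigma> t)) (sub e' (Lam \<sigma> t)) (\<sigma> \<rightarrow>\<^sub>t \<tau>)"
    by (rule sub_conv_both[of _ _ E]) (use 5(1,3) in \<open>auto intro: conv.refl has_type.intros lrel_conv\<close>)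
  show ?case
    unfolding sub.simps using c[unfolded sub.simps]
  proof (rule lrel_Lam)
    fix u u' assume "lrel ct vt \<sigma> u u'"
    then show "lrel ct vt \<tau> (sub (inst [u]) (sub (up e) t)) (sub (inst [u']) (sub (up e') t))"
      unfolding sub_inst_up using 5(3) by (intro 5(2)) (auto simp: less_Suc_eq_0_disj)
  qed
qed auto

lemma lrel_fundamental:
  "conv ct vt E t t' \<tau> \<Longrightarrow> (\<And>i. i < length E \<Longrightarrow> lrel ct vt (E ! i) (e i) (e' i)) \<Longrightarrow>
    lrel ct vt \<tau> (sub e t) (sub e' t')"
proof (induction arbitrary: e e' rule: conv.induct)
  case (refl E t \<tau>)
  show ?case by (rule lrel_has_type[OF refl(1)]) (use refl in auto)
next
  case (sym E t u \<tau>)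
  show ?case by (rule lrel_sym, rule sym.IH, rule lrel_sym) (use sym in auto)
next
  case (trans E t u \<tau> v)
  \<comment> \<open>The two halves meet at the middle term under the environment \<open>e\<close>,
    so \<open>e\<close> has to be related to itself.\<close>
  have "lrel ct vt (E ! i) (e i) (e i)" if "i < length E" for i
    using trans.prems[OF that] lrel_sym lrel_trans by metis
  then show ?case using trans.IH(1)[of e e] trans.IH(2)[of e e'] trans.prems lrel_trans by metis
next
  case (app E t t' \<sigma> \<tau> u u')
  show ?case using app.IH(1)[of e e'] app.IH(2)[of e e'] app.prems by simp
next
  case (lam \<sigma> E t t' \<tau>)
  have c: "conv ct vt [] (sub e (Lam \<sigma> t)) (sub e' (Lam \<sigma> t')) (\<sigma> \<rightarrow>\<^sub>t \<tau>)"
    by (rule sub_conv_both[of _ _ E]) (use lam.hyps lam.prems in \<open>auto intro: conv.lam lrel_conv\<close>)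
  show ?case
    unfolding sub.simps using c[unfolded sub.simps]
  proof (rule lrel_Lam)
    fix u u' assume "lrel ct vt \<sigma> u u'"
    then show "lrel ct vt \<tau> (sub (inst [u]) (sub (up e) t)) (sub (inst [u']) (sub (up e') t'))"
      unfolding sub_inst_up using lam.prems by (intro lam.IH) (auto simp: less_Suc_eq_0_disj)
  qed
next
  case (beta \<sigma> E t \<tau> u)
  have ll: "lrel ct vt \<sigma> (sub e u) (sub e' u)"
    by (rule lrel_has_type[OF beta(2)]) (use beta in auto)
  have l: "lrel ct vt \<tau> (sub (case_nat (sub e u) e) t) (sub (case_nat (sub e' u) e') t)"
    using ll by (intro lrel_has_type[OF beta(1)]) (use beta(3) in \<open>auto simp: less_Suc_eq_0_disj\<close>)
  have eq: "sub e' (sub (inst [u]) t) = sub (case_nat (sub e' u) e') t"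
  proof -
    have "(\<lambda>i. sub e' (inst [u] i)) = case_nat (sub e' u) e'"
      by (auto simp: inst_Cons fun_eq_iff split: nat.split)
    then show ?thesis by (simp add: sub_sub)
  qed
  have "has_type ct vt [] (sub e (Lam \<sigma> t \<cdot> u)) \<tau>"
    by (rule has_type_sub[of _ _ E])
      (use beta in \<open>auto intro: has_type.intros dest: lrel_conv conv_has_type\<close>)
  then show ?case
    unfolding eq using whr_beta[of \<sigma> "sub (up e) t" "sub e u"]
    by (intro lrel_whr_expand[OF l]) (auto simp: sub_inst_up)
next
  case (eta E t \<sigma> \<tau>)
  have c: "conv ct vt [] (sub e (Lam \<sigma> (ren Suc t \<cdot> Bd 0))) (sub e' t) (\<sigma> \<rightarrow>\<^sub>t \<tau>)"
    by (rule sub_conv_both[of _ _ E]) (use eta in \<open>auto intro: conv.eta lrel_conv\<close>)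
  have f: "lrel ct vt (\<sigma> \<rightarrow>\<^sub>t \<tau>) (sub e t) (sub e' t)"
    by (rule lrel_has_type[OF eta(1)]) (use eta in auto)
  have "lrel ct vt \<tau> (sub e (Lam \<sigma> (ren Suc t \<cdot> Bd 0)) \<cdot> u) (sub e' t \<cdot> u')" if u: "lrel ct vt \<sigma> u u'" for u u'
  proof -
    note ht = conv_has_type[OF c] conv_has_type[OF lrel_conv[OF u]]
    have "lrel ct vt \<tau> (sub e t \<cdot> u) (sub e' t \<cdot> u')" using f u by simp
    moreover have "whr (sub e (Lam \<sigma> (ren Suc t \<cdot> Bd 0)) \<cdot> u) (sub e t \<cdot> u)"
      using whr_beta[of \<sigma> "sub (up e) (ren Suc t \<cdot> Bd 0)" u] by (simp add: sub_ren sub_sub inst_Cons)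
    ultimately show ?thesis
      by (rule lrel_whr_expand) (use ht in \<open>auto simp: has_type_App_iff\<close>)
  qed
  with c show ?case by simp
qed

text \<open>Rigid terms do not reduce, so the reducts given by the relation are the terms
  themselves. Fully applied constructors such as \<open>CCons\<close> and \<open>COr\<close> are
  thereby injective and distinct from each other modulo conversion.\<close>

lemma conv_rigid_nsim:
  assumes "conv ct vt [] t u (Base b)" "rigid t" "rigid u"
  shows "nsim ct vt t u"
proof -
  have "lrel ct vt (Base b) t u"
    using lrel_fundamental[OF assms(1), of Bd Bd] by simp
  then show ?thesis using assms(2,3) by (auto dest: rigid_whr_rtranclp)
qed

section \<open>Truth of meta-logic formulas in the term model\<close>

abbreviation ground :: "('k \<Rightarrow> 'b ty option) \<Rightarrow> ('k, 'b) mtm \<Rightarrow> 'b ty \<Rightarrow> bool" where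
  "ground ct \<equiv> has_type ct (mvt ct {}) []"

abbreviation gconv :: "('k \<Rightarrow> 'b ty option) \<Rightarrow> ('k, 'b) mtm \<Rightarrow> ('k, 'b) mtm \<Rightarrow> 'b ty \<Rightarrow> bool" where
  "gconv ct \<equiv> conv ct (mvt ct {}) []"

abbreviation val :: "('b mvar \<Rightarrow> ('k, 'b) mtm) \<Rightarrow> (nat \<Rightarrow> ('k, 'b) mtm) \<Rightarrow> ('k, 'b) mtm \<Rightarrow> ('k, 'b) mtm" where
  "val \<equiv> hom Base Con"

text \<open>\<open>\<theta>\<close> interprets both kinds of parameters, \<open>e\<close> the loose
  indices. Nominal constants go through \<open>\<theta>\<close> as well, so that they can be renamed
  away from the terms assigned to eigenvariables. Asking for cofinitely many constants at \<nabla>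
  avoids any mention of the support of \<open>\<theta>\<close> and \<open>e\<close>.\<close>

primrec sem :: "('k \<Rightarrow> 'b ty option) \<Rightarrow> ('p \<Rightarrow> ('k, 'b) mtm list \<Rightarrow> bool) \<Rightarrow>
    ('b mvar \<Rightarrow> ('k, 'b) mtm) \<Rightarrow> (nat \<Rightarrow> ('k, 'b) mtm) \<Rightarrow> ('p, 'k, 'b) mform \<Rightarrow> bool" where
  "sem ct I \<theta> e FTop \<longleftrightarrow> True"
| "sem ct I \<theta> e FBot \<longleftrightarrow> False"
| "sem ct I \<theta> e (FAnd F G) \<longleftrightarrow> sem ct I \<theta> e F \<and> sem ct I \<theta> e G"
| "sem ct I \<theta> e (FOr F G) \<longleftrightarrow> sem ct I \<theta> e F \<or> sem ct I \<theta> e G"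
| "sem ct I \<theta> e (FImp F G) \<longleftrightarrow> (sem ct I \<theta> e F \<longrightarrow> sem ct I \<theta> e G)"
| "sem ct I \<theta> e (FAll \<tau> F) \<longleftrightarrow> (\<forall>t. ground ct t \<tau> \<longrightarrow> sem ct I \<theta> (case_nat t e) F)"
| "sem ct I \<theta> e (FEx \<tau> F) \<longleftrightarrow> (\<exists>t. ground ct t \<tau> \<and> sem ct I \<theta> (case_nat t e) F)"
| "sem ct I \<theta> e (FNab \<tau> F) \<longleftrightarrow>
    (\<exists>X. finite X \<and> (\<forall>a. snd a = \<tau> \<and> a \<notin> X \<longrightarrow> sem ct I \<theta> (case_nat (Par (Nom a)) e) F))"
| "sem ct I \<theta> e (FNA n s t) \<longleftrightarrow>
    na_holds ct {} (FNA n (val \<theta> e s) (val \<theta> e t) :: ('p, 'k, 'b) mform)"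
| "sem ct I \<theta> e (FAt p ts) \<longleftrightarrow> I p (map (val \<theta> e) ts)"

section \<open>Parameters, well-formedness and congruence of truth\<close>

definition fpars :: "('p, 'k, 'b) mform \<Rightarrow> 'b mvar set" where
  "fpars F = (\<Union>t \<in> tms F. pars t)"

lemma fpars_simps [simp]:
  "fpars FTop = {}" "fpars FBot = {}"
  "fpars (FAnd F G) = fpars F \<union> fpars G" "fpars (FOr F G) = fpars F \<union> fpars G"
  "fpars (FImp F G) = fpars F \<union> fpars G"
  "fpars (FAll \<tau> F) = fpars F" "fpars (FEx \<tau> F) = fpars F" "fpars (FNab \<tau> F) = fpars F"
  "fpars (FNA n s t) = pars s \<union> pars t" "fpars (FAt p ts) = (\<Union>t \<in> set ts. pars t)"
  by (auto simp: fpars_def)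

lemma supp_iff: "a \<in> supp F \<longleftrightarrow> Nom a \<in> fpars F"
  by (auto simp: supp_def fpars_def noms_def)

lemma finite_fpars [simp]: "finite (fpars F)"
  by (induction F) auto

lemma finite_Nom_vimage: "finite X \<Longrightarrow> finite {a. Nom a \<in> X}"
  using finite_vimageI[of X Nom] by (simp add: vimage_def inj_def)

lemma finite_Eig_vimage: "finite X \<Longrightarrow> finite {a. Eig a \<in> X}"
  using finite_vimageI[of X Eig] by (simp add: vimage_def inj_def)

lemma finite_noms [simp]: "finite (noms t)"
  by (simp add: noms_def finite_Nom_vimage)

lemma finite_supp [simp]: "finite (supp F)"
  using finite_Nom_vimage[OF finite_fpars, of F] by (simp add: supp_iff[symmetric])

lemma sem_fsub: "sem ct I \<theta> e (fsub \<sigma> F) \<longleftrightarrow> sem ct I \<theta> (\<lambda>i. val \<theta> e (\<sigma> i)) F"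
proof -
  have up: "(\<lambda>i. val \<theta> (case_nat t e) (up \<sigma> i)) = case_nat t (\<lambda>i. val \<theta> e (\<sigma> i))"
    for t e and \<sigma> :: "nat \<Rightarrow> ('a, 'b) mtm"
    by (auto simp: up_def fun_eq_iff hom_ren split: nat.split)
  show ?thesis
    by (induction F arbitrary: e \<sigma>) (simp_all add: up hom_sub comp_def)
qed

lemma mvt_Nom: "mvt ct \<Sigma> (Nom a) = (if inhabited ct (snd a) then Some (snd a) else None)"
  and mvt_Eig: "mvt ct \<Sigma> (Eig h) = (if h \<in> \<Sigma> then Some (snd h) else None)"
  by (simp_all add: mvt_def)

lemma mvt_mono: "mvt ct \<Sigma> v = Some \<tau> \<Longrightarrow> \<Sigma> \<subseteq> \<Sigma>' \<Longrightarrow> mvt ct \<Sigma>' v = Some \<tau>"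
  by (auto simp: mvt_def split: mvar.splits if_splits)

lemma wf_form_fpars: "wf_form ct D \<Sigma> E F \<Longrightarrow> v \<in> fpars F \<Longrightarrow> mvt ct \<Sigma> v \<noteq> None"
proof (induction F arbitrary: E)
  case (FAt p ts)
  then show ?case by (fastforce simp: list_all2_conv_all_nth in_set_conv_nth dest: has_type_pars)
qed (auto dest: has_type_pars)

lemma wf_form_Eig: "wf_form ct D \<Sigma> E F \<Longrightarrow> Eig h \<in> fpars F \<Longrightarrow> h \<in> \<Sigma>"
  by (drule wf_form_fpars) (auto simp: mvt_Eig split: if_splits)

lemma wf_form_mono: "wf_form ct D \<Sigma> E F \<Longrightarrow> \<Sigma> \<subseteq> \<Sigma>' \<Longrightarrow> wf_form ct D \<Sigma>' E F"
proof (induction F arbitrary: E)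
  case (FNA n s t)
  then obtain \<tau>s \<tau> where *: "length \<tau>s = n"
    "has_type ct (mvt ct \<Sigma>) E s (fun_ty \<tau>s \<tau>)" "has_type ct (mvt ct \<Sigma>) E t \<tau>"
    by auto
  have "has_type ct (mvt ct \<Sigma>') E s (fun_ty \<tau>s \<tau>)" "has_type ct (mvt ct \<Sigma>') E t \<tau>"
    using has_type_mono[OF *(2)] has_type_mono[OF *(3)] mvt_mono FNA.prems(2) by blast+
  with *(1) show ?case by auto
next
  case (FAt p ts)
  then show ?case by (auto elim!: list.rel_mono_strong intro: has_type_mono mvt_mono)
qed auto

lemma wf_form_fsub:
  "wf_form ct D \<Sigma> E F \<Longrightarrow> (\<And>i. i < length E \<Longrightarrow> has_type ct (mvt ct \<Sigma>) E' (\<sigma> i) (E ! i)) \<Longrightarrow>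
    wf_form ct D \<Sigma> E' (fsub \<sigma> F)"
proof (induction F arbitrary: E E' \<sigma>)
  case (FAnd F G)
  then show ?case using FAnd.IH(1)[of E E' \<sigma>] FAnd.IH(2)[of E E' \<sigma>] by simp
next
  case (FOr F G)
  then show ?case using FOr.IH(1)[of E E' \<sigma>] FOr.IH(2)[of E E' \<sigma>] by simp
next
  case (FImp F G)
  then show ?case using FImp.IH(1)[of E E' \<sigma>] FImp.IH(2)[of E E' \<sigma>] by simp
next
  case (FAll \<tau> F)
  show ?case
    using FAll.prems
    by (auto intro!: FAll.IH[of "\<tau> # E"] has_type_ren_Suc
        simp: less_Suc_eq_0_disj has_type_Bd_iff)
next
  case (FEx \<tau> F)
  show ?case
    using FEx.prems
    by (auto intro!: FEx.IH[of "\<tau> # E"] has_type_ren_Suc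
        simp: less_Suc_eq_0_disj has_type_Bd_iff)
next
  case (FNab \<tau> F)
  show ?case
    using FNab.prems
    by (auto intro!: FNab.IH[of "\<tau> # E"] has_type_ren_Suc
        simp: less_Suc_eq_0_disj has_type_Bd_iff)
next
  case (FNA n s t)
  then show ?case by simp (metis has_type_sub)
next
  case (FAt p ts)
  then show ?case
    by (auto simp: list.rel_map elim!: list.rel_mono_strong intro: has_type_sub)
qed simp_all

lemma wf_form_inst:
  "wf_form ct D \<Sigma> \<tau>s F \<Longrightarrow> list_all2 (has_type ct (mvt ct \<Sigma>) []) ts \<tau>s \<Longrightarrow>
    wf_form ct D \<Sigma> [] (fsub (inst ts) F)"
  by (erule wf_form_fsub) (auto simp: inst_def list_all2_conv_all_nth)

lemma wf_form_pred_subst: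
  "wf_form ct D \<Sigma> E F \<Longrightarrow> wf_form ct D {} (arg_types D p) S \<Longrightarrow> wf_form ct D \<Sigma> E (pred_subst p S F)"
proof (induction F arbitrary: E)
  case (FAt q ts)
  show ?case
  proof (cases "q = p")
    case True
    then have "wf_form ct D \<Sigma> E (fsub (inst ts) S)"
      using FAt by (intro wf_form_fsub[of ct D \<Sigma> "arg_types D p"])
        (auto intro: wf_form_mono simp: inst_def list_all2_conv_all_nth)
    with True show ?thesis by simp
  qed (use FAt in simp)
qed auto

lemma fconv_refl: "wf_form ct D \<Sigma> E F \<Longrightarrow> fconv ct \<Sigma> E F F"
proof (induction F arbitrary: E)
  case (FAt p ts)
  then show ?case
    by (intro fconv.intros) (auto simp: list_all2_conv_all_nth intro!: exI intro: conv.refl)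
qed (auto intro: fconv.intros conv.refl)

lemma fconv_wf_form: "fconv ct \<Sigma> E F F' \<Longrightarrow> wf_form ct D \<Sigma> E F \<longleftrightarrow> wf_form ct D \<Sigma> E F'"
proof (induction rule: fconv.induct)
  case (9 E s s' \<sigma> t t' \<tau> n)
  then show ?case by simp (metis conv_has_type has_type_unique)
next
  case (10 E ts ts' p)
  have "has_type ct (mvt ct \<Sigma>) E (ts ! i) \<tau> \<longleftrightarrow> has_type ct (mvt ct \<Sigma>) E (ts' ! i) \<tau>"
    if "i < length ts" for i \<tau>
    using 10 that unfolding list_all2_conv_all_nth by (metis conv_has_type has_type_unique)
  moreover have "length ts = length ts'" using 10 by (simp add: list_all2_conv_all_nth)
  ultimately show ?case by (auto simp: list_all2_conv_all_nth)
qed auto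

lemma sem_cong:
  "wf_form ct D \<Sigma> E F \<Longrightarrow> (\<And>v. v \<in> fpars F \<Longrightarrow> \<theta> v = \<theta>' v) \<Longrightarrow>
    (\<And>i. i < length E \<Longrightarrow> e i = e' i) \<Longrightarrow> sem ct I \<theta> e F \<longleftrightarrow> sem ct I \<theta>' e' F"
proof (induction F arbitrary: E e e')
  case (FAnd F G)
  then show ?case using FAnd.IH(1)[of E e e'] FAnd.IH(2)[of E e e'] by simp
next
  case (FOr F G)
  then show ?case using FOr.IH(1)[of E e e'] FOr.IH(2)[of E e e'] by simp
next
  case (FImp F G)
  then show ?case using FImp.IH(1)[of E e e'] FImp.IH(2)[of E e e'] by simp
next
  case (FAll \<tau> F)
  have "sem ct I \<theta> (case_nat t e) F \<longleftrightarrow> sem ct I \<theta>' (case_nat t e') F" for t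
    using FAll.prems by (intro FAll.IH[of "\<tau> # E"]) (auto simp: less_Suc_eq_0_disj)
  then show ?case by simp
next
  case (FEx \<tau> F)
  have "sem ct I \<theta> (case_nat t e) F \<longleftrightarrow> sem ct I \<theta>' (case_nat t e') F" for t
    using FEx.prems by (intro FEx.IH[of "\<tau> # E"]) (auto simp: less_Suc_eq_0_disj)
  then show ?case by simp
next
  case (FNab \<tau> F)
  have "sem ct I \<theta> (case_nat t e) F \<longleftrightarrow> sem ct I \<theta>' (case_nat t e') F" for t
    using FNab.prems by (intro FNab.IH[of "\<tau> # E"]) (auto simp: less_Suc_eq_0_disj)
  then show ?case by simp
next
  case (FNA n s t)
  from FNA(1) obtain \<tau>s \<tau> where
    "has_type ct (mvt ct \<Sigma>) E s (fun_ty \<tau>s \<tau>)" "has_type ct (mvt ct \<Sigma>) E t \<tau>" by auto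
  then have "val \<theta> e s = val \<theta>' e' s" "val \<theta> e t = val \<theta>' e' t"
    using FNA(2,3) by (auto intro: hom_cong_typed)
  then show ?case by simp
next
  case (FAt p ts)
  have "val \<theta> e t = val \<theta>' e' t" if "t \<in> set ts" for t
  proof -
    from that FAt(1) obtain \<tau> where "has_type ct (mvt ct \<Sigma>) E t \<tau>"
      by (auto simp: list_all2_conv_all_nth in_set_conv_nth)
    then show ?thesis by (rule hom_cong_typed) (use FAt(2,3) that in auto)
  qed
  then show ?case by (simp cong: map_cong)
qed simp_all

subsection \<open>Nominal abstraction\<close>

lemma close_par_conv:
  assumes "conv ct (mvt ct \<Sigma>) [] t u \<tau>"
  shows "conv ct (mvt ct \<Sigma>) [snd c] (close_par (Nom c) 0 t) (close_par (Nom c) 0 u) \<tau>"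
  unfolding close_par_eq_hom
  by (rule hom_conv[OF assms, of ct "mvt ct \<Sigma>" "[snd c]" Con Base, unfolded bind_ty_Base])
    (auto simp: has_type_iffs mvt_Nom split: if_splits)

lemma abs_noms_Nil [simp]: "abs_noms [] t = t"
  and abs_noms_Cons [simp]: "abs_noms (c # cs) t = Lam (snd c) (close_par (Nom c) 0 (abs_noms cs t))"
  by (simp_all add: abs_noms_def)

lemma abs_noms_conv:
  "conv ct (mvt ct \<Sigma>) [] t u \<tau> \<Longrightarrow>
    conv ct (mvt ct \<Sigma>) [] (abs_noms cs t) (abs_noms cs u) (fun_ty (map snd cs) \<tau>)"
  by (induction cs) (auto intro: conv.lam close_par_conv)

lemma abs_noms_has_type:
  "has_type ct (mvt ct \<Sigma>) [] t \<tau> \<Longrightarrow>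
    has_type ct (mvt ct \<Sigma>) [] (abs_noms cs t) (fun_ty (map snd cs) \<tau>)"
  using abs_noms_conv conv.refl conv_has_type by metis

lemma close_par_fresh: "has_type ct vt [] t \<tau> \<Longrightarrow> v \<notin> pars t \<Longrightarrow> close_par v k t = t"
  unfolding close_par_eq_hom
  by (subst hom_cong_typed[of ct vt "[]" t \<tau> _ Con _ Par _ Bd]) auto

lemma pars_close_par: "pars (close_par v k t) = pars t - {v}"
  by (induction t arbitrary: k) auto

lemma pars_abs_noms: "pars (abs_noms cs t) = pars t - Nom ` set cs"
  by (induction cs) (auto simp: pars_close_par)

text \<open>A valuation commutes with abstraction as long as no renamed constant occurs in the value
  of another parameter, where abstraction would capture it. The values must be closed, so that
  lifting them below the new binder changes nothing.\<close>

lemma has_type_val_abs_noms: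
  assumes "\<And>c. c \<in> set cs \<Longrightarrow> \<theta> (Nom c) = Par (Nom (\<rho> c))"
    and "\<And>c. c \<in> set cs \<Longrightarrow> snd (\<rho> c) = snd c"
    and "\<And>v c. v \<in> pars t \<Longrightarrow> c \<in> set cs \<Longrightarrow> v \<noteq> Nom c \<Longrightarrow> Nom (\<rho> c) \<notin> pars (\<theta> v)"
    and "\<And>v. v \<in> pars t \<Longrightarrow> \<exists>\<tau>. has_type ct vt [] (\<theta> v) \<tau>"
  shows "val \<theta> Bd (abs_noms cs t) = abs_noms (map \<rho> cs) (val \<theta> Bd t)"
  using assms
proof (induction cs)
  case (Cons c cs)
  let ?u = "abs_noms cs t"
  have p: "pars ?u \<subseteq> pars t" by (auto simp: pars_abs_noms)
  have p': "pars (close_par (Nom c) 0 ?u) \<subseteq> pars t" using p by (auto simp: pars_close_par)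
  have "val (\<lambda>v. ren Suc (\<theta> v)) Bd (close_par (Nom c) 0 ?u) = val \<theta> Bd (close_par (Nom c) 0 ?u)"
    by (rule hom_cong_pars) (use p' Cons.prems(4) ren_closed in blast)
  also have "\<dots> = close_par (Nom (\<rho> c)) 0 (val \<theta> Bd ?u)"
  proof -
    have "(if v = Nom c then Bd 0 else \<theta> v) = close_par (Nom (\<rho> c)) 0 (\<theta> v)"
      if v: "v \<in> pars ?u" for v
    proof (cases "v = Nom c")
      case False
      then have "Nom (\<rho> c) \<notin> pars (\<theta> v)" using Cons.prems(3)[of v c] v p by auto
      moreover obtain \<tau> where "has_type ct vt [] (\<theta> v) \<tau>" using v p Cons.prems(4) by blast
      ultimately show ?thesis using False close_par_fresh by metis
    qed (use Cons.prems(1) in simp)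
    then have "val (\<lambda>v. if v = Nom c then Bd 0 else \<theta> v) (\<lambda>i. Bd (Suc i)) ?u =
        val (\<lambda>v. close_par (Nom (\<rho> c)) 0 (\<theta> v)) (\<lambda>i. Bd (Suc i)) ?u"
      by (rule hom_cong_pars)
    then show ?thesis
      by (simp add: close_par_eq_hom hom_hom if_distrib[of "val \<theta> Bd"] cong: if_cong)
  qed
  finally show ?case using Cons by simp
qed simp

lemma na_holds_FNA:
  "na_holds ct \<Sigma> (FNA n s t) \<longleftrightarrow> (\<exists>cs \<tau>. length cs = n \<and>
    (\<forall>c \<in> set cs. inhabited ct (snd c)) \<and> conv ct (mvt ct \<Sigma>) [] s (abs_noms cs t) \<tau>)"
  by (auto simp: na_holds_def)

lemma na_holds_conv_imp:
  assumes "na_holds ct \<Sigma> (FNA n s t :: ('p, 'k, 'b) mform)"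
    and s: "conv ct (mvt ct \<Sigma>) [] s s' \<sigma>" and t: "conv ct (mvt ct \<Sigma>) [] t t' \<tau>"
  shows "na_holds ct \<Sigma> (FNA n s' t' :: ('p, 'k, 'b) mform)"
proof -
  from assms(1) obtain cs \<tau>' where cs: "length cs = n" "\<forall>c \<in> set cs. inhabited ct (snd c)"
    and c: "conv ct (mvt ct \<Sigma>) [] s (abs_noms cs t) \<tau>'" by (auto simp: na_holds_FNA)
  have "conv ct (mvt ct \<Sigma>) [] (abs_noms cs t) (abs_noms cs t') (fun_ty (map snd cs) \<tau>)"
    by (rule abs_noms_conv[OF t])
  then have "conv ct (mvt ct \<Sigma>) [] s (abs_noms cs t') \<tau>'"
    using c conv.trans conv_has_type has_type_unique by metis
  then have "conv ct (mvt ct \<Sigma>) [] s' (abs_noms cs t') \<tau>'"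
    using s conv.trans conv.sym conv_has_type has_type_unique by metis
  with cs show ?thesis by (auto simp: na_holds_FNA)
qed

lemma na_holds_conv:
  assumes "conv ct (mvt ct \<Sigma>) [] s s' \<sigma>" and "conv ct (mvt ct \<Sigma>) [] t t' \<tau>"
  shows "na_holds ct \<Sigma> (FNA n s t :: ('p, 'k, 'b) mform) \<longleftrightarrow>
    na_holds ct \<Sigma> (FNA n s' t' :: ('p, 'k, 'b) mform)"
  using na_holds_conv_imp[OF _ assms] na_holds_conv_imp[OF _ assms[THEN conv.sym]] by blast

section \<open>Truth is invariant under conversion\<close>

definition conv_closed :: "('k \<Rightarrow> 'b ty option) \<Rightarrow> ('p \<Rightarrow> ('k, 'b) mtm list \<Rightarrow> bool) \<Rightarrow> bool" where
  "conv_closed ct I \<longleftrightarrow>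
    (\<forall>p us us'. list_all2 (\<lambda>t t'. \<exists>\<tau>. gconv ct t t' \<tau>) us us' \<longrightarrow> I p us \<longrightarrow> I p us')"

definition ground_map :: "('k \<Rightarrow> 'b ty option) \<Rightarrow> 'b tvar set \<Rightarrow> ('b mvar \<Rightarrow> ('k, 'b) mtm) \<Rightarrow> bool" where
  "ground_map ct \<Sigma> \<theta> \<longleftrightarrow> (\<forall>v \<tau>. mvt ct \<Sigma> v = Some \<tau> \<longrightarrow> ground ct (\<theta> v) \<tau>)"

lemma val_conv:
  assumes "conv ct (mvt ct \<Sigma>) E t t' \<tau>" and "ground_map ct \<Sigma> \<theta>"
    and "\<And>i. i < length E \<Longrightarrow> gconv ct (e i) (e' i) (E ! i)"
  shows "gconv ct (val \<theta> e t) (val \<theta> e' t') \<tau>"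
  using hom_conv_both[OF assms(1), of ct "mvt ct {}" "[]" Con Base \<theta> e e'] assms(2,3)
  by (simp add: has_type_Con_iff ground_map_def)

lemma val_ground:
  assumes "has_type ct (mvt ct \<Sigma>) E t \<tau>" and "ground_map ct \<Sigma> \<theta>"
    and "\<And>i. i < length E \<Longrightarrow> ground ct (e i) (E ! i)"
  shows "ground ct (val \<theta> e t) \<tau>"
  using val_conv[OF conv.refl[OF assms(1)] assms(2), of e e] assms(3) conv.refl conv_has_type by blast

lemma list_all2_conv_sym:
  "list_all2 (\<lambda>t t'. \<exists>\<tau>. conv ct vt E t t' \<tau>) ts ts' \<Longrightarrow> list_all2 (\<lambda>t t'. \<exists>\<tau>. conv ct vt E t t' \<tau>) ts' ts"
  by (induction rule: list_all2_induct) (auto intro: conv.sym)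

text \<open>Formula and environment vary together; the environment must vary because the value of a
  raised eigenvariable is a redex. The \<nabla> case relies on the inhabitation recorded in
  \<open>wf_form\<close>, which makes the nominal constants well-typed.\<close>

lemma sem_conv:
  assumes "fconv ct \<Sigma> E F F'" and "wf_form ct D \<Sigma> E F" and "conv_closed ct I" and "ground_map ct \<Sigma> \<theta>"
    and "\<And>i. i < length E \<Longrightarrow> gconv ct (e i) (e' i) (E ! i)"
  shows "sem ct I \<theta> e F \<longleftrightarrow> sem ct I \<theta> e' F'"
  using assms(1,2,5)
proof (induction arbitrary: e e' rule: fconv.induct)
  case (3 E F F' G G')
  show ?case using 3(3)[of e e'] 3(4)[of e e'] 3(5,6) by simp
next
  case (4 E F F' G G')
  show ?case using 4(3)[of e e'] 4(4)[of e e'] 4(5,6) by simp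
next
  case (5 E F F' G G')
  show ?case using 5(3)[of e e'] 5(4)[of e e'] 5(5,6) by simp
next
  case (6 \<tau> E F F')
  have "sem ct I \<theta> (case_nat t e) F \<longleftrightarrow> sem ct I \<theta> (case_nat t e') F'" if "ground ct t \<tau>" for t
    using 6(3,4) that by (intro 6(2)) (auto simp: less_Suc_eq_0_disj intro: conv.refl)
  then show ?case by auto
next
  case (7 \<tau> E F F')
  have "sem ct I \<theta> (case_nat t e) F \<longleftrightarrow> sem ct I \<theta> (case_nat t e') F'" if "ground ct t \<tau>" for t
    using 7(3,4) that by (intro 7(2)) (auto simp: less_Suc_eq_0_disj intro: conv.refl)
  then show ?case by auto
next
  case (8 \<tau> E F F')
  have "sem ct I \<theta> (case_nat (Par (Nom a)) e) F \<longleftrightarrow> sem ct I \<theta> (case_nat (Par (Nom a)) e') F'"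
    if "snd a = \<tau>" for a
    using 8(3,4) that
    by (intro 8(2)) (auto simp: less_Suc_eq_0_disj has_type_Par_iff mvt_Nom intro!: conv.refl)
  then show ?case by simp
next
  case (9 E s s' \<sigma> t t' \<tau> n)
  have "gconv ct (val \<theta> e s) (val \<theta> e' s') \<sigma>" "gconv ct (val \<theta> e t) (val \<theta> e' t') \<tau>"
    using val_conv[OF 9(1) assms(4)] val_conv[OF 9(2) assms(4)] 9(4) by blast+
  then show ?case by (simp add: na_holds_conv)
next
  case (10 E ts ts' p)
  have "list_all2 (\<lambda>t t'. \<exists>\<tau>. gconv ct t t' \<tau>) (map (val \<theta> e) ts) (map (val \<theta> e') ts')"
    unfolding list.rel_map using 10(1)
    by (rule list.rel_mono_strong) (use val_conv[OF _ assms(4)] 10(3) in blast)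
  note this list_all2_conv_sym[OF this]
  then show ?case using assms(3) unfolding conv_closed_def sem.simps by metis
qed auto

subsection \<open>Equivariance\<close>

abbreviation cmb :: "('b tvar \<Rightarrow> 'b tvar) \<Rightarrow> ('b tvar \<Rightarrow> ('k, 'b) mtm) \<Rightarrow> 'b mvar \<Rightarrow> ('k, 'b) mtm" where
  "cmb \<rho> \<theta> \<equiv> case_mvar (\<lambda>a. Par (Nom (\<rho> a))) \<theta>"

definition pm :: "('b tvar \<Rightarrow> 'b tvar) \<Rightarrow> ('k, 'b) mtm \<Rightarrow> ('k, 'b) mtm" where
  "pm \<pi> = hom Base Con (cmb \<pi> (\<lambda>h. Par (Eig h))) Bd"

definition tperm :: "('b tvar \<Rightarrow> 'b tvar) \<Rightarrow> bool" where
  "tperm \<pi> \<longleftrightarrow> bij \<pi> \<and> (\<forall>a. snd (\<pi> a) = snd a)"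

lemma tperm_inv: "tperm \<pi> \<Longrightarrow> tperm (inv \<pi>)"
  unfolding tperm_def by (metis bij_imp_bij_inv bij_inv_eq_iff)

lemma tperm_involution: "(\<And>a. \<pi> (\<pi> a) = a) \<Longrightarrow> (\<And>a. snd (\<pi> a) = snd a) \<Longrightarrow> tperm \<pi>"
  unfolding tperm_def by (auto intro: involuntory_imp_bij)

lemma pm_pm: "pm \<pi> (pm \<pi>' t) = pm (\<lambda>a. \<pi> (\<pi>' a)) t"
  unfolding pm_def hom_hom by (auto intro!: hom_cong_pars split: mvar.split)

lemma pm_val: "pm \<pi> (val \<theta> e t) = val (\<lambda>v. pm \<pi> (\<theta> v)) (\<lambda>i. pm \<pi> (e i)) t"
  unfolding pm_def by (simp add: hom_hom)

lemma pm_Nom [simp]: "pm \<pi> (Par (Nom a)) = Par (Nom (\<pi> a))"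
  by (simp add: pm_def)

lemma pm_cong: "(\<And>a. Nom a \<in> pars t \<Longrightarrow> \<pi> a = \<pi>' a) \<Longrightarrow> pm \<pi> t = pm \<pi>' t"
  unfolding pm_def by (rule hom_cong_pars) (auto split: mvar.split)

lemma cmb_id: "cmb (\<lambda>a. a) (\<lambda>h. Par (Eig h)) = Par"
  by (auto simp: fun_eq_iff split: mvar.split)

lemma pm_id [simp]: "pm (\<lambda>a. a) t = t"
  by (simp add: pm_def cmb_id)

lemma pm_fresh: "(\<And>a. Nom a \<in> pars t \<Longrightarrow> \<pi> a = a) \<Longrightarrow> pm \<pi> t = t"
  using pm_cong[of t \<pi> "\<lambda>a. a"] by simp

lemma pm_inv: "tperm \<pi> \<Longrightarrow> pm (inv \<pi>) (pm \<pi> t) = t" "tperm \<pi> \<Longrightarrow> pm \<pi> (pm (inv \<pi>) t) = t"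
  unfolding tperm_def by (simp_all add: pm_pm bij_is_inj bij_is_surj surj_f_inv_f)

lemma pm_conv:
  assumes "conv ct (mvt ct \<Sigma>) E t u \<tau>" "\<And>a. snd (\<pi> a) = snd a"
  shows "conv ct (mvt ct \<Sigma>) E (pm \<pi> t) (pm \<pi> u) \<tau>"
  unfolding pm_def
  by (rule hom_conv[OF assms(1), where \<beta> = Base and ct' = ct and vt' = "mvt ct \<Sigma>", unfolded bind_ty_Base])
    (use assms(2) in \<open>auto simp: has_type_iffs mvt_def split: mvar.splits if_splits\<close>)

lemma pm_has_type:
  "has_type ct (mvt ct \<Sigma>) E t \<tau> \<Longrightarrow> (\<And>a. snd (\<pi> a) = snd a) \<Longrightarrow> has_type ct (mvt ct \<Sigma>) E (pm \<pi> t) \<tau>"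
  using pm_conv conv.refl conv_has_type by metis

lemma ren_Suc_cmb_Par: "(\<lambda>v. ren Suc (cmb \<pi> (\<lambda>h. Par (Eig h)) v)) = cmb \<pi> (\<lambda>h. Par (Eig h))"
  by (auto simp: fun_eq_iff split: mvar.split)

lemma pm_Lam: "pm \<pi> (Lam \<tau> t) = Lam \<tau> (pm \<pi> t)"
  by (simp add: pm_def ren_Suc_cmb_Par)

lemma pm_simps:
  "pm \<pi> (Con c) = Con c" "pm \<pi> (Par (Eig h)) = Par (Eig h)" "pm \<pi> (Bd i) = Bd i"
  "pm \<pi> (t \<cdot> u) = pm \<pi> t \<cdot> pm \<pi> u"
  by (simp_all add: pm_def)

lemma pm_close_par:
  "inj \<pi> \<Longrightarrow> pm \<pi> (close_par (Nom c) k t) = close_par (Nom (\<pi> c)) k (pm \<pi> t)"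
proof (induction t arbitrary: k)
  case (Par v)
  then show ?case by (cases v) (auto simp: pm_simps dest: injD)
qed (simp_all add: pm_simps pm_Lam)

lemma pm_abs_noms:
  "inj \<pi> \<Longrightarrow> (\<And>a. snd (\<pi> a) = snd a) \<Longrightarrow> pm \<pi> (abs_noms cs t) = abs_noms (map \<pi> cs) (pm \<pi> t)"
  by (induction cs) (simp_all add: pm_Lam pm_close_par)

lemma na_holds_pm_imp:
  assumes "tperm \<pi>" "na_holds ct \<Sigma> (FNA n s t :: ('p, 'k, 'b) mform)"
  shows "na_holds ct \<Sigma> (FNA n (pm \<pi> s) (pm \<pi> t) :: ('p, 'k, 'b) mform)"
proof -
  from assms(2) obtain cs \<tau> where cs: "length cs = n" "\<forall>c \<in> set cs. inhabited ct (snd c)"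
    and c: "conv ct (mvt ct \<Sigma>) [] s (abs_noms cs t) \<tau>" by (auto simp: na_holds_FNA)
  have "conv ct (mvt ct \<Sigma>) [] (pm \<pi> s) (abs_noms (map \<pi> cs) (pm \<pi> t)) \<tau>"
    using pm_conv[OF c, of \<pi>] pm_abs_noms[of \<pi> cs t] assms(1) bij_is_inj[of \<pi>]
    unfolding tperm_def by fastforce
  moreover have "length (map \<pi> cs) = n" "\<forall>c \<in> set (map \<pi> cs). inhabited ct (snd c)"
    using cs assms(1) by (auto simp: tperm_def)
  ultimately show ?thesis unfolding na_holds_FNA by blast
qed

lemma na_holds_pm:
  assumes "tperm \<pi>"
  shows "na_holds ct \<Sigma> (FNA n (pm \<pi> s) (pm \<pi> t) :: ('p, 'k, 'b) mform) \<longleftrightarrow>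
    na_holds ct \<Sigma> (FNA n s t :: ('p, 'k, 'b) mform)"
  using na_holds_pm_imp[OF assms, where s = s and t = t and n = n]
    na_holds_pm_imp[OF tperm_inv[OF assms], where s = "pm \<pi> s" and t = "pm \<pi> t" and n = n]
  unfolding pm_inv(1)[OF assms] by blast

definition equivariant :: "('p \<Rightarrow> ('k, 'b) mtm list \<Rightarrow> bool) \<Rightarrow> bool" where
  "equivariant I \<longleftrightarrow> (\<forall>\<pi> p us. tperm \<pi> \<longrightarrow> I p us \<longrightarrow> I p (map (pm \<pi>) us))"

lemma equivariant_iff: "equivariant I \<Longrightarrow> tperm \<pi> \<Longrightarrow> I p (map (pm \<pi>) us) \<longleftrightarrow> I p us"
  unfolding equivariant_def
proof (rule iffI)
  assume *: "\<forall>\<pi> p us. tperm \<pi> \<longrightarrow> I p us \<longrightarrow> I p (map (pm \<pi>) us)" "tperm \<pi>" "I p (map (pm \<pi>) us)"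
  then have "I p (map (pm (inv \<pi>)) (map (pm \<pi>) us))" using tperm_inv by blast
  then show "I p us" using *(2) by (simp add: comp_def pm_inv)
qed blast

text \<open>The range of each quantifier is closed under the permutation and its inverse, so
  witnesses can be transported both ways. For \<nabla> the finite exceptional set is
  transported.\<close>

lemma sem_pm:
  assumes "equivariant I" "tperm \<pi>"
  shows "sem ct I (\<lambda>v. pm \<pi> (\<theta> v)) (\<lambda>i. pm \<pi> (e i)) F \<longleftrightarrow> sem ct I \<theta> e F"
proof (induction F arbitrary: e)
  have case_nat: "case_nat (pm \<pi> t) (\<lambda>i. pm \<pi> (e i)) = (\<lambda>i. pm \<pi> (case_nat t e i))" for t e
    by (auto simp: fun_eq_iff split: nat.split)
  have ty: "snd (\<pi> a) = snd a" "snd (inv \<pi> a) = snd a" for a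
    using assms(2) tperm_inv[OF assms(2)] unfolding tperm_def by blast+
  {
    case (FAll \<tau> F)
    show ?case
    proof (simp, safe)
      fix t assume *: "\<forall>t. ground ct t \<tau> \<longrightarrow> sem ct I (\<lambda>v. pm \<pi> (\<theta> v)) (case_nat t (\<lambda>i. pm \<pi> (e i))) F"
        and "ground ct t \<tau>"
      then have "sem ct I (\<lambda>v. pm \<pi> (\<theta> v)) (case_nat (pm \<pi> t) (\<lambda>i. pm \<pi> (e i))) F"
        using pm_has_type ty by blast
      then show "sem ct I \<theta> (case_nat t e) F" using FAll by (simp add: case_nat)
    next
      fix t assume *: "\<forall>t. ground ct t \<tau> \<longrightarrow> sem ct I \<theta> (case_nat t e) F" and "ground ct t \<tau>"
      then have "sem ct I \<theta> (case_nat (pm (inv \<pi>) t) e) F" using pm_has_type ty by blast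
      then show "sem ct I (\<lambda>v. pm \<pi> (\<theta> v)) (case_nat t (\<lambda>i. pm \<pi> (e i))) F"
        using FAll[of "case_nat (pm (inv \<pi>) t) e"] by (simp add: case_nat[symmetric] pm_inv assms(2))
    qed
  next
    case (FEx \<tau> F)
    show ?case
    proof (simp, safe)
      fix t assume *: "sem ct I \<theta> (case_nat t e) F" "ground ct t \<tau>"
      then have "sem ct I (\<lambda>v. pm \<pi> (\<theta> v)) (case_nat (pm \<pi> t) (\<lambda>i. pm \<pi> (e i))) F"
        using FEx by (simp add: case_nat)
      then show "\<exists>t. ground ct t \<tau> \<and> sem ct I (\<lambda>v. pm \<pi> (\<theta> v)) (case_nat t (\<lambda>i. pm \<pi> (e i))) F"
        using pm_has_type ty * by blast
    next
      fix t assume *: "sem ct I (\<lambda>v. pm \<pi> (\<theta> v)) (case_nat t (\<lambda>i. pm \<pi> (e i))) F" "ground ct t \<tau>"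
      then have "sem ct I \<theta> (case_nat (pm (inv \<pi>) t) e) F"
        using FEx[of "case_nat (pm (inv \<pi>) t) e"] by (simp add: case_nat[symmetric] pm_inv assms(2))
      then show "\<exists>t. ground ct t \<tau> \<and> sem ct I \<theta> (case_nat t e) F"
        using pm_has_type ty * by blast
    qed
  next
    case (FNab \<tau> F)
    have IH: "sem ct I (\<lambda>v. pm \<pi> (\<theta> v)) (case_nat (Par (Nom (\<pi> a))) (\<lambda>i. pm \<pi> (e i))) F \<longleftrightarrow>
        sem ct I \<theta> (case_nat (Par (Nom a)) e) F" for a
      using FNab[of "case_nat (Par (Nom a)) e"] by (simp add: case_nat[symmetric])
    have pi: "\<pi> (inv \<pi> a) = a" "inv \<pi> (\<pi> a) = a" for a
      using assms(2) by (auto simp: tperm_def bij_is_inj bij_is_surj surj_f_inv_f)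
    show ?case
      unfolding sem.simps
    proof (intro iffI; elim exE conjE)
      fix X assume "finite X" and *: "\<forall>a. snd a = \<tau> \<and> a \<notin> X \<longrightarrow>
          sem ct I (\<lambda>v. pm \<pi> (\<theta> v)) (case_nat (Par (Nom a)) (\<lambda>i. pm \<pi> (e i))) F"
      show "\<exists>X. finite X \<and> (\<forall>a. snd a = \<tau> \<and> a \<notin> X \<longrightarrow> sem ct I \<theta> (case_nat (Par (Nom a)) e) F)"
      proof (intro exI[of _ "inv \<pi> ` X"] conjI allI impI)
        fix a assume a: "snd a = \<tau> \<and> a \<notin> inv \<pi> ` X"
        then have "\<pi> a \<notin> X" using pi by (metis imageI)
        then show "sem ct I \<theta> (case_nat (Par (Nom a)) e) F"
          using * IH ty a by metis
      qed (use \<open>finite X\<close> in simp)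
    next
      fix X assume "finite X" and
        *: "\<forall>a. snd a = \<tau> \<and> a \<notin> X \<longrightarrow> sem ct I \<theta> (case_nat (Par (Nom a)) e) F"
      show "\<exists>X. finite X \<and> (\<forall>a. snd a = \<tau> \<and> a \<notin> X \<longrightarrow>
          sem ct I (\<lambda>v. pm \<pi> (\<theta> v)) (case_nat (Par (Nom a)) (\<lambda>i. pm \<pi> (e i))) F)"
      proof (intro exI[of _ "\<pi> ` X"] conjI allI impI)
        fix a assume a: "snd a = \<tau> \<and> a \<notin> \<pi> ` X"
        then have "inv \<pi> a \<notin> X" using pi by (metis imageI)
        then have "sem ct I \<theta> (case_nat (Par (Nom (inv \<pi> a))) e) F"
          using * ty a by metis
        then show "sem ct I (\<lambda>v. pm \<pi> (\<theta> v)) (case_nat (Par (Nom a)) (\<lambda>i. pm \<pi> (e i))) F"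
          using IH[of "inv \<pi> a"] pi by simp
      qed (use \<open>finite X\<close> in simp)
    qed
  next
    case (FNA n s t)
    show ?case by (simp add: pm_val[symmetric] na_holds_pm[OF assms(2)])
  next
    case (FAt p ts)
    have "map (val (\<lambda>v. pm \<pi> (\<theta> v)) (\<lambda>i. pm \<pi> (e i))) ts = map (pm \<pi>) (map (val \<theta> e) ts)"
      by (simp add: pm_val)
    then show ?case using equivariant_iff[OF assms] by (simp del: map_map)
  }
qed simp_all

section \<open>Fresh renamings by shifting the number of a constant\<close>

definition shift :: "nat \<Rightarrow> 'b tvar \<Rightarrow> 'b tvar" where
  "shift k a = (fst a + k, snd a)"

lemma snd_shift [simp]: "snd (shift k a) = snd a"
  by (simp add: shift_def)

lemma inj_shift [simp]: "inj (shift k)"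
  by (auto simp: shift_def inj_def prod_eq_iff)

text \<open>Constants are numbered at each type, so a large offset escapes any finite set without
  changing types. Every larger offset works as well, which later permits one offset for two
  purposes.\<close>

lemma shift_avoids: "finite X \<Longrightarrow> \<exists>k\<^sub>0. \<forall>k \<ge> k\<^sub>0. \<forall>a. shift k a \<notin> X"
proof -
  assume "finite X"
  then have fin: "finite (fst ` X)" by simp
  have "shift k a \<notin> X" if "Suc (Max (fst ` X)) \<le> k" for k a
  proof
    assume "shift k a \<in> X"
    then have "fst a + k \<in> fst ` X" by (force simp: shift_def)
    then have "fst a + k \<le> Max (fst ` X)" using fin by simp
    with that show False by simp
  qed
  then show ?thesis by blast
qed

text \<open>The involution that exchanges \<open>f a\<close> and \<open>g a\<close> for
  \<open>a\<close> in \<open>N\<close>. It extends the passage from one injective renaming of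
  \<open>N\<close> to another, a partial map, to a permutation of everything.\<close>

definition swap_images :: "'a set \<Rightarrow> ('a \<Rightarrow> 'c) \<Rightarrow> ('a \<Rightarrow> 'c) \<Rightarrow> 'c \<Rightarrow> 'c" where
  "swap_images N f g x = (if x \<in> f ` N then g (inv_into N f x)
    else if x \<in> g ` N then f (inv_into N g x) else x)"

lemma swap_images:
  assumes "inj_on f N" "inj_on g N" "f ` N \<inter> g ` N = {}"
  shows "a \<in> N \<Longrightarrow> swap_images N f g (f a) = g a" "a \<in> N \<Longrightarrow> swap_images N f g (g a) = f a"
    "x \<notin> f ` N \<Longrightarrow> x \<notin> g ` N \<Longrightarrow> swap_images N f g x = x"
    "swap_images N f g (swap_images N f g x) = x"
proof -
  show 1: "swap_images N f g (f a) = g a" if "a \<in> N" for a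
    using assms that by (auto simp: swap_images_def)
  show 2: "swap_images N f g (g a) = f a" if "a \<in> N" for a
    using assms that by (auto simp: swap_images_def)
  show 3: "x \<notin> f ` N \<Longrightarrow> x \<notin> g ` N \<Longrightarrow> swap_images N f g x = x" for x
    by (simp add: swap_images_def)
  show "swap_images N f g (swap_images N f g x) = x"
    using 1 2 3 by (cases "x \<in> f ` N"; cases "x \<in> g ` N") auto
qed

lemma swap_images_snd:
  assumes "inj_on f N" "inj_on g N" "f ` N \<inter> g ` N = {}" "\<And>a. a \<in> N \<Longrightarrow> snd (f a) = snd (g a)"
  shows "snd (swap_images N f g x) = snd x"
  using swap_images[OF assms(1-3)] assms(4)
  by (cases "x \<in> f ` N"; cases "x \<in> g ` N") auto

text \<open>The witness behind the choice operator in \<open>ncas\<close>: every constant of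
  \<open>N\<close> is exchanged with its shifted copy.\<close>

lemma exists_nom_perm_avoiding:
  assumes "finite N" "finite X"
  shows "\<exists>\<pi>. nom_perm \<pi> \<and> \<pi> ` N \<inter> X = {}"
proof -
  obtain k where k: "\<And>a. shift k a \<notin> N \<union> X"
    using shift_avoids[of "N \<union> X"] assms by auto
  let ?\<pi> = "swap_images N id (shift k)"
  have *: "inj_on id N" "inj_on (shift k) N" "id ` N \<inter> shift k ` N = {}"
    using k inj_on_subset[OF inj_shift] by auto
  note sw = swap_images[OF *]
  have "bij ?\<pi>" using sw(4) by (rule involuntory_imp_bij)
  moreover have "{a. ?\<pi> a \<noteq> a} \<subseteq> id ` N \<union> shift k ` N" using sw(3) by auto
  then have "finite {a. ?\<pi> a \<noteq> a}" by (rule finite_subset) (use assms in simp)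
  moreover have "\<forall>a. snd (?\<pi> a) = snd a" using swap_images_snd[OF *] by simp
  moreover have "?\<pi> ` N \<inter> X = {}" using sw(1) k by auto
  ultimately show ?thesis unfolding nom_perm_def by blast
qed

subsection \<open>The term model of a definition\<close>

text \<open>Absence of implication makes truth monotone in the predicates, so that the clauses have
  a least fixed point.\<close>

primrec positive :: "('p, 't, 'b) form \<Rightarrow> bool" where
  "positive FTop \<longleftrightarrow> True"
| "positive FBot \<longleftrightarrow> True"
| "positive (FAnd F G) \<longleftrightarrow> positive F \<and> positive G"
| "positive (FOr F G) \<longleftrightarrow> positive F \<and> positive G"
| "positive (FImp F G) \<longleftrightarrow> False"
| "positive (FAll \<tau> F) \<longleftrightarrow> positive F"
| "positive (FEx \<tau> F) \<longleftrightarrow> positive F"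
| "positive (FNab \<tau> F) \<longleftrightarrow> positive F"
| "positive (FNA n s t) \<longleftrightarrow> True"
| "positive (FAt p ts) \<longleftrightarrow> True"

lemma sem_mono: "positive F \<Longrightarrow> I \<le> J \<Longrightarrow> sem ct I \<theta> e F \<Longrightarrow> sem ct J \<theta> e F"
proof (induction F arbitrary: e)
  case (FNab \<tau> F)
  from FNab.prems(3) obtain X where "finite X"
    "\<forall>a. snd a = \<tau> \<and> a \<notin> X \<longrightarrow> sem ct I \<theta> (case_nat (Par (Nom a)) e) F" by auto
  then show ?case using FNab.IH FNab.prems by (auto intro!: exI[of _ X])
next
  case (FAt p ts)
  then show ?case by (auto simp: le_fun_def)
qed auto

text \<open>Typing of the arguments is built in: the body is well-formed relative to the argument
  types, and its truth respects conversion between arguments of these types.\<close>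

definition step :: "('k \<Rightarrow> 'b ty option) \<Rightarrow> ('p, 'k, 'b) defn \<Rightarrow>
    ('p \<Rightarrow> ('k, 'b) mtm list \<Rightarrow> bool) \<Rightarrow> 'p \<Rightarrow> ('k, 'b) mtm list \<Rightarrow> bool" where
  "step ct D I p us \<longleftrightarrow>
    list_all2 (ground ct) us (arg_types D p) \<and> sem ct I Par (inst us) (snd (snd (D p)))"

text \<open>Closed bodies without nominal constants make the fixed point equivariant and independent
  of the assignment; positivity makes it exist. Predicates marked \<open>Nu\<close> would call for
  greatest fixed points instead.\<close>

locale term_model =
  fixes ct :: "'k \<Rightarrow> 'b ty option" and D :: "('p, 'k, 'b) defn"
  assumes body_wf: "wf_form ct D {} (arg_types D p) (snd (snd (D p)))"
    and body_supp: "supp (snd (snd (D p))) = {}"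
    and body_positive: "positive (snd (snd (D p)))"
    and not_Nu: "fst (D p) \<noteq> Nu"
begin

definition M :: "'p \<Rightarrow> ('k, 'b) mtm list \<Rightarrow> bool" where
  "M = lfp (step ct D)"

lemma mono_step: "mono (step ct D)"
  using sem_mono[OF body_positive] by (fastforce simp: mono_def step_def intro!: le_funI)

lemma M_unfold: "M = step ct D M"
  unfolding M_def by (rule lfp_unfold[OF mono_step])

lemma M_iff: "M p us \<longleftrightarrow> step ct D M p us"
  using M_unfold by metis

lemma M_lowerbound: "step ct D J \<le> J \<Longrightarrow> M \<le> J"
  unfolding M_def by (rule lfp_lowerbound)

lemma body_fpars: "fpars (snd (snd (D p))) = {}"
proof -
  have "v \<notin> fpars (snd (snd (D p)))" for v
    using body_supp[of p] wf_form_Eig[OF body_wf, of _ p] by (cases v) (auto simp: supp_iff[symmetric])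
  then show ?thesis by blast
qed

lemma sem_body_cong:
  "list_all2 R us (arg_types D p) \<Longrightarrow> (\<And>i. i < length us \<Longrightarrow> e i = us ! i) \<Longrightarrow>
    sem ct I \<theta> e (snd (snd (D p))) \<longleftrightarrow> sem ct I Par (inst us) (snd (snd (D p)))"
  by (rule sem_cong[OF body_wf]) (auto simp: body_fpars inst_def list_all2_lengthD)

lemma ground_map_Par: "ground_map ct {} Par"
  by (auto simp: ground_map_def has_type_Par_iff)

text \<open>Both properties concern an interpretation as a whole. They are carried up the
  transfinite iteration, being preserved by \<open>step\<close> and by suprema.\<close>

lemma M_closed: "conv_closed ct M \<and> equivariant M"
  unfolding M_def
proof (rule lfp_ordinal_induct[OF mono_step])
  fix I :: "'p \<Rightarrow> ('k, 'b) mtm list \<Rightarrow> bool"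
  assume I: "conv_closed ct I \<and> equivariant I"
  show "conv_closed ct (step ct D I) \<and> equivariant (step ct D I)"
  proof
    show "conv_closed ct (step ct D I)"
      unfolding conv_closed_def
    proof (intro allI impI)
      fix p us us'
      assume us: "list_all2 (\<lambda>t t'. \<exists>\<tau>. gconv ct t t' \<tau>) us us'" and s: "step ct D I p us"
      have g: "gconv ct (us ! i) (us' ! i) (arg_types D p ! i)" if "i < length us" for i
      proof -
        from us that obtain \<tau> where "gconv ct (us ! i) (us' ! i) \<tau>"
          by (auto simp: list_all2_conv_all_nth)
        moreover have "ground ct (us ! i) (arg_types D p ! i)"
          using s that by (auto simp: step_def list_all2_conv_all_nth)
        ultimately show ?thesis using conv_has_type has_type_unique by metis
      qed
      have l: "length us = length us'" "length us = length (arg_types D p)"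
        using us s by (auto simp: step_def dest: list_all2_lengthD)
      have "sem ct I Par (inst us) (snd (snd (D p))) \<longleftrightarrow> sem ct I Par (inst us') (snd (snd (D p)))"
        by (rule sem_conv[OF fconv_refl[OF body_wf] body_wf])
          (use I g l ground_map_Par in \<open>auto simp: inst_def\<close>)
      moreover have "list_all2 (ground ct) us' (arg_types D p)"
        using l conv_has_type[OF g] by (auto simp: list_all2_conv_all_nth)
      ultimately show "step ct D I p us'" using s by (simp add: step_def)
    qed
    show "equivariant (step ct D I)"
      unfolding equivariant_def
    proof (intro allI impI)
      fix \<pi> :: "'b tvar \<Rightarrow> 'b tvar" and p us
      assume \<pi>: "tperm \<pi>" and s: "step ct D I p us"
      have "ground ct (pm \<pi> t) \<tau>" if "ground ct t \<tau>" for t \<tau>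
        using pm_has_type[OF that] \<pi> unfolding tperm_def by blast
      then have l: "list_all2 (ground ct) (map (pm \<pi>) us) (arg_types D p)"
        using s unfolding step_def list.rel_map by (blast intro: list.rel_mono_strong)
      \<comment> \<open>The permutation also changes the assignment \<open>Par\<close>, but the body
        contains no parameters, so only the change of the arguments is visible.\<close>
      have "sem ct I (\<lambda>v. pm \<pi> (Par v)) (\<lambda>i. pm \<pi> (inst us i)) (snd (snd (D p)))"
        using sem_pm[of I \<pi>] \<pi> I s by (simp add: step_def)
      then have "sem ct I Par (inst (map (pm \<pi>) us)) (snd (snd (D p)))"
        by (subst (asm) sem_body_cong[OF l]) (auto simp: inst_def)
      with l show "step ct D I p (map (pm \<pi>) us)" by (simp add: step_def)
    qed
  qed
next
  fix A :: "('p \<Rightarrow> ('k, 'b) mtm list \<Rightarrow> bool) set"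
  assume A: "\<forall>I \<in> A. conv_closed ct I \<and> equivariant I"
  show "conv_closed ct (Sup A) \<and> equivariant (Sup A)"
  proof
    show "conv_closed ct (Sup A)"
      unfolding conv_closed_def
    proof (intro allI impI)
      fix p us us' assume us: "list_all2 (\<lambda>t t'. \<exists>\<tau>. gconv ct t t' \<tau>) us us'" and "Sup A p us"
      then obtain I where I: "I \<in> A" "I p us" by auto
      then have "I p us'" using A us unfolding conv_closed_def by blast
      with I show "Sup A p us'" by auto
    qed
    show "equivariant (Sup A)"
      unfolding equivariant_def
    proof (intro allI impI)
      fix \<pi> :: "'b tvar \<Rightarrow> 'b tvar" and p us assume \<pi>: "tperm \<pi>" and "Sup A p us"
      then obtain I where I: "I \<in> A" "I p us" by auto
      then have "I p (map (pm \<pi>) us)" using A \<pi> unfolding equivariant_def by blast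
      with I show "Sup A p (map (pm \<pi>) us)" by auto
    qed
  qed
qed

lemmas M_conv_closed = M_closed[THEN conjunct1]
lemmas M_equivariant = M_closed[THEN conjunct2]

text \<open>Park induction for one predicate of a simultaneous definition, the other predicates
  keeping their value in \<open>M\<close>. This is the semantic content of \<open>IL\<close>;
  \<open>S\<close> may come from an invariant with implications, since only the bodies have to be
  monotone.\<close>

lemma M_induct:
  assumes "\<And>us. list_all2 (ground ct) us (arg_types D p) \<Longrightarrow>
      sem ct (M(p := S)) Par (inst us) (snd (snd (D p))) \<Longrightarrow> S us"
    and "M p us"
  shows "S us"
proof -
  \<comment> \<open>The pre-fixed point cuts \<open>M\<close> down to \<open>S\<close> at
    \<open>p\<close> only. Being below \<open>M\<close> and below \<open>M(p := S)\<close>, it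
    yields membership in \<open>M\<close> by the first bound and in \<open>S\<close> by the
    second.\<close>
  let ?J = "M(p := \<lambda>us. M p us \<and> S us)"
  have J: "?J \<le> M" "?J \<le> M(p := S)" by (auto simp: le_fun_def)
  have 1: "M q us" if "step ct D ?J q us" for q us
    using predicate2D[OF monoD[OF mono_step J(1)] that] by (rule M_iff[THEN iffD2])
  have 2: "S us" if "step ct D ?J p us" for us
    using that assms(1) sem_mono[OF body_positive J(2)] unfolding step_def by blast
  have "step ct D ?J q us \<Longrightarrow> ?J q us" for q us
    using 1[of q us] 2[of us] by (cases "q = p") simp_all
  then have "M \<le> ?J" by (intro M_lowerbound) (auto simp: le_fun_def)
  then have "?J p us" using assms(2) by (rule predicate2D)
  then show ?thesis by simp
qed

end

subsection \<open>Soundness of the meta-logic\<close>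

lemma exists_shift_avoiding: "finite X \<Longrightarrow> \<exists>k. \<forall>a. shift k a \<notin> X"
  using shift_avoids[of X] by blast

lemma pars_ren: "pars (ren r t) = pars t"
  by (induction t arbitrary: r) auto

lemma pars_up: "(\<Union>i. pars (up \<sigma> i)) \<subseteq> (\<Union>i. pars (\<sigma> i))"
  by (auto simp: up_def pars_ren split: nat.splits)

lemma pars_sub: "pars (sub \<sigma> t) \<subseteq> pars t \<union> (\<Union>i. pars (\<sigma> i))"
proof (induction t arbitrary: \<sigma>)
  case (Lam \<tau> t)
  show ?case using Lam[of "up \<sigma>"] pars_up[of \<sigma>] by simp blast
qed fastforce+

lemma fpars_fsub: "fpars (fsub \<sigma> F) \<subseteq> fpars F \<union> (\<Union>i. pars (\<sigma> i))"
proof (induction F arbitrary: \<sigma>)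
  case (FAll \<tau> F)
  show ?case using FAll[of "up \<sigma>"] pars_up[of \<sigma>] by simp blast
next
  case (FEx \<tau> F)
  show ?case using FEx[of "up \<sigma>"] pars_up[of \<sigma>] by simp blast
next
  case (FNab \<tau> F)
  show ?case using FNab[of "up \<sigma>"] pars_up[of \<sigma>] by simp blast
next
  case (FNA n s t)
  show ?case using pars_sub[of \<sigma> s] pars_sub[of \<sigma> t] by auto
next
  case (FAt p ts)
  show ?case using pars_sub[of \<sigma>] by auto
qed fastforce+

lemma fpars_fsub_inst: "fpars (fsub (inst ts) F) \<subseteq> fpars F \<union> (\<Union>t \<in> set ts. pars t)"
  using fpars_fsub[of "inst ts" F] by (auto simp: inst_def split: if_splits)

lemma fpars_pred_subst: "fpars (pred_subst p S F) \<subseteq> fpars F \<union> fpars S"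
proof (induction F)
  case (FAt q ts)
  show ?case using fpars_fsub_inst[of ts S] by auto
qed auto

text \<open>Substituting for parameters inside a formula amounts to changing the assignment. The
  assumption covers every environment because the substituted terms end up below
  quantifiers.\<close>

lemma sem_map_form:
  assumes "\<And>v e. v \<in> fpars F \<Longrightarrow> val \<theta> e (\<phi> v) = \<theta>' v"
  shows "sem ct I \<theta> e (map_form id (hom Base Con \<phi> Bd) F) \<longleftrightarrow> sem ct I \<theta>' e F"
  using assms
proof (induction F arbitrary: e)
  have val: "val \<theta> e (hom Base Con \<phi> Bd t) = val \<theta>' e t"
    if "\<And>v e. v \<in> pars t \<Longrightarrow> val \<theta> e (\<phi> v) = \<theta>' v" for e t
    unfolding hom_hom using that by (auto intro: hom_cong_pars)
  {
    case (FNA n s t)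
    then show ?case using val[of s e] val[of t e] by simp
  next
    case (FAt p ts)
    then have "val \<theta> e (hom Base Con \<phi> Bd t) = val \<theta>' e t" if "t \<in> set ts" for t
      using that by (intro val) auto
    then show ?case by (simp add: comp_def cong: map_cong)
  }
qed simp_all

text \<open>\<open>psub\<close> does not lift under binders, so agreement requires values that
  lifting leaves alone.\<close>

lemma psub_eq_hom: "(\<And>v. v \<in> pars t \<Longrightarrow> ren Suc (\<theta> v) = \<theta> v) \<Longrightarrow> psub \<theta> t = hom Base Con \<theta> Bd t"
proof (induction t)
  case (Lam \<tau> t)
  have "hom Base Con (\<lambda>v. ren Suc (\<theta> v)) Bd t = hom Base Con \<theta> Bd t"
    by (rule hom_cong_pars) (use Lam.prems in auto)
  then show ?case using Lam by simp
qed auto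

lemma map_tm_eq_pm: "map_tm id (case_mvar (\<lambda>a. Nom (\<pi> a)) Eig) id = pm \<pi>"
  by (auto simp: map_tm_eq_hom pm_def fun_eq_iff intro!: hom_cong_pars split: mvar.split)

lemma permute_eq: "permute \<pi> F = map_form id (pm \<pi>) F"
  by (simp add: permute_def map_tm_eq_pm)

lemma pars_pm: "pars (pm \<pi> t) = case_mvar (\<lambda>a. Nom (\<pi> a)) Eig ` pars t"
proof (induction t)
  case (Par v)
  then show ?case by (cases v) (auto simp: pm_simps)
qed (auto simp: pm_simps pm_Lam)

lemma noms_pm: "noms (pm \<pi> t) = \<pi> ` noms t"
  by (force simp: noms_def pars_pm split: mvar.splits)

lemma supp_permute: "supp (permute \<pi> F) = \<pi> ` supp F"
  by (simp add: supp_def permute_eq form.set_map image_UN noms_pm)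

lemma wf_form_map_hom:
  assumes "wf_form ct D \<Sigma> E F" "ground_map ct \<Sigma> \<phi>"
  shows "wf_form ct D {} E (map_form id (hom Base Con \<phi> Bd) F)"
proof -
  have ht: "has_type ct (mvt ct {}) E (hom Base Con \<phi> Bd t) \<tau>"
    if "has_type ct (mvt ct \<Sigma>) E t \<tau>" for E t \<tau>
    by (rule has_type_hom[OF that, where \<beta> = Base, unfolded bind_ty_Base])
      (use assms(2) in \<open>auto simp: has_type_iffs ground_map_def intro: has_type_weaken_closed\<close>)
  show ?thesis
    using assms(1)
  proof (induction F arbitrary: E)
    case (FNA n s t)
    then obtain \<tau>s \<tau> where "length \<tau>s = n"
      "has_type ct (mvt ct \<Sigma>) E s (fun_ty \<tau>s \<tau>)" "has_type ct (mvt ct \<Sigma>) E t \<tau>" by auto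
    then show ?case using ht by simp blast
  next
    case (FAt p ts)
    then show ?case using ht by (auto simp: list.rel_map elim!: list.rel_mono_strong)
  qed auto
qed

section \<open>Abstracting over nominal constants and applying to them again\<close>

lemma conv_apps:
  "conv ct vt E f g (fun_ty \<tau>s \<tau>) \<Longrightarrow> list_all2 (has_type ct vt E) ts \<tau>s \<Longrightarrow>
    conv ct vt E (apps f ts) (apps g ts) \<tau>"
proof (induction \<tau>s arbitrary: f g ts)
  case (Cons \<sigma> \<tau>s)
  from Cons.prems(2) obtain u us where *: "ts = u # us" "has_type ct vt E u \<sigma>"
    "list_all2 (has_type ct vt E) us \<tau>s"
    by (auto simp: list_all2_Cons2)
  then have "conv ct vt E (f \<cdot> u) (g \<cdot> u) (fun_ty \<tau>s \<tau>)"
    using Cons.prems(1) by (auto intro: conv.app conv.refl)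
  then show ?case using Cons.IH * by simp
qed simp

lemma open_close_par: "sub (inst [Par v]) (close_par v 0 t) = t"
proof -
  have "hom Base Con (\<lambda>w. sub (inst [Par v]) (if w = v then Bd 0 else Par w)) Bd t = hom Base Con Par Bd t"
    by (rule hom_cong_pars) (simp add: inst_Cons)
  then show ?thesis unfolding close_par_eq_hom sub_hom by (simp add: inst_Cons)
qed

text \<open>One \<beta>-step per constant restores the term. This is how a raised eigenvariable,
  applied to the support, obtains its intended value.\<close>

lemma conv_apps_abs_noms:
  assumes "has_type ct (mvt ct \<Sigma>) [] t \<tau>" "\<forall>d \<in> set ds. inhabited ct (snd d)"
  shows "conv ct (mvt ct \<Sigma>) [] (apps (abs_noms ds t) (map (\<lambda>d. Par (Nom d)) ds)) t \<tau>"
  using assms(2)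
proof (induction ds)
  case Nil
  then show ?case using assms(1) by (auto intro: conv.refl)
next
  case (Cons d ds)
  let ?w = "abs_noms ds t"
  have d: "has_type ct (mvt ct \<Sigma>) [] (Par (Nom d)) (snd d)"
    using Cons.prems by (simp add: has_type_Par_iff mvt_Nom)
  have "has_type ct (mvt ct \<Sigma>) [snd d] (close_par (Nom d) 0 ?w) (fun_ty (map snd ds) \<tau>)"
    using close_par_conv[OF conv.refl[OF abs_noms_has_type[OF assms(1)]]] conv_has_type by blast
  from conv.beta[OF this d]
  have "conv ct (mvt ct \<Sigma>) [] (abs_noms (d # ds) t \<cdot> Par (Nom d)) ?w (fun_ty (map snd ds) \<tau>)"
    by (simp add: open_close_par)
  then have "conv ct (mvt ct \<Sigma>) [] (apps (abs_noms (d # ds) t \<cdot> Par (Nom d)) (map (\<lambda>d. Par (Nom d)) ds))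
      (apps ?w (map (\<lambda>d. Par (Nom d)) ds)) \<tau>"
    by (rule conv_apps)
      (use Cons.prems in \<open>auto simp: list_all2_conv_all_nth has_type_Par_iff mvt_Nom\<close>)
  then show ?case using Cons by (auto intro: conv.trans)
qed

lemma val_apps: "hom \<beta> \<kappa> \<theta> e (apps t us) = apps (hom \<beta> \<kappa> \<theta> e t) (map (hom \<beta> \<kappa> \<theta> e) us)"
  by (induction us arbitrary: t) auto

lemma pars_apps: "pars (apps t us) = pars t \<union> (\<Union>u \<in> set us. pars u)"
  by (induction us arbitrary: t) auto

text \<open>\<open>S\<close> has no parameters, so its truth does not depend on the place where it
  is inserted and can be moved into the interpretation of \<open>p\<close>.\<close>

lemma sem_pred_subst:
  assumes "wf_form ct D {} (arg_types D p) S" "fpars S = {}" "wf_form ct D \<Sigma> E F"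
  shows "sem ct I \<theta> e (pred_subst p S F) \<longleftrightarrow>
    sem ct (I(p := \<lambda>us. sem ct I Par (inst us) S)) \<theta> e F"
  using assms(3)
proof (induction F arbitrary: E e)
  case (FAt q ts)
  show ?case
  proof (cases "q = p")
    case True
    have "sem ct I \<theta> (\<lambda>i. val \<theta> e (inst ts i)) S \<longleftrightarrow> sem ct I Par (inst (map (val \<theta> e) ts)) S"
      by (rule sem_cong[OF assms(1)])
        (use assms(2) FAt True in \<open>auto simp: inst_def dest!: list_all2_lengthD\<close>)
    then show ?thesis using True by (simp add: sem_fsub)
  qed simp
qed auto

section \<open>Truth under a ground substitution of eigenvariables\<close>

definition gsubst :: "('k \<Rightarrow> 'b ty option) \<Rightarrow> 'b tvar set \<Rightarrow> ('b tvar \<Rightarrow> ('k, 'b) mtm) \<Rightarrow> bool" where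
  "gsubst ct \<Sigma> \<theta> \<longleftrightarrow> (\<forall>h \<in> \<Sigma>. ground ct (\<theta> h) (snd h))"

lemma gsubst_ground_map:
  "gsubst ct \<Sigma> \<theta> \<Longrightarrow> (\<And>a. snd (\<rho> a) = snd a) \<Longrightarrow> ground_map ct \<Sigma> (cmb \<rho> \<theta>)"
  by (auto simp: gsubst_def ground_map_def mvt_def has_type_Par_iff split: mvar.splits if_splits)

lemma ground_noEig: "ground ct t \<tau> \<Longrightarrow> Eig h \<notin> pars t"
  by (auto dest: has_type_pars simp: mvt_Eig)

text \<open>The renamed constants of \<open>F\<close> must not meet those in the terms substituted
  for the eigenvariables of \<open>F\<close>. The condition looks at the formula rather than at a
  signature, so truth can be defined for a formula alone.\<close>

definition fresh_ren :: "('b tvar \<Rightarrow> 'b tvar) \<Rightarrow> ('b tvar \<Rightarrow> ('k, 'b) mtm) \<Rightarrow> ('p, 'k, 'b) mform \<Rightarrow> bool" where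
  "fresh_ren \<rho> \<theta> F \<longleftrightarrow> inj \<rho> \<and> (\<forall>a. snd (\<rho> a) = snd a) \<and>
    (\<forall>a \<in> supp F. \<forall>h. Eig h \<in> fpars F \<longrightarrow> \<rho> a \<notin> noms (\<theta> h))"

context term_model
begin

abbreviation wff :: "'b tvar set \<Rightarrow> ('p, 'k, 'b) mform \<Rightarrow> bool" where
  "wff \<Sigma> \<equiv> wf_form ct D \<Sigma> []"

abbreviation holds :: "('b tvar \<Rightarrow> 'b tvar) \<Rightarrow> ('b tvar \<Rightarrow> ('k, 'b) mtm) \<Rightarrow> (nat \<Rightarrow> ('k, 'b) mtm) \<Rightarrow>
    ('p, 'k, 'b) mform \<Rightarrow> bool" where
  "holds \<rho> \<theta> \<equiv> sem ct M (cmb \<rho> \<theta>)"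

text \<open>Existential in form, but for well-formed formulas equivalent to truth under any given
  fresh renaming, by \<open>tr_iff\<close>.\<close>

definition tr :: "('b tvar \<Rightarrow> ('k, 'b) mtm) \<Rightarrow> ('p, 'k, 'b) mform \<Rightarrow> bool" where
  "tr \<theta> F \<longleftrightarrow> (\<exists>\<rho>. fresh_ren \<rho> \<theta> F \<and> holds \<rho> \<theta> Bd F)"

text \<open>Shifting by a large offset is a canonical fresh renaming. The permutation that exchanges
  \<open>\<rho> a\<close> with the shifted \<open>a\<close> fixes the values of the eigenvariables
  of \<open>F\<close>, since both renamings avoid them; equivariance does the rest.\<close>

lemma fresh_ren_shift:
  assumes F: "wff \<Sigma> F" and \<rho>: "fresh_ren \<rho> \<theta> F"
  shows "\<exists>k\<^sub>0. \<forall>k \<ge> k\<^sub>0. holds \<rho> \<theta> Bd F \<longleftrightarrow> holds (shift k) \<theta> Bd F"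
proof -
  let ?X = "\<rho> ` supp F \<union> (\<Union>h \<in> {h. Eig h \<in> fpars F}. noms (\<theta> h))"
  have "finite ?X" by (simp add: finite_Eig_vimage)
  then obtain k\<^sub>0 where k0: "\<forall>k \<ge> k\<^sub>0. \<forall>a. shift k a \<notin> ?X" using shift_avoids by blast
  show ?thesis
  proof (intro exI allI impI)
    fix k assume "k\<^sub>0 \<le> k"
    then have k: "shift k a \<notin> ?X" for a using k0 by blast
    let ?\<pi> = "swap_images (supp F) \<rho> (shift k)"
    have *: "inj_on \<rho> (supp F)" "inj_on (shift k) (supp F)" "\<rho> ` supp F \<inter> shift k ` supp F = {}"
    proof -
      show "inj_on \<rho> (supp F)" using \<rho> inj_on_subset[of \<rho> UNIV "supp F"] by (simp add: fresh_ren_def)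
      show "inj_on (shift k) (supp F)" by (rule inj_on_subset[OF inj_shift]) simp
      show "\<rho> ` supp F \<inter> shift k ` supp F = {}"
        unfolding disjoint_iff using k by (metis UnI1 imageE)
    qed
    note sw = swap_images[OF *]
    have "snd (?\<pi> a) = snd a" for a
      by (rule swap_images_snd[OF *]) (use \<rho> in \<open>metis fresh_ren_def snd_shift\<close>)
    then have \<pi>: "tperm ?\<pi>" using sw(4) by (intro tperm_involution)
    have "holds \<rho> \<theta> Bd F \<longleftrightarrow> sem ct M (\<lambda>v. pm ?\<pi> (cmb \<rho> \<theta> v)) (\<lambda>i. pm ?\<pi> (Bd i)) F"
      by (rule sem_pm[OF M_equivariant \<pi>, symmetric])
    also have "\<dots> \<longleftrightarrow> holds (shift k) \<theta> Bd F"
    proof (rule sem_cong[OF F])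
      fix v assume v: "v \<in> fpars F"
      show "pm ?\<pi> (cmb \<rho> \<theta> v) = cmb (shift k) \<theta> v"
      proof (cases v)
        case (Nom a)
        then show ?thesis using v sw(1) by (simp add: supp_iff)
      next
        case (Eig h)
        have "?\<pi> a = a" if "a \<in> noms (\<theta> h)" for a
        proof (rule sw(3))
          show "a \<notin> \<rho> ` supp F" using \<rho> v Eig that unfolding fresh_ren_def by blast
          show "a \<notin> shift k ` supp F" using k v Eig that by blast
        qed
        then have "pm ?\<pi> (\<theta> h) = \<theta> h" by (intro pm_fresh) (simp add: noms_def)
        then show ?thesis using Eig by simp
      qed
    qed simp
    finally show "holds \<rho> \<theta> Bd F \<longleftrightarrow> holds (shift k) \<theta> Bd F" .
  qed
qed

text \<open>Two fresh renamings are compared with one and the same shift, whose offset is beyond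
  both thresholds.\<close>

lemma tr_iff:
  assumes F: "wff \<Sigma> F" and \<rho>: "fresh_ren \<rho> \<theta> F"
  shows "tr \<theta> F \<longleftrightarrow> holds \<rho> \<theta> Bd F"
proof -
  have "holds \<rho>' \<theta> Bd F \<longleftrightarrow> holds \<rho> \<theta> Bd F" if \<rho>': "fresh_ren \<rho>' \<theta> F" for \<rho>'
    using fresh_ren_shift[OF F \<rho>] fresh_ren_shift[OF F \<rho>'] by (meson max.cobounded1 max.cobounded2)
  then show ?thesis using \<rho> unfolding tr_def by blast
qed

text \<open>Freshness for a whole signature, so that one renaming evaluates all formulas of a
  sequent at once.\<close>

definition avoids :: "'b tvar set \<Rightarrow> ('b tvar \<Rightarrow> ('k, 'b) mtm) \<Rightarrow> ('b tvar \<Rightarrow> 'b tvar) \<Rightarrow> bool" where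
  "avoids \<Sigma> \<theta> \<rho> \<longleftrightarrow> inj \<rho> \<and> (\<forall>a. snd (\<rho> a) = snd a) \<and> (\<forall>h \<in> \<Sigma>. \<forall>a. \<rho> a \<notin> noms (\<theta> h))"

lemma avoidsD:
  assumes "avoids \<Sigma> \<theta> \<rho>"
  shows "inj \<rho>" "\<And>a. snd (\<rho> a) = snd a" "\<And>a h. h \<in> \<Sigma> \<Longrightarrow> \<rho> a \<notin> noms (\<theta> h)"
  using assms unfolding avoids_def by blast+

lemma exists_avoids: "finite \<Sigma> \<Longrightarrow> \<exists>\<rho>. avoids \<Sigma> \<theta> \<rho>"
proof -
  assume "finite \<Sigma>"
  then have "finite (\<Union>h \<in> \<Sigma>. noms (\<theta> h))" by simp
  then obtain k where "\<forall>a. shift k a \<notin> (\<Union>h \<in> \<Sigma>. noms (\<theta> h))" using exists_shift_avoiding by metis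
  then have "avoids \<Sigma> \<theta> (shift k)" unfolding avoids_def using inj_shift snd_shift by blast
  then show ?thesis by blast
qed

lemma tr_avoids:
  assumes "avoids \<Sigma> \<theta> \<rho>" "wff \<Sigma> F"
  shows "tr \<theta> F \<longleftrightarrow> holds \<rho> \<theta> Bd F"
  by (rule tr_iff[OF assms(2)]) (use avoidsD[OF assms(1)] wf_form_Eig[OF assms(2)] in \<open>simp add: fresh_ren_def\<close>)

lemma tr_upd:
  assumes "wff \<Sigma> F" "h \<notin> \<Sigma>"
  shows "tr (\<theta>(h := u)) F \<longleftrightarrow> tr \<theta> F"
proof -
  have h: "Eig h \<notin> fpars F" using wf_form_Eig[OF assms(1)] assms(2) by blast
  then have "fresh_ren \<rho> (\<theta>(h := u)) F \<longleftrightarrow> fresh_ren \<rho> \<theta> F" for \<rho>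
    unfolding fresh_ren_def by (metis fun_upd_other)
  moreover have "holds \<rho> (\<theta>(h := u)) Bd F \<longleftrightarrow> holds \<rho> \<theta> Bd F" for \<rho>
    by (rule sem_cong[OF assms(1)]) (use h in \<open>auto split: mvar.split\<close>)
  ultimately show ?thesis unfolding tr_def by blast
qed

lemma tr_fconv:
  assumes "finite \<Sigma>" "gsubst ct \<Sigma> \<theta>" "fconv ct \<Sigma> [] F F'" "wff \<Sigma> F"
  shows "tr \<theta> F \<longleftrightarrow> tr \<theta> F'"
proof -
  obtain \<rho> where av: "avoids \<Sigma> \<theta> \<rho>" using exists_avoids[OF assms(1)] by blast
  note \<rho> = avoidsD(2)[OF av] tr_avoids[OF av]
  have "holds \<rho> \<theta> Bd F \<longleftrightarrow> holds \<rho> \<theta> Bd F'"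
    by (rule sem_conv[OF assms(3,4) M_conv_closed gsubst_ground_map[OF assms(2) \<rho>(1)]]) simp
  then show ?thesis using \<rho>(2) assms(4) fconv_wf_form[OF assms(3)] by simp
qed

text \<open>Soundness of \<open>ident\<close>: the permutation is absorbed into the renaming, and
  the composite still avoids the signature.\<close>

lemma tr_permute:
  assumes "finite \<Sigma>" "nom_perm \<pi>" "wff \<Sigma> F" "wff \<Sigma> (permute \<pi> F)"
  shows "tr \<theta> (permute \<pi> F) \<longleftrightarrow> tr \<theta> F"
proof -
  obtain \<rho> where av: "avoids \<Sigma> \<theta> \<rho>" using exists_avoids[OF assms(1)] by blast
  note \<rho> = avoidsD[OF av] tr_avoids[OF av]
  have \<pi>: "inj \<pi>" "\<And>a. snd (\<pi> a) = snd a" using assms(2) bij_is_inj unfolding nom_perm_def by blast+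
  have "tr \<theta> (permute \<pi> F) \<longleftrightarrow> holds \<rho> \<theta> Bd (permute \<pi> F)" using \<rho>(4) assms(4) by blast
  also have "\<dots> \<longleftrightarrow> holds (\<lambda>a. \<rho> (\<pi> a)) \<theta> Bd F"
    unfolding permute_eq pm_def by (rule sem_map_form) (auto split: mvar.split)
  also have "\<dots> \<longleftrightarrow> tr \<theta> F"
  proof (rule tr_avoids[OF _ assms(3), symmetric])
    show "avoids \<Sigma> \<theta> (\<lambda>a. \<rho> (\<pi> a))"
      using inj_compose[OF \<rho>(1) \<pi>(1)] \<rho>(2,3) \<pi>(2) by (auto simp: avoids_def comp_def)
  qed
  finally show ?thesis .
qed

text \<open>Turns the chosen permutation followed by \<open>psub\<close> into a single homomorphism,
  which is legitimate because ground values are closed.\<close>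

lemma ncas_eq:
  assumes "finite \<Sigma>" "gsubst ct \<Sigma> \<theta>" "wff \<Sigma> F"
  obtains \<pi> where "nom_perm \<pi>" "\<And>a h. a \<in> supp F \<Longrightarrow> h \<in> \<Sigma> \<Longrightarrow> \<pi> a \<notin> noms (\<theta> h)"
    "ncas \<Sigma> \<theta> F = map_form id (hom Base Con (cmb \<pi> \<theta>) Bd) F"
proof -
  define P where "P = (\<lambda>\<pi>. nom_perm \<pi> \<and> supp (permute \<pi> F) \<inter> (\<Union>h \<in> \<Sigma>. noms (\<theta> h)) = {})"
  have "\<exists>\<pi>. P \<pi>"
    using exists_nom_perm_avoiding[of "supp F" "\<Union>h \<in> \<Sigma>. noms (\<theta> h)"] assms(1)
    by (auto simp: P_def supp_permute)
  then have P: "P (SOME \<pi>. P \<pi>)" by (rule someI_ex)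
  define \<pi> where "\<pi> = (SOME \<pi>. P \<pi>)"
  let ?\<theta> = "case_mvar (\<lambda>a. Par (Nom a)) \<theta>"
  have "psub ?\<theta> (pm \<pi> t) = hom Base Con (cmb \<pi> \<theta>) Bd t" if t: "t \<in> tms F" for t
  proof -
    have "ren Suc (?\<theta> v) = ?\<theta> v" if v: "v \<in> pars (pm \<pi> t)" for v
    proof (cases v)
      case (Eig h)
      then have "Eig h \<in> pars t" using v by (auto simp: pars_pm split: mvar.splits)
      then have "Eig h \<in> fpars F" using t by (auto simp: fpars_def)
      then have "h \<in> \<Sigma>" using assms(3) wf_form_Eig by blast
      then have "ground ct (\<theta> h) (snd h)" using assms(2) by (simp add: gsubst_def)
      then show ?thesis using Eig ren_closed by simp
    qed simp
    then have "psub ?\<theta> (pm \<pi> t) = hom Base Con ?\<theta> Bd (pm \<pi> t)" by (rule psub_eq_hom)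
    also have "\<dots> = hom Base Con (cmb \<pi> \<theta>) Bd t"
      unfolding pm_def hom_hom by (auto intro!: hom_cong_pars split: mvar.split)
    finally show ?thesis .
  qed
  then have "map_form id (psub ?\<theta>) (permute \<pi> F) = map_form id (hom Base Con (cmb \<pi> \<theta>) Bd) F"
    unfolding permute_eq form.map_comp by (auto intro!: form.map_cong0)
  then have "ncas \<Sigma> \<theta> F = map_form id (hom Base Con (cmb \<pi> \<theta>) Bd) F"
    unfolding ncas_def Let_def P_def[symmetric] \<pi>_def[symmetric] .
  moreover have "nom_perm \<pi>" "\<And>a h. a \<in> supp F \<Longrightarrow> h \<in> \<Sigma> \<Longrightarrow> \<pi> a \<notin> noms (\<theta> h)"
    using P unfolding \<pi>_def[symmetric] by (auto simp: P_def supp_permute)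
  ultimately show thesis using that by blast
qed

lemma val_ground_id: "ground ct t \<tau> \<Longrightarrow> val (cmb (\<lambda>a. a) \<theta>) e t = t"
  by (subst hom_cong_typed[of ct "mvt ct {}" "[]" t \<tau> Con Con _ Par e Bd])
    (auto dest: ground_noEig split: mvar.split)

text \<open>Under a ground substitution no eigenvariable remains, so any assignment evaluates the
  instance. The permutation chosen by \<open>ncas\<close> is itself a fresh renaming for
  \<open>F\<close>, hence the agreement with \<open>tr \<theta> F\<close>.\<close>

lemma tr_ncas:
  assumes "finite \<Sigma>" "gsubst ct \<Sigma> \<theta>" "wff \<Sigma> F"
  shows "wff {} (ncas \<Sigma> \<theta> F)" "tr \<theta>\<^sub>0 (ncas \<Sigma> \<theta> F) \<longleftrightarrow> tr \<theta> F"
    "sem ct M Par Bd (ncas \<Sigma> \<theta> F) \<longleftrightarrow> tr \<theta> F"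
proof -
  obtain \<pi> where \<pi>: "nom_perm \<pi>" "\<And>a h. a \<in> supp F \<Longrightarrow> h \<in> \<Sigma> \<Longrightarrow> \<pi> a \<notin> noms (\<theta> h)"
    and eq: "ncas \<Sigma> \<theta> F = map_form id (hom Base Con (cmb \<pi> \<theta>) Bd) F"
    using ncas_eq[OF assms] by metis
  have \<pi>': "inj \<pi>" "\<And>a. snd (\<pi> a) = snd a" using \<pi>(1) bij_is_inj unfolding nom_perm_def by blast+
  have gm: "ground_map ct \<Sigma> (cmb \<pi> \<theta>)" by (rule gsubst_ground_map[OF assms(2) \<pi>'(2)])
  show wf: "wff {} (ncas \<Sigma> \<theta> F)"
    unfolding eq by (rule wf_form_map_hom[OF assms(3) gm])
  have gr: "\<exists>\<tau>. ground ct (cmb \<pi> \<theta> v) \<tau>" if "v \<in> fpars F" for v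
    using wf_form_fpars[OF assms(3) that] gm unfolding ground_map_def by blast
  have f: "fresh_ren \<pi> \<theta> F"
    unfolding fresh_ren_def using \<pi>' \<pi>(2) wf_form_Eig[OF assms(3)] by blast
  have "fresh_ren (\<lambda>a. a) \<theta>\<^sub>0 (ncas \<Sigma> \<theta> F)"
    unfolding fresh_ren_def using wf_form_Eig[OF wf] by auto
  then have "tr \<theta>\<^sub>0 (ncas \<Sigma> \<theta> F) \<longleftrightarrow> holds (\<lambda>a. a) \<theta>\<^sub>0 Bd (ncas \<Sigma> \<theta> F)"
    by (rule tr_iff[OF wf])
  also have "\<dots> \<longleftrightarrow> holds \<pi> \<theta> Bd F"
    unfolding eq by (rule sem_map_form) (use gr val_ground_id in blast)
  also have "\<dots> \<longleftrightarrow> tr \<theta> F" using tr_iff[OF assms(3) f] by blast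
  finally show "tr \<theta>\<^sub>0 (ncas \<Sigma> \<theta> F) \<longleftrightarrow> tr \<theta> F" .
  have "sem ct M Par Bd (ncas \<Sigma> \<theta> F) \<longleftrightarrow> holds \<pi> \<theta> Bd F"
    unfolding eq by (rule sem_map_form) (use gr val_ground_id[of _ _ "\<lambda>h. Par (Eig h)"] in \<open>simp add: cmb_id\<close>, blast)
  with \<open>holds \<pi> \<theta> Bd F \<longleftrightarrow> tr \<theta> F\<close> show "sem ct M Par Bd (ncas \<Sigma> \<theta> F) \<longleftrightarrow> tr \<theta> F" by simp
qed

text \<open>The eigenvariable \<open>h\<close> raised over the support \<open>cs\<close> stands for an arbitrary closed term \<open>t\<close>, in which
  the nominal constants that \<open>cs\<close> is renamed to may occur.\<close>
lemma tr_raised: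
  assumes "finite \<Sigma>" "gsubst ct \<Sigma> \<theta>" "wf_form ct D \<Sigma> [\<tau>] B" "set cs = supp B"
    "h \<notin> \<Sigma>" "snd h = fun_ty (map snd cs) \<tau>"
    and av: "avoids \<Sigma> \<theta> \<rho>" and t: "ground ct t \<tau>"
  defines "u \<equiv> abs_noms (map \<rho> cs) t"
    and "F \<equiv> fsub (inst [apps (Par (Eig h)) (map (\<lambda>c. Par (Nom c)) cs)]) B"
  shows "wff (insert h \<Sigma>) F" "gsubst ct (insert h \<Sigma>) (\<theta>(h := u))"
    "tr (\<theta>(h := u)) F \<longleftrightarrow> holds \<rho> \<theta> (case_nat t Bd) B"
proof -
  let ?w = "apps (Par (Eig h)) (map (\<lambda>c. Par (Nom c)) cs)"
  note \<rho> = avoidsD[OF av]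
  have snds: "map snd (map \<rho> cs) = map snd cs" using \<rho>(2) by simp
  have u: "ground ct u (snd h)" 
    using abs_noms_has_type[OF t, of "map \<rho> cs"] unfolding snds u_def assms(6) .
  then show gs: "gsubst ct (insert h \<Sigma>) (\<theta>(h := u))" using assms(2) by (auto simp: gsubst_def)
  have inh: "inhabited ct (snd c)" if "c \<in> set cs" for c
  proof -
    have "Nom c \<in> fpars B" using that assms(4) supp_iff by blast
    from wf_form_fpars[OF assms(3) this] show ?thesis by (simp add: mvt_Nom split: if_splits)
  qed
  have B: "wf_form ct D (insert h \<Sigma>) [\<tau>] B" using assms(3) by (rule wf_form_mono) blast
  have "conv ct (mvt ct (insert h \<Sigma>)) [] ?w ?w \<tau>"
    by (rule conv_apps[where \<tau>s = "map snd cs"], rule conv.refl)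
      (use assms(6) inh in \<open>auto simp: has_type_Par_iff mvt_def list_all2_conv_all_nth\<close>)
  then have w: "has_type ct (mvt ct (insert h \<Sigma>)) [] ?w \<tau>" using conv_has_type by blast
  show wf: "wff (insert h \<Sigma>) F"
    unfolding F_def by (rule wf_form_inst[OF B]) (use w in simp)
  have pw: "pars ?w = insert (Eig h) (Nom ` set cs)" by (auto simp: pars_apps)
  have pF: "fpars F \<subseteq> fpars B \<union> insert (Eig h) (Nom ` set cs)"
    using fpars_fsub_inst[of "[?w]" B] by (simp add: F_def pw)
  have "fresh_ren \<rho> (\<theta>(h := u)) F"
    unfolding fresh_ren_def
  proof (intro conjI ballI allI impI)
    fix a h' assume a: "a \<in> supp F" and h': "Eig h' \<in> fpars F"
    have "a \<in> set cs" using a pF assms(4) by (auto simp: supp_iff)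
    \<comment> \<open>\<open>u\<close> abstracts over all renamed constants of the support, so none
      is left in it even if \<open>t\<close> contains them.\<close>
    then have 1: "\<rho> a \<notin> noms u" by (auto simp: u_def noms_def pars_abs_noms)
    have "h' = h \<or> h' \<in> \<Sigma>" using h' pF wf_form_Eig[OF assms(3), of h'] by blast
    with 1 show "\<rho> a \<notin> noms ((\<theta>(h := u)) h')" using \<rho>(3)[of h' a] by auto
  qed (use \<rho> in auto)
  from tr_iff[OF wf this]
  have "tr (\<theta>(h := u)) F \<longleftrightarrow> holds \<rho> (\<theta>(h := u)) (\<lambda>i. val (cmb \<rho> (\<theta>(h := u))) Bd (inst [?w] i)) B"
    by (simp add: F_def sem_fsub)
  also have "\<dots> \<longleftrightarrow> holds \<rho> (\<theta>(h := u)) (case_nat t Bd) B"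
  proof (rule sem_conv[OF fconv_refl[OF B] B M_conv_closed gsubst_ground_map[OF gs \<rho>(2)]])
    fix i assume "i < length [\<tau>]"
    then have [simp]: "i = 0" by simp
    \<comment> \<open>The raised eigenvariable evaluates to \<open>u\<close> applied to the renamed
      constants, which is only convertible to \<open>t\<close>, not equal to it.\<close>
    have "gconv ct (apps u (map (\<lambda>d. Par (Nom d)) (map \<rho> cs))) t \<tau>"
      unfolding u_def by (rule conv_apps_abs_noms[OF t]) (use inh \<rho>(2) in auto)
    then show "gconv ct (val (cmb \<rho> (\<theta>(h := u))) Bd (inst [?w] i)) (case_nat t Bd i) ([\<tau>] ! i)"
      by (simp add: inst_Cons val_apps comp_def)
  qed
  also have "\<dots> \<longleftrightarrow> holds \<rho> \<theta> (case_nat t Bd) B"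
    by (rule sem_cong[OF assms(3)]) (use wf_form_Eig[OF assms(3)] assms(5) in \<open>auto split: mvar.split\<close>)
  finally show "tr (\<theta>(h := u)) F \<longleftrightarrow> holds \<rho> \<theta> (case_nat t Bd) B" .
qed

section \<open>\<nabla> and the choice of its constant\<close>

lemma sem_fsub_inst1: "sem ct I \<theta> Bd (fsub (inst [t]) F) \<longleftrightarrow> sem ct I \<theta> (case_nat (val \<theta> Bd t) Bd) F"
proof -
  have "(\<lambda>i. val \<theta> Bd (inst [t] i)) = case_nat (val \<theta> Bd t) Bd"
    by (auto simp: inst_Cons fun_eq_iff split: nat.split)
  then show ?thesis by (simp add: sem_fsub)
qed

text \<open>The transposition of \<open>a\<close> and \<open>b\<close> leaves all relevant values
  alone and preserves truth.\<close>

lemma sem_nab_swap: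
  assumes F: "wf_form ct D \<Sigma> (\<tau> # E) F" and "snd a = snd b"
    and "\<And>v. v \<in> fpars F \<Longrightarrow> Nom a \<notin> pars (\<theta> v) \<and> Nom b \<notin> pars (\<theta> v)"
    and "\<And>i. i < length E \<Longrightarrow> Nom a \<notin> pars (e i) \<and> Nom b \<notin> pars (e i)"
  shows "sem ct M \<theta> (case_nat (Par (Nom a)) e) F \<longleftrightarrow> sem ct M \<theta> (case_nat (Par (Nom b)) e) F"
proof -
  let ?\<pi> = "\<lambda>c. if c = a then b else if c = b then a else c"
  have \<pi>: "tperm ?\<pi>" by (rule tperm_involution) (use assms(2) in auto)
  have fr: "pm ?\<pi> t = t" if "Nom a \<notin> pars t \<and> Nom b \<notin> pars t" for t
    using that by (intro pm_fresh) auto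
  have "sem ct M \<theta> (case_nat (Par (Nom a)) e) F \<longleftrightarrow>
      sem ct M (\<lambda>v. pm ?\<pi> (\<theta> v)) (\<lambda>i. pm ?\<pi> (case_nat (Par (Nom a)) e i)) F"
    by (rule sem_pm[OF M_equivariant \<pi>, symmetric])
  also have "\<dots> \<longleftrightarrow> sem ct M \<theta> (case_nat (Par (Nom b)) e) F"
    by (rule sem_cong[OF F]) (use fr[OF assms(3)] fr[OF assms(4)] in \<open>auto simp: less_Suc_eq_0_disj\<close>)
  finally show ?thesis .
qed

text \<open>Finitely many constants occur in the relevant values and all others are interchangeable,
  so one fresh constant decides for cofinitely many: the some/any property.\<close>

lemma sem_nab:
  assumes F: "wf_form ct D \<Sigma> (\<tau> # E) F" and a: "snd a = \<tau>"
    and "\<And>v. v \<in> fpars F \<Longrightarrow> Nom a \<notin> pars (\<theta> v)" and "\<And>i. i < length E \<Longrightarrow> Nom a \<notin> pars (e i)"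
  shows "sem ct M \<theta> e (FNab \<tau> F) \<longleftrightarrow> sem ct M \<theta> (case_nat (Par (Nom a)) e) F"
proof -
  let ?Y = "{b. Nom b \<in> (\<Union>v \<in> fpars F. pars (\<theta> v)) \<union> (\<Union>i \<in> {..<length E}. pars (e i))}"
  have Y: "finite ?Y" by (rule finite_Nom_vimage) simp
  have swap: "sem ct M \<theta> (case_nat (Par (Nom a)) e) F \<longleftrightarrow> sem ct M \<theta> (case_nat (Par (Nom b)) e) F"
    if "snd b = \<tau>" "b \<notin> ?Y" for b
    by (rule sem_nab_swap[OF F]) (use that assms in auto)
  show ?thesis
  proof
    assume "sem ct M \<theta> e (FNab \<tau> F)"
    then obtain X where X: "finite X"
      "\<forall>a. snd a = \<tau> \<and> a \<notin> X \<longrightarrow> sem ct M \<theta> (case_nat (Par (Nom a)) e) F" by auto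
    \<comment> \<open>A constant outside both the exceptional set of the quantifier and the
      occurring constants links the quantifier with \<open>a\<close>.\<close>
    obtain k where "\<And>a. shift k a \<notin> X \<union> ?Y"
      using exists_shift_avoiding[of "X \<union> ?Y"] X(1) Y by (metis finite_UnI)
    then have "shift k a \<notin> X" "shift k a \<notin> ?Y" "snd (shift k a) = \<tau>" using a by auto
    then show "sem ct M \<theta> (case_nat (Par (Nom a)) e) F" using swap X(2) by blast
  next
    assume "sem ct M \<theta> (case_nat (Par (Nom a)) e) F"
    then have "\<forall>b. snd b = \<tau> \<and> b \<notin> ?Y \<longrightarrow> sem ct M \<theta> (case_nat (Par (Nom b)) e) F"
      using swap by blast
    then show "sem ct M \<theta> e (FNab \<tau> F)" using Y unfolding sem.simps by blast
  qed
qed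

lemma wf_inst_Nom:
  "wff \<Sigma> (FNab \<tau> B) \<Longrightarrow> snd a = \<tau> \<Longrightarrow> wff \<Sigma> (fsub (inst [Par (Nom a)]) B)"
  by (rule wf_form_inst[of _ _ _ "[\<tau>]"]) (auto simp: has_type_Par_iff mvt_Nom)

text \<open>Serves \<open>nabL\<close> and \<open>nabR\<close>. The renamed constant is fresh:
  injectivity keeps it apart from the other constants of \<open>B\<close>, and \<open>avoids\<close>
  keeps it apart from the values of the eigenvariables.\<close>

lemma tr_nab:
  assumes "finite \<Sigma>" "wff \<Sigma> (FNab \<tau> B)" "a \<notin> supp B" "snd a = \<tau>"
  shows "tr \<theta> (FNab \<tau> B) \<longleftrightarrow> tr \<theta> (fsub (inst [Par (Nom a)]) B)"
proof -
  have B: "wf_form ct D \<Sigma> [\<tau>] B" using assms(2) by simp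
  obtain \<rho> where av: "avoids \<Sigma> \<theta> \<rho>" using exists_avoids[OF assms(1)] by blast
  note \<rho> = avoidsD[OF av] tr_avoids[OF av]
  have "tr \<theta> (fsub (inst [Par (Nom a)]) B) \<longleftrightarrow> holds \<rho> \<theta> (case_nat (Par (Nom (\<rho> a))) Bd) B"
    using \<rho>(4)[OF wf_inst_Nom[OF assms(2,4)]] by (simp add: sem_fsub_inst1)
  also have "\<dots> \<longleftrightarrow> holds \<rho> \<theta> Bd (FNab \<tau> B)"
  proof (rule sem_nab[OF B, symmetric])
    fix v assume v: "v \<in> fpars B"
    show "Nom (\<rho> a) \<notin> pars (cmb \<rho> \<theta> v)"
    proof (cases v)
      case (Nom b)
      then have "b \<noteq> a" using v assms(3) supp_iff by blast
      then show ?thesis using Nom inj_eq[OF \<rho>(1)] by auto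
    next
      case (Eig h)
      then have "h \<in> \<Sigma>" using v wf_form_Eig[OF B] by blast
      then show ?thesis using Eig \<rho>(3) by (simp add: noms_def)
    qed
  qed (use assms(4) \<rho>(2) in auto)
  also have "\<dots> \<longleftrightarrow> tr \<theta> (FNab \<tau> B)" using \<rho>(4)[OF assms(2)] by blast
  finally show "tr \<theta> (FNab \<tau> B) \<longleftrightarrow> tr \<theta> (fsub (inst [Par (Nom a)]) B)" by blast
qed

text \<open>Soundness of \<open>naR\<close>. The renaming avoids the values of all eigenvariables,
  so evaluation captures nothing and the renamed constants witness the instance.\<close>

lemma tr_na:
  assumes "finite \<Sigma>" "gsubst ct \<Sigma> \<theta>" "wff \<Sigma> N" "na_holds ct \<Sigma> N"
  shows "tr \<theta> N"
proof -
  obtain \<rho> where av: "avoids \<Sigma> \<theta> \<rho>" using exists_avoids[OF assms(1)] by blast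
  note \<rho> = avoidsD[OF av] tr_avoids[OF av]
  let ?\<theta> = "cmb \<rho> \<theta>"
  have gm: "ground_map ct \<Sigma> ?\<theta>" by (rule gsubst_ground_map[OF assms(2) \<rho>(2)])
  from assms(4) obtain n s t cs \<tau> where N: "N = FNA n s t" "length cs = n"
    "\<forall>c \<in> set cs. inhabited ct (snd c)" and c: "conv ct (mvt ct \<Sigma>) [] s (abs_noms cs t) \<tau>"
    by (auto simp: na_holds_def)
  have "val ?\<theta> Bd (abs_noms cs t) = abs_noms (map \<rho> cs) (val ?\<theta> Bd t)"
  proof (rule has_type_val_abs_noms)
    fix v assume v: "v \<in> pars t"
    then have vf: "v \<in> fpars N" using N(1) by simp
    then show "\<exists>\<tau>. ground ct (?\<theta> v) \<tau>"
      using wf_form_fpars[OF assms(3)] gm unfolding ground_map_def by blast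
    fix c assume "v \<noteq> Nom c"
    then show "Nom (\<rho> c) \<notin> pars (?\<theta> v)"
      using vf wf_form_Eig[OF assms(3)] \<rho>(3) inj_eq[OF \<rho>(1)] by (cases v) (auto simp: noms_def)
  qed (use \<rho>(2) in auto)
  then have "gconv ct (val ?\<theta> Bd s) (abs_noms (map \<rho> cs) (val ?\<theta> Bd t)) \<tau>"
    using val_conv[OF c gm, of Bd Bd] by simp
  moreover have "length (map \<rho> cs) = n" "\<forall>c \<in> set (map \<rho> cs). inhabited ct (snd c)"
    using N \<rho>(2) by auto
  ultimately have "sem ct M ?\<theta> Bd N" unfolding N(1) sem.simps na_holds_FNA by blast
  then show ?thesis using \<rho>(4)[OF assms(3)] by blast
qed

lemma wf_def_unfold: "wff \<Sigma> (FAt p ts) \<Longrightarrow> D p = (k, \<tau>s, B) \<Longrightarrow> wff \<Sigma> (fsub (inst ts) B)"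
  using wf_form_inst[OF wf_form_mono[OF body_wf[of p]], of \<Sigma> ts] by simp

text \<open>The fixed point equation of the model, for plain and inductive definitions alike and for
  both unfolding rules.\<close>

lemma tr_def_unfold:
  assumes "finite \<Sigma>" "gsubst ct \<Sigma> \<theta>" "wff \<Sigma> (FAt p ts)" "D p = (k, \<tau>s, B)"
  shows "tr \<theta> (FAt p ts) \<longleftrightarrow> tr \<theta> (fsub (inst ts) B)"
proof -
  have B: "B = snd (snd (D p))" "\<tau>s = arg_types D p" using assms(4) by auto
  have ts: "list_all2 (has_type ct (mvt ct \<Sigma>) []) ts (arg_types D p)" using assms(3) by simp
  note wf = wf_def_unfold[OF assms(3,4)]
  obtain \<rho> where av: "avoids \<Sigma> \<theta> \<rho>" using exists_avoids[OF assms(1)] by blast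
  note \<rho> = avoidsD(2)[OF av] tr_avoids[OF av]
  let ?us = "map (val (cmb \<rho> \<theta>) Bd) ts"
  have us: "list_all2 (ground ct) ?us (arg_types D p)"
    unfolding list.rel_map using ts
    by (rule list.rel_mono_strong) (use val_ground[OF _ gsubst_ground_map[OF assms(2) \<rho>(1)], of "[]"] in simp)
  have "tr \<theta> (FAt p ts) \<longleftrightarrow> M p ?us" using \<rho>(2)[OF assms(3)] by simp
  also have "\<dots> \<longleftrightarrow> step ct D M p ?us" by (rule M_iff)
  also have "\<dots> \<longleftrightarrow> sem ct M Par (inst ?us) B" using us by (simp add: step_def B)
  also have "\<dots> \<longleftrightarrow> holds \<rho> \<theta> (\<lambda>i. val (cmb \<rho> \<theta>) Bd (inst ts i)) B"
    unfolding B by (rule sem_body_cong[OF us, symmetric]) (auto simp: inst_def)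
  also have "\<dots> \<longleftrightarrow> tr \<theta> (fsub (inst ts) B)" using \<rho>(2)[OF wf] by (simp add: sem_fsub)
  finally show "tr \<theta> (FAt p ts) \<longleftrightarrow> tr \<theta> (fsub (inst ts) B)" .
qed

text \<open>Evaluates the formulas in the invariance premise of \<open>IL\<close>. They contain new
  eigenvariables but no nominal constants, so the identity is a fresh renaming.\<close>

lemma tr_inst_Eigs:
  assumes F: "wf_form ct D {} \<tau>s F" "fpars F = {}"
    and hs: "map snd hs = \<tau>s" "xs = map (\<lambda>h. Par (Eig h)) hs"
    and us: "us = map \<theta> hs"
  shows "wff (set hs) (fsub (inst xs) F)"
    "tr \<theta> (fsub (inst xs) F) \<longleftrightarrow> sem ct M Par (inst us) F"
proof -
  show wf: "wff (set hs) (fsub (inst xs) F)"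
    by (rule wf_form_inst[OF wf_form_mono[OF F(1)]])
      (use hs in \<open>auto simp: list_all2_conv_all_nth has_type_Par_iff mvt_Eig\<close>)
  have "fpars (fsub (inst xs) F) \<subseteq> Eig ` set hs"
    using fpars_fsub_inst[of xs F] F(2) hs(2) by auto
  then have "fresh_ren (\<lambda>a. a) \<theta> (fsub (inst xs) F)" by (auto simp: fresh_ren_def supp_iff)
  from tr_iff[OF wf this]
  have "tr \<theta> (fsub (inst xs) F) \<longleftrightarrow>
      holds (\<lambda>a. a) \<theta> (\<lambda>i. val (cmb (\<lambda>a. a) \<theta>) Bd (inst xs i)) F"
    by (simp add: sem_fsub)
  also have "\<dots> \<longleftrightarrow> sem ct M Par (inst us) F"
    by (rule sem_cong[OF F(1)]) (use F(2) hs us in \<open>auto simp: inst_def\<close>)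
  finally show "tr \<theta> (fsub (inst xs) F) \<longleftrightarrow> sem ct M Par (inst us) F" .
qed

lemma tr_connectives:
  assumes "finite \<Sigma>" "wff \<Sigma> A" "wff \<Sigma> B"
  shows "tr \<theta> (FAnd A B) \<longleftrightarrow> tr \<theta> A \<and> tr \<theta> B" "tr \<theta> (FOr A B) \<longleftrightarrow> tr \<theta> A \<or> tr \<theta> B"
    "tr \<theta> (FImp A B) \<longleftrightarrow> (tr \<theta> A \<longrightarrow> tr \<theta> B)" "tr \<theta> FTop"
proof -
  obtain \<rho> where "avoids \<Sigma> \<theta> \<rho>" using exists_avoids[OF assms(1)] by blast
  note tr = tr_avoids[OF this]
  show "tr \<theta> (FAnd A B) \<longleftrightarrow> tr \<theta> A \<and> tr \<theta> B" "tr \<theta> (FOr A B) \<longleftrightarrow> tr \<theta> A \<or> tr \<theta> B"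
    "tr \<theta> (FImp A B) \<longleftrightarrow> (tr \<theta> A \<longrightarrow> tr \<theta> B)" "tr \<theta> FTop"
    using assms(2,3) by (simp_all add: tr)
qed

lemma tr_inst_term:
  assumes "finite \<Sigma>" "gsubst ct \<Sigma> \<theta>" "wf_form ct D \<Sigma> [\<tau>] B" "has_type ct (mvt ct \<Sigma>) [] t \<tau>"
  shows "tr \<theta> (FAll \<tau> B) \<Longrightarrow> tr \<theta> (fsub (inst [t]) B)" "tr \<theta> (fsub (inst [t]) B) \<Longrightarrow> tr \<theta> (FEx \<tau> B)"
proof -
  obtain \<rho> where av: "avoids \<Sigma> \<theta> \<rho>" using exists_avoids[OF assms(1)] by blast
  note \<rho> = avoidsD(2)[OF av] tr_avoids[OF av]
  have wf: "wff \<Sigma> (fsub (inst [t]) B)"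
    by (rule wf_form_inst[OF assms(3)]) (use assms(4) in simp)
  have g: "ground ct (val (cmb \<rho> \<theta>) Bd t) \<tau>"
    by (rule val_ground[OF assms(4) gsubst_ground_map[OF assms(2) \<rho>(1)]]) simp
  show "tr \<theta> (FAll \<tau> B) \<Longrightarrow> tr \<theta> (fsub (inst [t]) B)"
    using \<rho>(2)[OF wf] \<rho>(2)[of "FAll \<tau> B"] assms(3) g by (simp add: sem_fsub_inst1)
  show "tr \<theta> (fsub (inst [t]) B) \<Longrightarrow> tr \<theta> (FEx \<tau> B)"
    using \<rho>(2)[OF wf] \<rho>(2)[of "FEx \<tau> B"] assms(3) g by (auto simp: sem_fsub_inst1)
qed

section \<open>Validity of sequents and soundness of the rules\<close>

definition valid :: "'b tvar set \<Rightarrow> ('p, 'k, 'b) mform multiset \<Rightarrow> ('p, 'k, 'b) mform \<Rightarrow> bool" where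
  "valid \<Sigma> \<Gamma> C \<longleftrightarrow> (\<forall>\<theta>. gsubst ct \<Sigma> \<theta> \<longrightarrow> (\<forall>B \<in># \<Gamma>. tr \<theta> B) \<longrightarrow> tr \<theta> C)"

lemma valid_left:
  "valid \<Sigma> (add_mset B \<Gamma>) C \<Longrightarrow> (\<And>\<theta>. gsubst ct \<Sigma> \<theta> \<Longrightarrow> tr \<theta> A \<Longrightarrow> tr \<theta> B) \<Longrightarrow> valid \<Sigma> (add_mset A \<Gamma>) C"
  by (auto simp: valid_def)

lemma valid_right:
  "valid \<Sigma> \<Gamma> B \<Longrightarrow> (\<And>\<theta>. gsubst ct \<Sigma> \<theta> \<Longrightarrow> tr \<theta> B \<Longrightarrow> tr \<theta> A) \<Longrightarrow> valid \<Sigma> \<Gamma> A"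
  by (auto simp: valid_def)

text \<open>Well-formedness is assumed of the conclusion and handed on to the premises, as the side
  conditions of the rules permit. The signature is finite so that an avoiding renaming
  exists.\<close>

theorem gder_sound:
  "gder ct D \<Sigma> \<Gamma> C \<Longrightarrow> finite \<Sigma> \<Longrightarrow> \<forall>B \<in># \<Gamma>. wff \<Sigma> B \<Longrightarrow> wff \<Sigma> C \<Longrightarrow> valid \<Sigma> \<Gamma> C"
proof (induction rule: gder.induct)
  case (convL \<Sigma> B B' \<Gamma> C)
  then show ?case using tr_fconv fconv_wf_form[OF convL(1), of D] by (fastforce simp: valid_def)
next
  case (convR \<Sigma> B B' \<Gamma>)
  then show ?case using tr_fconv fconv_wf_form[OF convR(1), of D] by (fastforce simp: valid_def)
next
  case (ident \<pi> \<Sigma> B \<Gamma>)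
  then show ?case using tr_permute by (auto simp: valid_def)
next
  case (cut \<Sigma> B \<Gamma> \<Gamma>' C)
  then show ?case by (auto simp: valid_def)
next
  case (contrL \<Sigma> B \<Gamma> C)
  then show ?case by (auto simp: valid_def)
next
  case (topR \<Sigma> \<Gamma>)
  then show ?case using tr_connectives(4)[of \<Sigma> FTop FTop] by (simp add: valid_def)
next
  case (botL \<Sigma> \<Gamma> C)
  then show ?case by (auto simp: valid_def tr_def)
next
  case (andL1 \<Sigma> A \<Gamma> C B)
  then show ?case using tr_connectives(1) by (auto simp: valid_def)
next
  case (andL2 \<Sigma> B \<Gamma> C A)
  then show ?case using tr_connectives(1) by (auto simp: valid_def)
next
  case (andR \<Sigma> \<Gamma> A B)
  then show ?case using tr_connectives(1) by (auto simp: valid_def)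
next
  case (orL \<Sigma> A \<Gamma> C B)
  then show ?case using tr_connectives(2) by (auto simp: valid_def)
next
  case (orR1 \<Sigma> \<Gamma> A B)
  then show ?case using tr_connectives(2) by (auto simp: valid_def)
next
  case (orR2 \<Sigma> \<Gamma> B A)
  then show ?case using tr_connectives(2) by (auto simp: valid_def)
next
  case (impL \<Sigma> \<Gamma> A B C)
  then show ?case using tr_connectives(3) by (auto simp: valid_def)
next
  case (impR \<Sigma> A \<Gamma> B)
  then show ?case using tr_connectives(3) by (auto simp: valid_def)
next
  case (allL \<Sigma> t \<tau> B \<Gamma> C)
  then have B: "wf_form ct D \<Sigma> [\<tau>] B" by simp
  show ?case
    by (rule valid_left[OF allL.IH])
      (use allL.prems wf_form_inst[OF B, of "[t]"] tr_inst_term(1)[OF _ _ B] allL(1) in auto)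
next
  case (allR cs B h \<Sigma> \<tau> \<Gamma>)
  then have B: "wf_form ct D \<Sigma> [\<tau>] B" by simp
  let ?F = "fsub (inst [apps (Par (Eig h)) (map (\<lambda>c. Par (Nom c)) cs)]) B"
  show ?case
    unfolding valid_def
  proof (intro allI impI)
    fix \<theta> assume \<theta>: "gsubst ct \<Sigma> \<theta>" and \<Gamma>: "\<forall>B \<in># \<Gamma>. tr \<theta> B"
    obtain \<rho> where av: "avoids \<Sigma> \<theta> \<rho>" using exists_avoids[OF allR.prems(1)] by blast
    \<comment> \<open>An arbitrary closed \<open>t\<close> may mention the renamed constants of the
      support. This is where the raised type of \<open>h\<close> is needed.\<close>
    have "holds \<rho> \<theta> (case_nat t Bd) B" if t: "ground ct t \<tau>" for t
    proof -
      note r = tr_raised[OF allR.prems(1) \<theta> B allR(2,3,4) av t]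
      have "valid (insert h \<Sigma>) \<Gamma> ?F"
        by (rule allR.IH) (use r(1) allR.prems wf_form_mono[OF _ subset_insertI] in \<open>simp, blast, simp\<close>)
      moreover have "\<forall>B \<in># \<Gamma>. tr (\<theta>(h := u)) B" for u
        using \<Gamma> tr_upd[OF _ allR(3)] allR.prems(2) by blast
      ultimately show ?thesis using r(2,3) unfolding valid_def by blast
    qed
    then show "tr \<theta> (FAll \<tau> B)" using tr_avoids[OF av allR.prems(3)] by simp
  qed
next
  case (exL cs B h \<Sigma> \<tau> \<Gamma> C)
  then have B: "wf_form ct D \<Sigma> [\<tau>] B" by simp
  let ?F = "fsub (inst [apps (Par (Eig h)) (map (\<lambda>c. Par (Nom c)) cs)]) B"
  show ?case
    unfolding valid_def
  proof (intro allI impI)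
    fix \<theta> assume \<theta>: "gsubst ct \<Sigma> \<theta>" and \<Gamma>: "\<forall>B \<in># add_mset (FEx \<tau> B) \<Gamma>. tr \<theta> B"
    obtain \<rho> where av: "avoids \<Sigma> \<theta> \<rho>" using exists_avoids[OF exL.prems(1)] by blast
    have "holds \<rho> \<theta> Bd (FEx \<tau> B)" using \<Gamma> tr_avoids[OF av, of "FEx \<tau> B"] B by simp
    then obtain t where t: "ground ct t \<tau>" and s: "holds \<rho> \<theta> (case_nat t Bd) B" by auto
    note r = tr_raised[OF exL.prems(1) \<theta> B exL(2,3,4) av t]
    let ?\<theta> = "\<theta>(h := abs_noms (map \<rho> cs) t)"
    have C: "wff (insert h \<Sigma>) C" using exL.prems(3) by (rule wf_form_mono[OF _ subset_insertI])
    have "valid (insert h \<Sigma>) (add_mset ?F \<Gamma>) C"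
      by (rule exL.IH) (use exL.prems(1,2) r(1) C in \<open>auto intro: wf_form_mono[OF _ subset_insertI]\<close>)
    moreover have "\<forall>B \<in># \<Gamma>. tr ?\<theta> B" using \<Gamma> tr_upd[OF _ exL(3)] exL.prems(2) by simp
    ultimately have "tr ?\<theta> C" using r(2,3) s unfolding valid_def by simp
    then show "tr \<theta> C" using tr_upd[OF exL.prems(3) exL(3)] by blast
  qed
next
  case (exR \<Sigma> t \<tau> \<Gamma> B)
  then have B: "wf_form ct D \<Sigma> [\<tau>] B" by simp
  show ?case
    by (rule valid_right[OF exR.IH])
      (use exR.prems wf_form_inst[OF B, of "[t]"] tr_inst_term(2)[OF _ _ B] exR(1) in auto)
next
  case (nabL a B \<tau> \<Sigma> \<Gamma> C)
  then have F: "wff \<Sigma> (FNab \<tau> B)" by simp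
  show ?case
    by (rule valid_left[OF nabL.IH])
      (use nabL.prems wf_inst_Nom[OF F nabL(2)] tr_nab[OF _ F nabL(1,2)] in auto)
next
  case (nabR a B \<tau> \<Sigma> \<Gamma>)
  note F = nabR.prems(3)
  show ?case
    by (rule valid_right[OF nabR.IH])
      (use nabR.prems wf_inst_Nom[OF F nabR(2)] tr_nab[OF _ F nabR(1,2)] in auto)
next
  case (naL N n s t \<Sigma> \<Gamma> C)
  have N: "wff \<Sigma> N" using naL.prems(2) by simp
  show ?case
    unfolding valid_def
  proof (intro allI impI)
    fix \<theta> assume \<theta>: "gsubst ct \<Sigma> \<theta>" and \<Gamma>: "\<forall>B \<in># add_mset N \<Gamma>. tr \<theta> B"
    \<comment> \<open>The premise is taken at \<open>\<theta>\<close> itself, which is ground and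
      therefore leaves an empty signature.\<close>
    have "eigs (\<theta> h) = {}" if "h \<in> \<Sigma>" for h
      using \<theta> that ground_noEig unfolding gsubst_def eigs_def by blast
    then have sig: "sig_subst \<Sigma> \<theta> = {}" by (simp add: sig_subst_def)
    then have wf: "wf_subst ct \<Sigma> \<theta>" using \<theta> by (simp add: wf_subst_def gsubst_def)
    have "sem ct M Par Bd (ncas \<Sigma> \<theta> N)" using tr_ncas(3)[OF naL.prems(1) \<theta> N] \<Gamma> by simp
    moreover have "\<exists>s' t'. ncas \<Sigma> \<theta> N = FNA n s' t'"
      by (simp add: ncas_def Let_def permute_def naL(1))
    ultimately have "na_holds ct {} (ncas \<Sigma> \<theta> N)" by auto
    then have "valid {} (image_mset (ncas \<Sigma> \<theta>) \<Gamma>) (ncas \<Sigma> \<theta> C)"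
      using naL.IH[OF wf] naL.prems tr_ncas(1)[OF naL.prems(1) \<theta>] by (simp add: sig)
    moreover have "gsubst ct {} \<theta>" by (simp add: gsubst_def)
    moreover have "\<forall>B \<in># image_mset (ncas \<Sigma> \<theta>) \<Gamma>. tr \<theta> B"
      using \<Gamma> naL.prems(2) tr_ncas(2)[OF naL.prems(1) \<theta>] by simp
    ultimately show "tr \<theta> C"
      using tr_ncas(2)[OF naL.prems(1) \<theta> naL.prems(3)] unfolding valid_def by blast
  qed
next
  case (naR \<Sigma> N \<Gamma>)
  then show ?case using tr_na by (auto simp: valid_def)
next
  case (defL p k \<tau>s B \<Sigma> ts \<Gamma> C)
  then have F: "wff \<Sigma> (FAt p ts)" by (meson union_single_eq_member)
  show ?case
    by (rule valid_left[OF defL.IH])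
      (use defL.prems wf_def_unfold[OF F defL(1)] tr_def_unfold[OF _ _ F defL(1)] in auto)
next
  case (defR p k \<tau>s B \<Sigma> \<Gamma> ts)
  note F = defR.prems(3)
  show ?case
    by (rule valid_right[OF defR.IH])
      (use defR.prems wf_def_unfold[OF F defR(1)] tr_def_unfold[OF _ _ F defR(1)] in auto)
next
  case (IL p \<tau>s B S hs xs \<Sigma> ts \<Gamma> C)
  have B: "B = snd (snd (D p))" "\<tau>s = arg_types D p" using IL(1) by auto
  have F: "wff \<Sigma> (FAt p ts)" using IL.prems(2) by simp
  have S: "fpars S = {}"
  proof -
    have "v \<notin> fpars S" for v
      using IL(3) wf_form_Eig[OF IL(2)] by (cases v) (auto simp: supp_iff[symmetric])
    then show ?thesis by blast
  qed
  have pB: "wf_form ct D {} \<tau>s (pred_subst p S B)" "fpars (pred_subst p S B) = {}"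
    using wf_form_pred_subst[OF body_wf[of p], of p S] IL(2) fpars_pred_subst[of p S B] S body_fpars[of p]
    by (auto simp: B)
  let ?S = "\<lambda>us. sem ct M Par (inst us) S"
  have inv: "?S us" if "list_all2 (ground ct) us (arg_types D p)"
    "sem ct (M(p := ?S)) Par (inst us) (snd (snd (D p)))" for us
  proof -
    have len: "length us = length hs" 
      using list_all2_lengthD[OF that(1)] arg_cong[OF IL(5), of length] B(2) by simp
    \<comment> \<open>The eigenvariables of the premise are distinct, so any closed tuple arises
      from an assignment to them.\<close>
    define \<theta> where "\<theta> h = the (map_of (zip hs us) h)" for h
    have us: "us = map \<theta> hs"
      using len IL(4) by (auto simp: \<theta>_def list_eq_iff_nth_eq map_of_zip_nth)
    have gs: "gsubst ct (set hs) \<theta>"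
    proof -
      have "list_all2 (ground ct) (map \<theta> hs) (map snd hs)" using that(1) us B(2) IL(5) by simp
      then show ?thesis by (simp add: gsubst_def list_all2_map1 list_all2_map2 list_all2_same)
    qed
    note t1 = tr_inst_Eigs[OF pB IL(5,6) us] and t2 = tr_inst_Eigs[OF IL(2) S IL(5,6) us]
    have "valid (set hs) {#fsub (inst xs) (pred_subst p S B)#} (fsub (inst xs) S)"
      using IL.IH(1) t1(1) t2(1) by simp
    moreover have "sem ct M Par (inst us) (pred_subst p S B)"
      using that(2) sem_pred_subst[OF IL(2)[unfolded B(2)] S body_wf[of p]] by (simp add: B(1))
    ultimately show ?thesis using gs t1(2) t2(2) by (auto simp: valid_def)
  qed
  have wfS: "wff \<Sigma> (fsub (inst ts) S)"
    using F B(2) by (intro wf_form_inst[OF wf_form_mono[OF IL(2)]]) auto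
  then have "valid \<Sigma> (add_mset (fsub (inst ts) S) \<Gamma>) C" using IL.IH(2) IL.prems by simp
  then show ?case
  proof (rule valid_left)
    fix \<theta> assume \<theta>: "gsubst ct \<Sigma> \<theta>" and p: "tr \<theta> (FAt p ts)"
    obtain \<rho> where "avoids \<Sigma> \<theta> \<rho>" using exists_avoids[OF IL.prems(1)] by blast
    note \<rho> = tr_avoids[OF this]
    let ?us = "map (val (cmb \<rho> \<theta>) Bd) ts"
    have "M p ?us" using \<rho>[OF F] p by simp
    then have "?S ?us" by (rule M_induct[rotated]) (rule inv)
    also have "?S ?us \<longleftrightarrow> holds \<rho> \<theta> (\<lambda>i. val (cmb \<rho> \<theta>) Bd (inst ts i)) S"
      by (rule sem_cong[OF IL(2), symmetric])
        (use S F B(2) in \<open>auto simp: inst_def dest!: list_all2_lengthD\<close>)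
    finally show "tr \<theta> (fsub (inst ts) S)" using \<rho>[OF wfS] by (simp add: sem_fsub)
  qed
next
  case (CIR p \<tau>s B S hs xs \<Sigma> \<Gamma> ts)
  then show ?case using not_Nu[of p] by simp
qed

end

section \<open>Pattern clauses\<close>

text \<open>The environment below the quantifiers of a clause: its own variables come first and the
  arguments of the predicate after them, as the indices \<open>Bd (length \<tau>s + j)\<close> in
  \<open>clause_body\<close> expect.\<close>

definition ext :: "('k, 'v, 'b) tm list \<Rightarrow> (nat \<Rightarrow> ('k, 'v, 'b) tm) \<Rightarrow> nat \<Rightarrow> ('k, 'v, 'b) tm" where
  "ext vs e i = (if i < length vs then vs ! i else e (i - length vs))"

lemma ext_Nil [simp]: "ext [] e = e"
  and ext_Cons: "ext (v # vs) e = case_nat v (ext vs e)"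
  by (auto simp: ext_def fun_eq_iff split: nat.split)

lemma fsub_Bd [simp]: "fsub Bd F = F"
proof (induction F)
  case (FAt p ts)
  show ?case by (simp add: map_idI)
qed simp_all

lemma wf_form_append: "wf_form ct D \<Sigma> E F \<Longrightarrow> wf_form ct D \<Sigma> (E @ E') F"
  using wf_form_fsub[of ct D \<Sigma> E F "E @ E'" Bd] by (simp add: has_type_Bd_iff nth_append)

lemma wf_form_fold_FEx: "wf_form ct D \<Sigma> E (fold FEx \<tau>s F) \<longleftrightarrow> wf_form ct D \<Sigma> (\<tau>s @ E) F"
  by (induction \<tau>s arbitrary: F) auto

lemma wf_form_foldr_FAnd: "wf_form ct D \<Sigma> E (foldr FAnd Fs FTop) \<longleftrightarrow> (\<forall>F \<in> set Fs. wf_form ct D \<Sigma> E F)"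
  by (induction Fs) auto

lemma wf_form_clause_body:
  assumes "list_all2 (has_type ct (mvt ct \<Sigma>) \<tau>s) ts \<sigma>s" "wf_form ct D \<Sigma> \<tau>s B"
  shows "wf_form ct D \<Sigma> \<sigma>s (clause_body (\<tau>s, ts, B))"
proof -
  have "wf_form ct D \<Sigma> (\<tau>s @ \<sigma>s) (FNA 0 (ts ! j) (Bd (length \<tau>s + j)))" if "j < length ts" for j
  proof -
    have "has_type ct (mvt ct \<Sigma>) (\<tau>s @ \<sigma>s) (ts ! j) (\<sigma>s ! j)"
      using assms(1) that by (auto simp: list_all2_conv_all_nth intro: has_type_append)
    moreover have "has_type ct (mvt ct \<Sigma>) (\<tau>s @ \<sigma>s) (Bd (length \<tau>s + j)) (\<sigma>s ! j)"
      using assms(1) that by (auto simp: has_type_Bd_iff list_all2_conv_all_nth)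
    ultimately show ?thesis by auto
  qed
  then show ?thesis
    using wf_form_append[OF assms(2)]
    by (auto simp: clause_body_def wf_form_fold_FEx wf_form_foldr_FAnd)
qed

lemma wf_form_clauses_body:
  "wf_form ct D \<Sigma> \<sigma>s (clauses_body cls) \<longleftrightarrow> (\<forall>cl \<in> set cls. wf_form ct D \<Sigma> \<sigma>s (clause_body cl))"
  by (induction cls) (auto simp: clauses_body_def)

lemma positive_fold_FEx: "positive (fold FEx \<tau>s F) \<longleftrightarrow> positive F"
  by (induction \<tau>s arbitrary: F) auto

lemma positive_foldr_FAnd: "positive (foldr FAnd Fs FTop) \<longleftrightarrow> (\<forall>F \<in> set Fs. positive F)"
  by (induction Fs) auto

lemma positive_clauses_body:
  "positive (clauses_body cls) \<longleftrightarrow> (\<forall>(\<tau>s, ts, B) \<in> set cls. positive B)"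
  by (induction cls)
    (auto simp: clauses_body_def clause_body_def positive_fold_FEx positive_foldr_FAnd)

lemma fpars_fold_FEx: "fpars (fold FEx \<tau>s F) = fpars F"
  by (induction \<tau>s arbitrary: F) auto

lemma fpars_foldr_FAnd: "fpars (foldr FAnd Fs FTop) = (\<Union>F \<in> set Fs. fpars F)"
  by (induction Fs) auto

lemma supp_clauses_body:
  assumes "\<forall>(\<tau>s, ts, B) \<in> set cls. (\<forall>t \<in> set ts. noms t = {}) \<and> supp B = {}"
  shows "supp (clauses_body cls) = {}"
proof -
  have "supp (clause_body cl) = {}" if "cl \<in> set cls" for cl
  proof -
    obtain \<tau>s ts B where cl: "cl = (\<tau>s, ts, B)" by (cases cl)
    have "\<forall>t \<in> set ts. noms t = {}" "supp B = {}" using assms that cl by auto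
    then have "Nom a \<notin> fpars B" "j < length ts \<Longrightarrow> Nom a \<notin> pars (ts ! j)" for a j
      using nth_mem[of j ts] unfolding supp_iff[symmetric] noms_def by blast+
    then have "Nom a \<notin> fpars (clause_body cl)" for a
      by (auto simp: cl clause_body_def fpars_fold_FEx fpars_foldr_FAnd)
    then show ?thesis by (auto simp: supp_iff)
  qed
  then have "\<forall>cl \<in> set cls. Nom a \<notin> fpars (clause_body cl)" for a by (auto simp: supp_iff[symmetric])
  moreover have "fpars (clauses_body cls) = (\<Union>cl \<in> set cls. fpars (clause_body cl))"
    by (induction cls) (auto simp: clauses_body_def)
  ultimately have "Nom a \<notin> fpars (clauses_body cls)" for a by simp
  then show ?thesis by (auto simp: supp_iff)
qed

text \<open>\<open>fold\<close> makes the first type the innermost quantifier, so the witnesses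
  match the indices in list order.\<close>

lemma sem_fold_FEx:
  "sem ct I \<theta> e (fold FEx \<tau>s F) \<longleftrightarrow> (\<exists>vs. list_all2 (ground ct) vs \<tau>s \<and> sem ct I \<theta> (ext vs e) F)"
proof (induction \<tau>s arbitrary: F)
  case (Cons \<tau> \<tau>s)
  show ?case
    by (auto simp: Cons list_all2_Cons2 ext_Cons) (metis ext_Cons)+
qed simp

lemma sem_foldr_FAnd: "sem ct I \<theta> e (foldr FAnd Fs FTop) \<longleftrightarrow> (\<forall>F \<in> set Fs. sem ct I \<theta> e F)"
  by (induction Fs) auto

lemma na_holds_0: "na_holds ct \<Sigma> (FNA 0 s t) \<longleftrightarrow> (\<exists>\<tau>. conv ct (mvt ct \<Sigma>) [] s t \<tau>)"
  by (auto simp: na_holds_FNA)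

text \<open>Undoes the translation of pattern clauses. Nominal abstraction of degree 0 is
  conversion, so patterns are matched modulo conversion only.\<close>

lemma step_clausesE:
  assumes "step ct D I p args" "D p = (k, \<sigma>s, clauses_body cls)"
    and len_ts: "\<forall>(\<tau>s, ts, B) \<in> set cls. length ts = length \<sigma>s"
  obtains \<tau>s ts B vs where "(\<tau>s, ts, B) \<in> set cls" "list_all2 (ground ct) vs \<tau>s"
    "\<And>j. j < length ts \<Longrightarrow> \<exists>\<tau>. gconv ct (sub (ext vs (inst args)) (ts ! j)) (args ! j) \<tau>"
    "sem ct I Par (ext vs (inst args)) B"
proof -
  have len: "length args = length \<sigma>s"
    using assms(1,2) by (auto simp: step_def dest: list_all2_lengthD)
  have "sem ct I Par (inst args) (clauses_body cls)" using assms(1,2) by (simp add: step_def)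
  then have "\<exists>cl \<in> set cls. sem ct I Par (inst args) (clause_body cl)"
    by (induction cls) (auto simp: clauses_body_def)
  then obtain \<tau>s ts B vs where *: "(\<tau>s, ts, B) \<in> set cls" "list_all2 (ground ct) vs \<tau>s"
    and "\<forall>j < length ts. sem ct I Par (ext vs (inst args)) (FNA 0 (ts ! j) (Bd (length \<tau>s + j)))"
    "sem ct I Par (ext vs (inst args)) B"
    by (auto simp: clause_body_def sem_fold_FEx sem_foldr_FAnd)
  moreover have "ext vs (inst args) (length \<tau>s + j) = args ! j" if "j < length ts" for j
    using that bspec[OF len_ts *(1)] len list_all2_lengthD[OF *(2)] by (simp add: ext_def inst_def)
  ultimately show thesis using that[OF *] by (simp add: na_holds_0 sub_eq_hom)
qed

lemma sub_up_up: "(\<lambda>i. sub (up \<tau>) (up \<sigma> i)) = up (\<lambda>i. sub \<tau> (\<sigma> i))"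
  by (auto simp: up_def fun_eq_iff sub_ren ren_sub split: nat.split)

lemma fsub_fsub: "fsub \<tau> (fsub \<sigma> F) = fsub (\<lambda>i. sub \<tau> (\<sigma> i)) F"
  by (induction F arbitrary: \<sigma> \<tau>) (simp_all add: sub_sub sub_up_up)

lemma fsub_inst_up: "fsub (inst [u]) (fsub (up \<sigma>) F) = fsub (case_nat u \<sigma>) F"
proof -
  have "(\<lambda>i. sub (inst [u]) (up \<sigma> i)) = case_nat u \<sigma>"
    by (auto simp: fun_eq_iff inst_Cons up_def sub_ren split: nat.split)
  then show ?thesis by (simp add: fsub_fsub)
qed

lemma gder_fold_FEx:
  "list_all2 (has_type ct (mvt ct \<Sigma>) []) vs \<tau>s \<Longrightarrow> gder ct D \<Sigma> \<Gamma> (fsub (ext vs \<sigma>) F) \<Longrightarrow>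
    gder ct D \<Sigma> \<Gamma> (fsub \<sigma> (fold FEx \<tau>s F))"
proof (induction \<tau>s arbitrary: vs F)
  case (Cons \<tau> \<tau>s)
  then obtain v ws where vs: "vs = v # ws" "has_type ct (mvt ct \<Sigma>) [] v \<tau>"
    "list_all2 (has_type ct (mvt ct \<Sigma>) []) ws \<tau>s" by (auto simp: list_all2_Cons2)
  have "gder ct D \<Sigma> \<Gamma> (fsub (inst [v]) (fsub (up (ext ws \<sigma>)) F))"
    using Cons.prems(2) by (simp add: vs(1) ext_Cons fsub_inst_up)
  then have "gder ct D \<Sigma> \<Gamma> (fsub (ext ws \<sigma>) (FEx \<tau> F))" using vs(2) by (auto intro: gder.exR)
  then show ?case using Cons.IH[OF vs(3)] by simp
qed simp

text \<open>The syntactic counterpart of \<open>step_clausesE\<close>: unfold, choose the disjunct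
  of the clause, supply the witnesses \<open>vs\<close> and close each matching condition by
  \<open>naR\<close>.\<close>

lemma gder_clause:
  assumes "D p = (k, \<sigma>s, clauses_body cls)" "(\<tau>s, ts, B) \<in> set cls"
    and vs: "list_all2 (has_type ct (mvt ct \<Sigma>) []) vs \<tau>s" and "length ts = length args"
    and c: "\<And>j. j < length ts \<Longrightarrow> \<exists>\<tau>. conv ct (mvt ct \<Sigma>) [] (sub (ext vs (inst args)) (ts ! j)) (args ! j) \<tau>"
    and B: "gder ct D \<Sigma> \<Gamma> (fsub (ext vs (inst args)) B)"
  shows "gder ct D \<Sigma> \<Gamma> (FAt p args)"
proof (rule gder.defR[of D p, OF assms(1)])
  let ?\<sigma> = "ext vs (inst args)"
  have bd: "?\<sigma> (length \<tau>s + j) = args ! j" if "j < length ts" for j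
    using that assms(4) list_all2_lengthD[OF vs] by (simp add: ext_def inst_def)
  have conj: "gder ct D \<Sigma> \<Gamma> (fsub ?\<sigma> (foldr FAnd Fs FTop))"
    if "\<forall>F \<in> set Fs. gder ct D \<Sigma> \<Gamma> (fsub ?\<sigma> F)" for Fs
    using that by (induction Fs) (auto intro: gder.topR gder.andR)
  have "gder ct D \<Sigma> \<Gamma> (fsub ?\<sigma> (foldr FAnd
      (map (\<lambda>j. FNA 0 (ts ! j) (Bd (length \<tau>s + j))) [0..<length ts]) FTop))"
    using c by (intro conj) (auto intro!: gder.naR simp: na_holds_0 bd)
  then have "gder ct D \<Sigma> \<Gamma> (fsub (inst args) (clause_body (\<tau>s, ts, B)))"
    unfolding clause_body_def prod.case using B by (intro gder_fold_FEx[OF vs]) (auto intro: gder.andR)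
  then show "gder ct D \<Sigma> \<Gamma> (fsub (inst args) (clauses_body cls))"
    using assms(2) unfolding clauses_body_def
    by (induction cls) (auto intro: gder.orR1 gder.orR2)
qed

section \<open>The specification logic\<close>

lemma svt_mono: "svt \<Sigma> h = Some \<tau> \<Longrightarrow> \<Sigma> \<subseteq> \<Sigma>' \<Longrightarrow> svt \<Sigma>' h = Some \<tau>"
  by (auto simp: svt_def split: if_splits)

lemma wf_goal_gsub:
  "wf_goal sg us es \<Sigma> E G \<Longrightarrow> (\<And>i. i < length E \<Longrightarrow> has_type sg (svt \<Sigma>) E' (\<sigma> i) (E ! i)) \<Longrightarrow>
    wf_goal sg us es \<Sigma> E' (gsub \<sigma> G)"
proof (induction G arbitrary: E E' \<sigma>)
  case (GAll \<tau> G)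
  show ?case
    using GAll.prems
    by (auto intro!: GAll.IH[of "\<tau> # E"] has_type_ren_Suc simp: less_Suc_eq_0_disj has_type_Bd_iff)
next
  case (GEx \<tau> G)
  show ?case
    using GEx.prems
    by (auto intro!: GEx.IH[of "\<tau> # E"] has_type_ren_Suc simp: less_Suc_eq_0_disj has_type_Bd_iff)
next
  case (GAnd G H)
  show ?case using GAnd.IH(1)[of E E' \<sigma>] GAnd.IH(2)[of E E' \<sigma>] GAnd.prems by simp
next
  case (GOr G H)
  show ?case using GOr.IH(1)[of E E' \<sigma>] GOr.IH(2)[of E E' \<sigma>] GOr.prems by simp
next
  case (GImp A G)
  show ?case using GImp.IH[of E E' \<sigma>] GImp.prems by (auto intro: has_type_sub)
qed (auto intro: has_type_sub)

lemma wf_goal_mono: "wf_goal sg us es \<Sigma> E G \<Longrightarrow> \<Sigma> \<subseteq> \<Sigma>' \<Longrightarrow> wf_goal sg us es \<Sigma>' E G"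
  by (induction G arbitrary: E) (auto intro: has_type_mono svt_mono)

lemma gsub_cong:
  "wf_goal sg us es \<Sigma> E G \<Longrightarrow> (\<And>i. i < length E \<Longrightarrow> \<sigma> i = \<sigma>' i) \<Longrightarrow> gsub \<sigma> G = gsub \<sigma>' G"
proof (induction G arbitrary: E \<sigma> \<sigma>')
  case (GAll \<tau> G)
  show ?case
    using GAll.prems by (auto intro!: GAll.IH[of "\<tau> # E"] simp: less_Suc_eq_0_disj)
next
  case (GEx \<tau> G)
  show ?case
    using GEx.prems by (auto intro!: GEx.IH[of "\<tau> # E"] simp: less_Suc_eq_0_disj)
next
  case (GAnd G H)
  show ?case using GAnd.IH(1)[of E \<sigma> \<sigma>'] GAnd.IH(2)[of E \<sigma> \<sigma>'] GAnd.prems by simp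
next
  case (GOr G H)
  show ?case using GOr.IH(1)[of E \<sigma> \<sigma>'] GOr.IH(2)[of E \<sigma> \<sigma>'] GOr.prems by simp
next
  case (GImp A G)
  show ?case using GImp.IH[of E \<sigma> \<sigma>'] GImp.prems by (auto intro: sub_cong_typed)
qed (auto intro: sub_cong_typed)

lemma gsub_Bd [simp]: "gsub Bd G = G"
  by (induction G) simp_all

lemma gsub_gsub: "gsub \<tau> (gsub \<sigma> G) = gsub (\<lambda>i. sub \<tau> (\<sigma> i)) G"
  by (induction G arbitrary: \<sigma> \<tau>) (simp_all add: sub_sub sub_up_up)

lemma gsub_inst_up: "gsub (inst [u]) (gsub (up \<sigma>) G) = gsub (case_nat u \<sigma>) G"
proof -
  have "(\<lambda>i. sub (inst [u]) (up \<sigma> i)) = case_nat u \<sigma>"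
    by (auto simp: fun_eq_iff inst_Cons up_def sub_ren split: nat.split)
  then show ?thesis by (simp add: gsub_gsub)
qed

text \<open>Types are listed innermost first, hence the context \<open>\<tau>s @ E\<close>; a goal
  that precedes inner quantifiers has been lifted past them by \<open>flat\<close>.\<close>

lemma wf_flat:
  "wf_clause sg us es \<Sigma> E C \<Longrightarrow> flat C = (\<tau>s, Gs, A) \<Longrightarrow>
    (\<forall>G \<in> set Gs. wf_goal sg us es \<Sigma> (\<tau>s @ E) G) \<and> has_type sg (svt \<Sigma>) (\<tau>s @ E) A (Base SAtm)"
proof (induction C arbitrary: E \<tau>s Gs A)
  case (DImp G C)
  obtain Gs' where C: "flat C = (\<tau>s, Gs', A)" "Gs = gsub (\<lambda>i. Bd (i + length \<tau>s)) G # Gs'"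
    using DImp.prems(2) by (auto split: prod.splits)
  have "wf_goal sg us es \<Sigma> (\<tau>s @ E) (gsub (\<lambda>i. Bd (i + length \<tau>s)) G)"
    by (rule wf_goal_gsub[of _ _ _ _ E])
      (use DImp.prems(1) in \<open>auto simp: has_type_Bd_iff nth_append\<close>)
  then show ?case using DImp.IH[OF _ C(1)] DImp.prems(1) C(2) by auto
next
  case (DAll \<tau> C)
  obtain \<tau>s' where C: "flat C = (\<tau>s', Gs, A)" "\<tau>s = \<tau>s' @ [\<tau>]"
    using DAll.prems(2) by (auto split: prod.splits)
  then show ?case using DAll.IH[OF _ C(1), of "\<tau> # E"] DAll.prems(1) by simp
qed auto

lemma wf_conj_goals: "wf_goal sg us es \<Sigma> E (conj_goals Gs) \<longleftrightarrow> (\<forall>G \<in> set Gs. wf_goal sg us es \<Sigma> E G)"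
  by (induction Gs rule: conj_goals.induct) auto

inductive_cases hh_GAndE: "hh sg \<Sigma> \<Delta> (GAnd G H)"

lemma hh_conj_goals: "hh sg \<Sigma> \<Delta> (gsub \<sigma> (conj_goals Gs)) \<Longrightarrow> G \<in> set Gs \<Longrightarrow> hh sg \<Sigma> \<Delta> (gsub \<sigma> G)"
  by (induction Gs rule: conj_goals.induct) (auto elim: hh_GAndE)

section \<open>The encoding\<close>

definition pn :: "('b sty \<Rightarrow> nat \<Rightarrow> nat) \<Rightarrow> 'b evar \<Rightarrow> 'b mbase tvar" where
  "pn \<nu> h = (\<nu> (snd h) (fst h), psi_ty (snd h))"

lemma snd_pn [simp]: "snd (pn \<nu> h) = psi_ty (snd h)"
  by (simp add: pn_def)

text \<open>Eigenvariables of different types cannot collide because \<open>psi_ty\<close> is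
  injective; at one type \<open>\<nu>\<close> is bijective.\<close>

lemma inj_pn: "\<forall>\<tau>. bij (\<nu> \<tau>) \<Longrightarrow> inj (pn \<nu>)"
proof (rule injI)
  fix h h' assume bij: "\<forall>\<tau>. bij (\<nu> \<tau>)" and eq: "pn \<nu> h = pn \<nu> h'"
  have "psi_ty \<tau> = psi_ty \<tau>' \<Longrightarrow> \<tau> = \<tau>'" for \<tau> \<tau>' :: "'a sty"
    using ty.inj_map[of Spec] by (auto simp: inj_def)
  then have "snd h = snd h'" using eq by (simp add: pn_def)
  moreover from this have "fst h = fst h'"
    using eq bij by (simp add: pn_def) (metis bij_is_inj inj_eq)
  ultimately show "h = h'" by (simp add: prod_eq_iff)
qed

abbreviation psi_base :: "'b sbase \<Rightarrow> 'b mty" where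
  "psi_base b \<equiv> Base (Spec b)"

lemma psi_ty_eq_bind: "psi_ty \<tau> = bind_ty psi_base \<tau>"
  by (rule map_ty_eq_bind_ty)

lemma psi_tm_eq_hom:
  "psi_tm \<nu> t = hom psi_base (\<lambda>c. Con (SpecC c)) (\<lambda>h. Par (Nom (pn \<nu> h))) Bd t"
  unfolding psi_tm_def map_tm_eq_hom by (auto intro!: hom_cong_pars simp: pn_def)

lemma psi_tm_ren: "psi_tm \<nu> (ren r t) = ren r (psi_tm \<nu> t)"
  unfolding psi_tm_eq_hom by (simp add: hom_ren ren_hom)

lemma psi_tm_sub: "psi_tm \<nu> (sub \<sigma> t) = sub (\<lambda>i. psi_tm \<nu> (\<sigma> i)) (psi_tm \<nu> t)"
  unfolding psi_tm_eq_hom by (simp add: hom_sub sub_hom)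

lemma psi_tm_up: "(\<lambda>i. psi_tm \<nu> (up \<sigma> i)) = up (\<lambda>i. psi_tm \<nu> (\<sigma> i))"
  by (auto simp: up_def fun_eq_iff psi_tm_ren psi_tm_eq_hom[of _ "Bd 0"] split: nat.split)

text \<open>Both syntaxes use the same indices, so instantiating a goal becomes plain term
  substitution, with no \<beta>-step in between.\<close>

lemma psi_goal_gsub: "psi_goal \<nu> (gsub \<sigma> G) = sub (\<lambda>i. psi_tm \<nu> (\<sigma> i)) (psi_goal \<nu> G)"
  by (induction G arbitrary: \<sigma>) (simp_all add: psi_tm_sub psi_tm_up)

lemma psi_inst: "(\<lambda>i. psi_tm \<nu> (inst ts i)) = inst (map (psi_tm \<nu>) ts)"
  by (auto simp: inst_def fun_eq_iff psi_tm_eq_hom)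

text \<open>\<open>vt\<close> only has to type the constants that encode \<open>\<Sigma>\<close>. A
  deliberately small \<open>vt\<close> later bounds the nominal constants that can occur.\<close>

lemma psi_conv:
  assumes "conv sg (svt \<Sigma>) E t u \<tau>" "\<And>h. h \<in> \<Sigma> \<Longrightarrow> vt (Nom (pn \<nu> h)) = Some (psi_ty (snd h))"
  shows "conv (msig sg us es) vt (map psi_ty E) (psi_tm \<nu> t) (psi_tm \<nu> u) (psi_ty \<tau>)"
  unfolding psi_tm_eq_hom psi_ty_eq_bind
  by (rule hom_conv[OF assms(1)])
    (use assms(2) in \<open>auto simp: has_type_iffs psi_ty_eq_bind svt_def split: if_splits\<close>)

lemma psi_has_type:
  assumes "has_type sg (svt \<Sigma>) E t \<tau>" "\<And>h. h \<in> \<Sigma> \<Longrightarrow> vt (Nom (pn \<nu> h)) = Some (psi_ty (snd h))"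
  shows "has_type (msig sg us es) vt (map psi_ty E) (psi_tm \<nu> t) (psi_ty \<tau>)"
  using psi_conv[OF conv.refl[OF assms(1)] assms(2)] conv_has_type by blast

lemma psi_goal_has_type:
  assumes "wf_goal sg us es \<Sigma> E G" "\<And>h. h \<in> \<Sigma> \<Longrightarrow> vt (Nom (pn \<nu> h)) = Some (psi_ty (snd h))"
  shows "has_type (msig sg us es) vt (map psi_ty E) (psi_goal \<nu> G) frm"
  using assms(1)
proof (induction G arbitrary: E)
  case (GAtom A)
  then show ?case using psi_has_type[OF _ assms(2), of sg \<Sigma> E A "Base SAtm" us es]
    by (auto simp: has_type_iffs)
next
  case (GImp A G)
  then show ?case using psi_has_type[OF _ assms(2), of sg \<Sigma> E A "Base SAtm" us es]
    by (auto simp: has_type_iffs)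
next
  case (GAll \<tau> G)
  then show ?case using GAll.IH[of "\<tau> # E"] by (auto simp: has_type_iffs)
next
  case (GEx \<tau> G)
  then show ?case using GEx.IH[of "\<tau> # E"] by (auto simp: has_type_iffs)
qed (auto simp: has_type_iffs)

lemma psi_inhabited:
  assumes "inhabited sg \<tau>"
  shows "inhabited (msig sg us es :: ('c, 'b) mcon \<Rightarrow> _) (psi_ty \<tau>)"
proof -
  obtain t :: "('c, unit, 'b sbase) tm" where t: "has_type sg (\<lambda>_. None) [] t \<tau>"
    using assms by (auto simp: inhabited_def)
  have "has_type (msig sg us es) (\<lambda>_. None) [] (hom psi_base (\<lambda>c. Con (SpecC c)) (\<lambda>_. Par ()) Bd t) (psi_ty \<tau>)"
    unfolding psi_ty_eq_bind
    by (rule has_type_hom[OF t]) (auto simp: has_type_iffs psi_ty_eq_bind)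
  then show ?thesis unfolding inhabited_def by blast
qed

locale encoding =
  fixes sg :: "'c \<Rightarrow> 'b sty option"
    and us es :: "'b sty list"
    and \<nu> :: "'b sty \<Rightarrow> nat \<Rightarrow> nat"
    and \<Delta> :: "('c, 'b) dclause list"
  assumes us_inhabited: "\<forall>\<tau> \<in> set us. inhabited sg \<tau>"
    and bij_\<nu>: "\<forall>\<tau>. bij (\<nu> \<tau>)"
    and wf_\<Delta>: "\<forall>C \<in> set \<Delta>. wf_clause sg (set us) (set es) {} [] C"
begin

abbreviation ct :: "('c, 'b) mcon \<Rightarrow> 'b mty option" where
  "ct \<equiv> msig sg (set us) (set es)"

abbreviation D :: "(pred, ('c, 'b) mcon, 'b mbase) defn" where
  "D \<equiv> spec_defn \<nu> us es \<Delta>"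

lemma wf_\<Delta>_flat:
  assumes "C \<in> set \<Delta>" "flat C = (\<tau>s, Gs, A)"
  shows "wf_goal sg (set us) (set es) \<Sigma> \<tau>s (conj_goals Gs)" "has_type sg (svt \<Sigma>) \<tau>s A (Base SAtm)"
proof -
  have *: "\<forall>G \<in> set Gs. wf_goal sg (set us) (set es) {} \<tau>s G" "has_type sg (svt {}) \<tau>s A (Base SAtm)"
    using wf_flat[of sg "set us" "set es" "{}" "[]" C] wf_\<Delta> assms by auto
  show "wf_goal sg (set us) (set es) \<Sigma> \<tau>s (conj_goals Gs)"
    using *(1) wf_goal_mono[of sg "set us" "set es" "{}"] by (auto simp: wf_conj_goals)
  show "has_type sg (svt \<Sigma>) \<tau>s A (Base SAtm)"
    using *(2) by (rule has_type_mono) (simp add: svt_def)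
qed

lemma psi_goal_closed_type:
  "wf_goal sg (set us) (set es) {} E G \<Longrightarrow> has_type ct vt (map psi_ty E) (psi_goal \<nu> G) frm"
  "has_type sg (svt {}) E t \<tau> \<Longrightarrow> has_type ct vt (map psi_ty E) (psi_tm \<nu> t) (psi_ty \<tau>)"
  using psi_goal_has_type psi_has_type by blast+

sublocale term_model ct D
proof
  fix p
  have "wf_form ct D {} (arg_types D p) (snd (snd (D p))) \<and> positive (snd (snd (D p))) \<and> supp (snd (snd (D p))) = {}"
  proof (cases p)
    case Nat
    have "supp (clauses_body nat_clauses :: (pred, ('c, 'b) mcon, 'b mbase) mform) = {}"
      by (rule supp_clauses_body) (auto simp: nat_clauses_def noms_def supp_def)
    then show ?thesis using Nat
      by (auto simp: nat_clauses_def wf_form_clauses_body positive_clauses_body has_type_iffs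
          numeral_eq_Suc intro!: wf_form_clause_body)
  next
    case Member
    have "supp (clauses_body member_clauses :: (pred, ('c, 'b) mcon, 'b mbase) mform) = {}"
      by (rule supp_clauses_body) (auto simp: member_clauses_def noms_def supp_def)
    then show ?thesis using Member
      by (auto simp: member_clauses_def wf_form_clauses_body positive_clauses_body has_type_iffs
          numeral_eq_Suc intro!: wf_form_clause_body)
  next
    case Seq
    have inh: "inhabited ct (psi_ty \<tau>)" if "\<tau> \<in> set us" for \<tau>
      using that us_inhabited psi_inhabited by blast
    have "wf_form ct D {} [nt, atmlist, frm] (clauses_body (seq_clauses us es))"
      by (auto simp: seq_clauses_def wf_form_clauses_body has_type_iffs inh numeral_eq_Suc
          intro!: wf_form_clause_body)
    moreover have "supp (clauses_body (seq_clauses us es) :: (pred, ('c, 'b) mcon, 'b mbase) mform) = {}"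
      by (rule supp_clauses_body) (auto simp: seq_clauses_def noms_def supp_def)
    ultimately show ?thesis using Seq
      by (auto simp: seq_clauses_def positive_clauses_body)
  next
    case Prog
    have "wf_form ct D {} [atm, frm] (clauses_body (prog_clauses \<nu> \<Delta>))"
      using wf_\<Delta>_flat[where \<Sigma> = "{}"] psi_goal_closed_type
      by (fastforce simp: prog_clauses_def wf_form_clauses_body intro!: wf_form_clause_body split: prod.splits)
    moreover have "supp (clauses_body (prog_clauses \<nu> \<Delta>) :: (pred, ('c, 'b) mcon, 'b mbase) mform) = {}"
    proof (rule supp_clauses_body, clarify)
      fix \<tau>s ts B assume "(\<tau>s, ts, B) \<in> set (prog_clauses \<nu> \<Delta> :: ('c, 'b) gclause list)"
      then obtain C \<tau>s' Gs A where C: "C \<in> set \<Delta>" "flat C = (\<tau>s', Gs, A)" and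
        ts: "ts = [psi_tm \<nu> A, psi_goal \<nu> (conj_goals Gs)]" "B = FTop"
        by (auto simp: prog_clauses_def split: prod.splits)
      \<comment> \<open>Clauses are closed, so their encodings are typable without any parameters
        and contain no nominal constants.\<close>
      have "has_type ct (\<lambda>_. None) (map psi_ty \<tau>s') (psi_tm \<nu> A) atm"
        "has_type ct (\<lambda>_. None) (map psi_ty \<tau>s') (psi_goal \<nu> (conj_goals Gs)) frm"
        using psi_goal_closed_type(1)[OF wf_\<Delta>_flat(1)[OF C]] psi_goal_closed_type(2)[OF wf_\<Delta>_flat(2)[OF C]] by auto
      then show "(\<forall>t \<in> set ts. noms t = {}) \<and> supp B = {}"
        using has_type_pars[of ct "\<lambda>_. None"] by (auto simp: ts noms_def supp_def)
    qed
    ultimately show ?thesis using Prog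
      by (auto simp: prog_clauses_def positive_clauses_body split: prod.splits)
  qed
  then show "wf_form ct D {} (arg_types D p) (snd (snd (D p)))" "supp (snd (snd (D p))) = {}"
    "positive (snd (snd (D p)))" by auto
  show "fst (D p) \<noteq> Nu" by (cases p) auto
qed

end

subsection \<open>From derivations in the specification logic to proofs in the meta-logic\<close>

primrec num :: "nat \<Rightarrow> ('c, 'b) gtm" where
  "num 0 = Con CZ"
| "num (Suc n) = Con CS \<cdot> num n"

text \<open>The last element becomes the head, as in \<open>psi_atoms\<close>: a hypothesis appended
  by AUGMENT is a \<open>CCons\<close>.\<close>

definition alist :: "('c, 'b) gtm list \<Rightarrow> ('c, 'b) gtm" where
  "alist As = foldl (\<lambda>l A. Con CCons \<cdot> A \<cdot> l) (Con CNil) As"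

lemma alist_Nil [simp]: "alist [] = Con CNil"
  and alist_snoc [simp]: "alist (As @ [A]) = Con CCons \<cdot> A \<cdot> alist As"
  by (simp_all add: alist_def)

lemma psi_atoms_eq_alist: "psi_atoms \<nu> L = alist (map (psi_tm \<nu>) L)"
  by (simp add: psi_atoms_def alist_def foldl_map)

lemma has_type_num: "has_type (msig sg us es) vt E (num n) nt"
  by (induction n) (auto simp: has_type_iffs)

lemma has_type_alist:
  "\<forall>A \<in> set As. has_type (msig sg us es) vt E A atm \<Longrightarrow> has_type (msig sg us es) vt E (alist As) atmlist"
  by (induction As rule: rev_induct) (auto simp: has_type_iffs)

context encoding
begin

abbreviation der :: "(pred, ('c, 'b) mcon, 'b mbase) mform \<Rightarrow> bool" where
  "der F \<equiv> gder ct D {} {#} F"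

abbreviation mt :: "('c, 'b) gtm \<Rightarrow> 'b mty \<Rightarrow> bool" where
  "mt \<equiv> has_type ct (mvt ct {}) []"

section \<open>Meta-logic proofs by single clauses\<close>

lemma der_nat: "der (FAt Nat [num n])"
proof (induction n)
  case 0
  show ?case
    by (rule gder_clause[where p = Nat and \<tau>s = "[]" and ts = "[Con CZ]" and vs = "[]" and B = FTop])
      (auto simp: nat_clauses_def intro: gder.topR intro!: exI[of _ nt] conv.refl simp: has_type_iffs)
next
  case (Suc n)
  show ?case
    by (rule gder_clause[where p = Nat and \<tau>s = "[nt]" and ts = "[Con CS \<cdot> Bd 0]" and vs = "[num n]"
          and B = "FAt Nat [Bd 0]"])
      (use Suc in \<open>auto simp: nat_clauses_def ext_Cons has_type_num intro!: exI[of _ nt] conv.refl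
        simp: has_type_iffs\<close>)
qed

text \<open>The clauses of \<open>seq\<close> agree in their first two patterns, so only the pattern
  of the goal and the body are left to each case.\<close>

lemma der_seq_clause:
  assumes "(\<tau>s, [Con CS \<cdot> Bd 0, Bd 1, t], B) \<in> set (seq_clauses us es)"
    "list_all2 mt (num n # l # vs) \<tau>s" "sub (ext (num n # l # vs) (inst [num (Suc n), l, g])) t = g"
    "mt l atmlist" "mt g frm"
    "der (fsub (ext (num n # l # vs) (inst [num (Suc n), l, g])) B)"
  shows "der (FAt Seq [num (Suc n), l, g])"
proof (rule gder_clause[where D = D and p = Seq, OF spec_defn.simps(3) assms(1,2)])
  fix j assume "j < length [Con CS \<cdot> Bd 0, Bd 1, t]"
  then have "j = 0 \<or> j = 1 \<or> j = 2" by auto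
  then show "\<exists>\<tau>. gconv ct (sub (ext (num n # l # vs) (inst [num (Suc n), l, g])) ([Con CS \<cdot> Bd 0, Bd 1, t] ! j))
      ([num (Suc n), l, g] ! j) \<tau>"
  proof (elim disjE)
    assume "j = 0"
    then show ?thesis
      by (auto simp: ext_Cons has_type_num has_type_iffs intro!: exI[of _ nt] conv.refl)
  next
    assume "j = 1"
    then show ?thesis using assms(4) by (auto simp: ext_Cons intro!: exI[of _ atmlist] conv.refl)
  next
    assume "j = 2"
    then show ?thesis using assms(3,5) by (auto intro!: exI[of _ frm] conv.refl)
  qed
qed (use assms(6) in auto)

text \<open>Backchaining works modulo conversion, so membership is needed for every \<open>a\<close>
  convertible to an element. The repeated variable in the first clause is matched modulo conversion
  as well.\<close>

lemma der_member:
  assumes "\<forall>A \<in> set As. mt A atm" "A \<in> set As" "gconv ct A a atm"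
  shows "der (FAt Member [a, alist As])"
  using assms(1,2)
proof (induction As rule: rev_induct)
  case (snoc B As)
  have a: "mt a atm" using conv_has_type[OF assms(3)] by blast
  have aa: "\<exists>\<tau>. gconv ct a a \<tau>" using conv.refl[OF a] by blast
  have l: "mt (alist As) atmlist" using snoc.prems(1) by (intro has_type_alist) auto
  have B: "mt B atm" using snoc.prems(1) by simp
  show ?case
  proof (cases "A = B")
    case True
    have "gconv ct (Con CCons \<cdot> a \<cdot> alist As) (Con CCons \<cdot> B \<cdot> alist As) atmlist"
      using assms(3) True l
      by (intro conv.app[where \<sigma> = atmlist] conv.app[where \<sigma> = atm] conv.refl)
        (auto simp: has_type_iffs intro: conv.sym)
    then show ?thesis
      using a aa l by (intro gder_clause[where D = D and p = Member and \<tau>s = "[atm, atmlist]" and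
          ts = "[Bd 0, Con CCons \<cdot> Bd 0 \<cdot> Bd 1]" and vs = "[a, alist As]" and B = FTop, OF spec_defn.simps(2)])
        (auto simp: member_clauses_def ext_Cons less_Suc_eq_0_disj intro: gder.topR)
  next
    case False
    then have "der (FAt Member [a, alist As])" using snoc by auto
    moreover have "gconv ct (Con CCons \<cdot> B \<cdot> alist As) (Con CCons \<cdot> B \<cdot> alist As) atmlist"
      using B l by (auto intro!: conv.refl simp: has_type_iffs)
    ultimately show ?thesis
      using a aa l B by (intro gder_clause[where D = D and p = Member and \<tau>s = "[atm, atm, atmlist]" and
          ts = "[Bd 0, Con CCons \<cdot> Bd 1 \<cdot> Bd 2]" and vs = "[a, B, alist As]" and
          B = "FAt Member [Bd 0, Bd 2]", OF spec_defn.simps(2)])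
        (auto simp: member_clauses_def ext_Cons less_Suc_eq_0_disj numeral_eq_Suc)
  qed
qed simp

lemma der_seq_conv:
  assumes "der (FAt Seq [n, l, g])" "gconv ct g g' frm" "mt n nt" "mt l atmlist"
  shows "der (FAt Seq [n, l, g'])"
  by (rule gder.convR[OF _ assms(1)])
    (use assms(2-) in \<open>auto intro!: fconv.intros intro: conv.refl\<close>)

text \<open>Asking for all large heights instead of one height lets premises of different heights
  meet at their maximum, so monotonicity of \<open>seq\<close> in its height need not be proved
  inside the meta-logic.\<close>

definition eventually_der :: "('c, 'b) gtm \<Rightarrow> ('c, 'b) gtm \<Rightarrow> bool" where
  "eventually_der l g \<longleftrightarrow> (\<exists>n\<^sub>0. \<forall>n \<ge> n\<^sub>0. der (FAt Seq [num n, l, g]))"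

lemma eventually_der_step:
  assumes "\<And>n. n \<ge> n\<^sub>0 \<Longrightarrow> der (FAt Seq [num (Suc n), l, g])"
  shows "eventually_der l g"
  unfolding eventually_der_def
proof (intro exI[of _ "Suc n\<^sub>0"] allI impI)
  fix n assume "Suc n\<^sub>0 \<le> n"
  then obtain m where "n = Suc m" "n\<^sub>0 \<le> m" by (auto simp: Suc_le_eq gr0_conv_Suc dest: less_imp_Suc_add)
  then show "der (FAt Seq [num n, l, g])" using assms by simp
qed

lemma eventually_der_True: "mt l atmlist \<Longrightarrow> eventually_der l (Con CTop)"
  by (rule eventually_der_step, rule der_seq_clause[where t = "Con CTop" and vs = "[]" and B = FTop])
    (auto simp: seq_clauses_def has_type_num has_type_iffs intro: gder.topR)

lemma eventually_der_And:
  assumes "eventually_der l g" "eventually_der l g'" "mt l atmlist" "mt g frm" "mt g' frm"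
  shows "eventually_der l (Con CAnd \<cdot> g \<cdot> g')"
proof -
  from assms(1,2) obtain n m where "\<forall>k \<ge> n. der (FAt Seq [num k, l, g])" "\<forall>k \<ge> m. der (FAt Seq [num k, l, g'])"
    by (auto simp: eventually_der_def)
  then show ?thesis using assms(3-)
    by (intro eventually_der_step[of "max n m"] der_seq_clause[where t = "Con CAnd \<cdot> Bd 2 \<cdot> Bd 3" and vs = "[g, g']" and
          B = "FAnd (FAt Seq [Bd 0, Bd 1, Bd 2]) (FAt Seq [Bd 0, Bd 1, Bd 3])"])
      (auto simp: seq_clauses_def has_type_num has_type_iffs ext_Cons numeral_eq_Suc intro: gder.andR)
qed

lemma eventually_der_Or1:
  assumes "eventually_der l g" "mt l atmlist" "mt g frm" "mt g' frm"
  shows "eventually_der l (Con COr \<cdot> g \<cdot> g')"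
proof -
  from assms(1) obtain n where "\<forall>k \<ge> n. der (FAt Seq [num k, l, g])"
    by (auto simp: eventually_der_def)
  then show ?thesis using assms(2-)
    by (intro eventually_der_step[of n] der_seq_clause[where t = "Con COr \<cdot> Bd 2 \<cdot> Bd 3" and vs = "[g, g']" and
          B = "FAt Seq [Bd 0, Bd 1, Bd 2]"])
      (auto simp: seq_clauses_def has_type_num has_type_iffs ext_Cons numeral_eq_Suc)
qed

lemma eventually_der_Or2:
  assumes "eventually_der l g'" "mt l atmlist" "mt g frm" "mt g' frm"
  shows "eventually_der l (Con COr \<cdot> g \<cdot> g')"
proof -
  from assms(1) obtain n where "\<forall>k \<ge> n. der (FAt Seq [num k, l, g'])"
    by (auto simp: eventually_der_def)
  then show ?thesis using assms(2-)
    by (intro eventually_der_step[of n] der_seq_clause[where t = "Con COr \<cdot> Bd 2 \<cdot> Bd 3" and vs = "[g, g']" and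
          B = "FAt Seq [Bd 0, Bd 1, Bd 3]"])
      (auto simp: seq_clauses_def has_type_num has_type_iffs ext_Cons numeral_eq_Suc)
qed

lemma eventually_der_Imp:
  assumes "eventually_der (Con CCons \<cdot> a \<cdot> l) g" "mt l atmlist" "mt a atm" "mt g frm"
  shows "eventually_der l (Con CImp \<cdot> a \<cdot> g)"
proof -
  from assms(1) obtain n where "\<forall>k \<ge> n. der (FAt Seq [num k, Con CCons \<cdot> a \<cdot> l, g])"
    by (auto simp: eventually_der_def)
  then show ?thesis using assms(2-)
    by (intro eventually_der_step[of n] der_seq_clause[where t = "Con CImp \<cdot> Bd 2 \<cdot> Bd 3" and vs = "[a, g]" and
          B = "FAt Seq [Bd 0, Con CCons \<cdot> Bd 2 \<cdot> Bd 1, Bd 3]"])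
      (auto simp: seq_clauses_def has_type_num has_type_iffs ext_Cons numeral_eq_Suc)
qed

lemma eventually_der_member:
  assumes "\<forall>A \<in> set As. mt A atm" "A \<in> set As" "gconv ct A a atm"
  shows "eventually_der (alist As) (Con CAt \<cdot> a)"
proof -
  have "mt a atm" "mt (alist As) atmlist" using assms conv_has_type has_type_alist by blast+
  then show ?thesis using der_member[OF assms]
    by (intro eventually_der_step[of 0] der_seq_clause[where t = "Con CAt \<cdot> Bd 2" and vs = "[a]" and
          B = "FAt Member [Bd 2, Bd 1]"])
      (auto simp: seq_clauses_def has_type_num has_type_iffs ext_Cons numeral_eq_Suc)
qed

lemma eventually_der_prog:
  assumes "eventually_der l b" "der (FAt Prog [a, b])" "mt l atmlist" "mt a atm" "mt b frm"
  shows "eventually_der l (Con CAt \<cdot> a)"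
proof -
  from assms(1) obtain n where n: "\<forall>k \<ge> n. der (FAt Seq [num k, l, b])"
    by (auto simp: eventually_der_def)
  have closed: "sub (inst [b]) (ren Suc t) = t" for t :: "('c, 'b) gtm" by simp
  show ?thesis
    using assms(2-) n
    by (intro eventually_der_step[of n] der_seq_clause[where t = "Con CAt \<cdot> Bd 2" and vs = "[a]" and
          B = "FEx frm (FAnd (FAt Prog [Bd 3, Bd 0]) (FAt Seq [Bd 1, Bd 2, Bd 0]))"])
      (auto simp: seq_clauses_def has_type_num has_type_iffs ext_Cons numeral_eq_Suc inst_Cons[of b]
        sub_ren intro!: gder.exR[of _ _ b] gder.andR)
qed

text \<open>The clause for \<open>CEx\<close> asks for the redex
  \<open>Lam (psi_ty \<tau>) g \<cdot> t\<close>, which is obtained from the instantiated goal by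
  conversion.\<close>

lemma eventually_der_Ex:
  assumes "eventually_der l (sub (inst [t]) g)" "mt l atmlist" "mt t (psi_ty \<tau>)" "\<tau> \<in> set es"
    "has_type ct (mvt ct {}) [psi_ty \<tau>] g frm"
  shows "eventually_der l (Con (CEx \<tau>) \<cdot> Lam (psi_ty \<tau>) g)"
proof -
  from assms(1) obtain n where n: "\<forall>k \<ge> n. der (FAt Seq [num k, l, sub (inst [t]) g])"
    by (auto simp: eventually_der_def)
  let ?g = "Lam (psi_ty \<tau>) g"
  have "der (FAt Seq [num k, l, ?g \<cdot> t])" if "k \<ge> n" for k
    by (rule der_seq_conv[OF _ conv.sym[OF conv.beta]])
      (use n that assms has_type_num in auto)
  then show ?thesis
    using assms(2-)
    by (intro eventually_der_step[of n] der_seq_clause[where t = "Con (CEx \<tau>) \<cdot> Bd 2" and vs = "[?g]" and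
          B = "FEx (psi_ty \<tau>) (FAt Seq [Bd 1, Bd 2, Bd 3 \<cdot> Bd 0])"])
      (auto simp: seq_clauses_def has_type_num has_type_iffs ext_Cons numeral_eq_Suc inst_Cons[of t]
        sub_ren simp del: ren.simps(5) intro!: gder.exR[of _ _ t])
qed

text \<open>\<open>nabR\<close> accepts any constant outside the support, so the constant encoding
  the eigenvariable of GENERIC can be used itself, given that it occurs neither in the hypotheses
  nor in the goal.\<close>

lemma eventually_der_All:
  assumes "eventually_der l (sub (inst [Par (Nom a)]) g)" "mt l atmlist" "\<tau> \<in> set us" "snd a = psi_ty \<tau>"
    "has_type ct (mvt ct {}) [psi_ty \<tau>] g frm" "a \<notin> noms l" "a \<notin> noms g"
  shows "eventually_der l (Con (CAll \<tau>) \<cdot> Lam (psi_ty \<tau>) g)"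
proof -
  from assms(1) obtain n where n: "\<forall>k \<ge> n. der (FAt Seq [num k, l, sub (inst [Par (Nom a)]) g])"
    by (auto simp: eventually_der_def)
  let ?g = "Lam (psi_ty \<tau>) g" and ?a = "Par (Nom a)"
  have a: "mt ?a (psi_ty \<tau>)"
    using us_inhabited assms(3,4) by (auto simp: has_type_Par_iff mvt_Nom intro: psi_inhabited)
  have d: "der (FAt Seq [num k, l, ?g \<cdot> ?a])" if "k \<ge> n" for k
    by (rule der_seq_conv[OF _ conv.sym[OF conv.beta]])
      (use n that assms a has_type_num in auto)
  have "der (FNab (psi_ty \<tau>) (FAt Seq [ren Suc (num k), ren Suc l, ren Suc ?g \<cdot> Bd 0]))" if "k \<ge> n" for k
  proof (rule gder.nabR)
    have "Nom a \<notin> pars (num k)" by (induction k) auto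
    then show "a \<notin> supp (FAt Seq [ren Suc (num k), ren Suc l, ren Suc ?g \<cdot> Bd 0] :: (pred, ('c, 'b) mcon, 'b mbase) mform)"
      using assms(6,7) by (auto simp: supp_def noms_def pars_ren simp del: ren.simps(5))
    show "der (fsub (inst [?a]) (FAt Seq [ren Suc (num k), ren Suc l, ren Suc ?g \<cdot> Bd 0]))"
      using d[OF that] by (simp add: inst_Cons[of ?a] sub_ren del: ren.simps(5))
  qed (rule assms(4))
  then show ?thesis
    using assms(2-)
    by (intro eventually_der_step[of n] der_seq_clause[where t = "Con (CAll \<tau>) \<cdot> Bd 2" and vs = "[?g]" and
          B = "FNab (psi_ty \<tau>) (FAt Seq [Bd 1, Bd 2, Bd 3 \<cdot> Bd 0])"])
      (auto simp: seq_clauses_def has_type_num has_type_iffs ext_Cons numeral_eq_Suc simp del: ren.simps(5))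
qed

lemma psi_Nom_type:
  "\<forall>h \<in> \<Sigma>. inhabited sg (snd h) \<Longrightarrow> h \<in> \<Sigma> \<Longrightarrow> mvt ct \<Sigma>' (Nom (pn \<nu> h)) = Some (psi_ty (snd h))"
  by (auto simp: mvt_Nom intro: psi_inhabited)

text \<open>Typing as an occurrence check: under a typing that knows only the constants encoding
  \<open>\<Sigma>\<close>, the constant of an eigenvariable outside \<open>\<Sigma>\<close> cannot
  occur.\<close>

lemma noms_subset:
  assumes "has_type ct (\<lambda>v. if v \<in> (\<lambda>h. Nom (pn \<nu> h)) ` \<Sigma> then mvt ct {} v else None) E t \<tau>" "h \<notin> \<Sigma>"
  shows "pn \<nu> h \<notin> noms t"
proof
  assume "pn \<nu> h \<in> noms t"
  then have "Nom (pn \<nu> h) \<in> (\<lambda>h. Nom (pn \<nu> h)) ` \<Sigma>"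
    using has_type_pars[OF assms(1), of "Nom (pn \<nu> h)"] by (simp add: noms_def split: if_splits)
  then obtain h' where "h' \<in> \<Sigma>" "pn \<nu> h = pn \<nu> h'" by (elim imageE) simp
  then show False using assms(2) injD[OF inj_pn[OF bij_\<nu>], of h h'] by simp
qed

lemma eventually_der_conj:
  assumes "\<And>G. G \<in> set Gs \<Longrightarrow> eventually_der l (psi_goal \<nu> (gsub \<sigma> G)) \<and> mt (psi_goal \<nu> (gsub \<sigma> G)) frm"
    "mt l atmlist"
  shows "eventually_der l (psi_goal \<nu> (gsub \<sigma> (conj_goals Gs))) \<and> mt (psi_goal \<nu> (gsub \<sigma> (conj_goals Gs))) frm"
  using assms
proof (induction Gs rule: conj_goals.induct)
  case 1
  then show ?case by (auto intro: eventually_der_True simp: has_type_iffs)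
next
  case (3 G G' Gs)
  then have "eventually_der l (psi_goal \<nu> (gsub \<sigma> (conj_goals (G' # Gs))))"
    "mt (psi_goal \<nu> (gsub \<sigma> (conj_goals (G' # Gs)))) frm" by auto
  then show ?case using 3(2)[of G] 3(3) by (auto intro: eventually_der_And simp: has_type_iffs)
qed auto

lemma mt_psi:
  assumes "\<forall>h \<in> \<Sigma>. inhabited sg (snd h)"
  shows "has_type sg (svt \<Sigma>) [] t \<tau> \<Longrightarrow> mt (psi_tm \<nu> t) (psi_ty \<tau>)"
    "wf_goal sg (set us) (set es) \<Sigma> [] G \<Longrightarrow> mt (psi_goal \<nu> G) frm"
    "\<forall>A \<in> set L. has_type sg (svt \<Sigma>) [] A (Base SAtm) \<Longrightarrow> mt (psi_atoms \<nu> L) atmlist"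
proof -
  note ps = psi_Nom_type[OF assms]
  show *: "has_type sg (svt \<Sigma>) [] t \<tau> \<Longrightarrow> mt (psi_tm \<nu> t) (psi_ty \<tau>)" for t \<tau>
    using psi_has_type[OF _ ps, of sg \<Sigma> "[]" t \<tau>] by simp
  show "wf_goal sg (set us) (set es) \<Sigma> [] G \<Longrightarrow> mt (psi_goal \<nu> G) frm"
    using psi_goal_has_type[OF _ ps, of sg "set us" "set es" \<Sigma> "[]" G] by simp
  show "\<forall>A \<in> set L. has_type sg (svt \<Sigma>) [] A (Base SAtm) \<Longrightarrow> mt (psi_atoms \<nu> L) atmlist"
    using *[of _ "Base SAtm"] by (auto simp: psi_atoms_eq_alist intro!: has_type_alist)
qed

text \<open>The program stays fixed while AUGMENT extends \<open>L\<close> at its end. GENERIC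
  extends \<open>\<Sigma>\<close> at inhabited types only, which maintains the last
  hypothesis.\<close>

theorem hh_eventually_der:
  "hh sg \<Sigma> \<Delta>' G \<Longrightarrow> \<Delta>' = \<Delta> @ map DAtom L \<Longrightarrow> \<forall>A \<in> set L. has_type sg (svt \<Sigma>) [] A (Base SAtm) \<Longrightarrow>
    wf_goal sg (set us) (set es) \<Sigma> [] G \<Longrightarrow> \<forall>h \<in> \<Sigma>. inhabited sg (snd h) \<Longrightarrow>
    eventually_der (psi_atoms \<nu> L) (psi_goal \<nu> G)"
proof (induction arbitrary: L rule: hh.induct)
  case (TRUE \<Sigma> \<Delta>')
  then show ?case using mt_psi(3) by (auto intro: eventually_der_True)
next
  case (OR1 \<Sigma> \<Delta>' G H)
  then show ?case using mt_psi[OF OR1.prems(4)] by (auto intro: eventually_der_Or1)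
next
  case (OR2 \<Sigma> \<Delta>' H G)
  then show ?case using mt_psi[OF OR2.prems(4)] by (auto intro: eventually_der_Or2)
next
  case (AND \<Sigma> \<Delta>' G H)
  then show ?case using mt_psi[OF AND.prems(4)] by (auto intro: eventually_der_And)
next
  case (INSTANCE \<Sigma> t \<tau> \<Delta>' G)
  have G: "wf_goal sg (set us) (set es) \<Sigma> [\<tau>] G" "\<tau> \<in> set es" using INSTANCE.prems(3) by auto
  have "wf_goal sg (set us) (set es) \<Sigma> [] (gsub (inst [t]) G)"
    by (rule wf_goal_gsub[OF G(1)]) (use INSTANCE.hyps(1) in \<open>simp add: inst_def\<close>)
  then have "eventually_der (psi_atoms \<nu> L) (sub (inst [psi_tm \<nu> t]) (psi_goal \<nu> G))"
    using INSTANCE.IH INSTANCE.prems by (simp add: psi_goal_gsub psi_inst)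
  then show ?case
    using mt_psi[OF INSTANCE.prems(4)] INSTANCE.hyps(1) INSTANCE.prems(2) G
      psi_goal_has_type[OF G(1) psi_Nom_type[OF INSTANCE.prems(4)]]
    by (auto intro: eventually_der_Ex)
next
  case (AUGMENT \<Sigma> \<Delta>' A G)
  have "eventually_der (psi_atoms \<nu> (L @ [A])) (psi_goal \<nu> G)"
    by (rule AUGMENT.IH) (use AUGMENT.prems in auto)
  then show ?case
    using mt_psi[OF AUGMENT.prems(4)] mt_psi(1)[OF AUGMENT.prems(4), of A "Base SAtm"] AUGMENT.prems
    by (auto simp: psi_atoms_eq_alist intro!: eventually_der_Imp)
next
  case (GENERIC c \<Sigma> \<tau> \<Delta>' G)
  have G: "wf_goal sg (set us) (set es) \<Sigma> [\<tau>] G" "\<tau> \<in> set us" using GENERIC.prems(3) by auto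
  have G': "wf_goal sg (set us) (set es) (insert c \<Sigma>) [] (gsub (inst [Par c]) G)"
    by (rule wf_goal_gsub[OF wf_goal_mono[OF G(1)]])
      (use GENERIC.hyps(2) in \<open>auto simp: inst_def has_type_Par_iff svt_def\<close>)
  have L: "\<forall>A \<in> set L. has_type sg (svt (insert c \<Sigma>)) [] A (Base SAtm)"
    using GENERIC.prems(2) by (auto intro: has_type_mono svt_mono)
  have "eventually_der (psi_atoms \<nu> L) (psi_goal \<nu> (gsub (inst [Par c]) G))"
    by (rule GENERIC.IH[OF GENERIC.prems(1) L G'])
      (use GENERIC.prems(4) GENERIC.hyps(2) G(2) us_inhabited in auto)
  then have e: "eventually_der (psi_atoms \<nu> L) (sub (inst [Par (Nom (pn \<nu> c))]) (psi_goal \<nu> G))"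
    by (simp add: psi_goal_gsub psi_inst psi_tm_eq_hom[of _ "Par c"])
  \<comment> \<open>This typing forgets every nominal constant except those for
    \<open>\<Sigma>\<close>. Goal and hypotheses are typable with it, hence the constant of
    \<open>c\<close> is fresh for them.\<close>
  let ?vt = "\<lambda>v. if v \<in> (\<lambda>h. Nom (pn \<nu> h)) ` \<Sigma> then mvt ct {} v else None"
  have vt: "?vt (Nom (pn \<nu> h)) = Some (psi_ty (snd h))" if "h \<in> \<Sigma>" for h
    using that psi_Nom_type[OF GENERIC.prems(4) that] by simp
  have "has_type ct ?vt [] (psi_atoms \<nu> L) atmlist"
    using GENERIC.prems(2) psi_has_type[OF _ vt, of sg \<Sigma> "[]" _ "Base SAtm"]
    by (auto simp: psi_atoms_eq_alist intro!: has_type_alist)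
  moreover have "has_type ct ?vt [psi_ty \<tau>] (psi_goal \<nu> G) frm"
    using psi_goal_has_type[OF G(1), of ?vt] vt by simp
  ultimately have "pn \<nu> c \<notin> noms (psi_atoms \<nu> L)" "pn \<nu> c \<notin> noms (psi_goal \<nu> G)"
    using noms_subset GENERIC.hyps(1) by blast+
  then show ?case
    using e mt_psi[OF GENERIC.prems(4)] GENERIC.prems(2) GENERIC.hyps(2) G
      psi_goal_has_type[OF G(1) psi_Nom_type[OF GENERIC.prems(4)]]
    by (auto intro: eventually_der_All)
next
  case (BACKCHAIN C \<Delta>' \<tau>s Gs A' \<Sigma> ts A)
  note mt = mt_psi[OF BACKCHAIN.prems(4)]
  have c: "gconv ct (psi_tm \<nu> (sub (inst ts) A')) (psi_tm \<nu> A) atm"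
    using psi_conv[OF BACKCHAIN.hyps(4) psi_Nom_type[OF BACKCHAIN.prems(4)]] by simp
  have l: "mt (psi_atoms \<nu> L) atmlist" using mt(3) BACKCHAIN.prems(2) by blast
  have A: "mt (psi_tm \<nu> A) atm" using conv_has_type[OF c] by blast
  \<comment> \<open>A program clause is used through \<open>prog\<close>, a hypothesis through
    \<open>member\<close>.\<close>
  from BACKCHAIN.hyps(1) BACKCHAIN.prems(1) consider "C \<in> set \<Delta>" | B where "C = DAtom B" "B \<in> set L" by auto
  then show ?case
  proof cases
    case 1
    note wf = wf_\<Delta>_flat[OF 1 BACKCHAIN.hyps(2), of \<Sigma>]
    have ts: "has_type sg (svt \<Sigma>) [] (inst ts i) (\<tau>s ! i)" if "i < length \<tau>s" for i
      using BACKCHAIN.hyps(3) that by (auto simp: inst_def list_all2_conv_all_nth)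
    let ?g = "psi_goal \<nu> (gsub (inst ts) (conj_goals Gs))"
    have "eventually_der (psi_atoms \<nu> L) (psi_goal \<nu> (gsub (inst ts) G)) \<and> mt (psi_goal \<nu> (gsub (inst ts) G)) frm"
      if G: "G \<in> set Gs" for G
    proof -
      have "wf_goal sg (set us) (set es) \<Sigma> [] (gsub (inst ts) G)"
        by (rule wf_goal_gsub[of _ _ _ _ \<tau>s]) (use wf(1) G ts in \<open>auto simp: wf_conj_goals\<close>)
      then show ?thesis using BACKCHAIN.IH G BACKCHAIN.prems mt(2) by auto
    qed
    then have g: "eventually_der (psi_atoms \<nu> L) ?g" "mt ?g frm"
      using eventually_der_conj[OF _ l] by blast+
    have "der (FAt Prog [psi_tm \<nu> A, ?g])"
    proof (rule gder_clause[where D = D and p = Prog, OF spec_defn.simps(4)])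
      show "(map psi_ty \<tau>s, [psi_tm \<nu> A', psi_goal \<nu> (conj_goals Gs)], FTop) \<in> set (prog_clauses \<nu> \<Delta>)"
        using 1 BACKCHAIN.hyps(2) by (force simp: prog_clauses_def)
      show "list_all2 mt (map (psi_tm \<nu>) ts) (map psi_ty \<tau>s)"
        using BACKCHAIN.hyps(3) mt(1) by (auto simp: list.rel_map elim!: list.rel_mono_strong)
      let ?\<sigma> = "ext (map (psi_tm \<nu>) ts) (inst [psi_tm \<nu> A, ?g])"
      \<comment> \<open>The environment also holds the arguments of \<open>prog\<close>, but the
        patterns see only the clause variables in front of them.\<close>
      have \<sigma>: "?\<sigma> i = inst (map (psi_tm \<nu>) ts) i" if "i < length (map psi_ty \<tau>s)" for i
        using that list_all2_lengthD[OF BACKCHAIN.hyps(3)] by (simp add: ext_def inst_def)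
      have hA: "has_type ct (mvt ct {}) (map psi_ty \<tau>s) (psi_tm \<nu> A') (psi_ty (Base SAtm))"
        by (rule psi_has_type[OF wf(2) psi_Nom_type[OF BACKCHAIN.prems(4)]])
      have hG: "has_type ct (mvt ct {}) (map psi_ty \<tau>s) (psi_goal \<nu> (conj_goals Gs)) frm"
        by (rule psi_goal_has_type[OF wf(1) psi_Nom_type[OF BACKCHAIN.prems(4)]])
      have "sub ?\<sigma> (psi_tm \<nu> A') = psi_tm \<nu> (sub (inst ts) A')"
        using sub_cong_typed[OF hA \<sigma>] by (simp add: psi_tm_sub psi_inst)
      moreover have "sub ?\<sigma> (psi_goal \<nu> (conj_goals Gs)) = ?g"
        using sub_cong_typed[OF hG \<sigma>] by (simp add: psi_goal_gsub psi_inst)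
      ultimately show "\<exists>\<tau>. gconv ct (sub ?\<sigma> ([psi_tm \<nu> A', psi_goal \<nu> (conj_goals Gs)] ! j)) ([psi_tm \<nu> A, ?g] ! j) \<tau>"
        if "j < length [psi_tm \<nu> A', psi_goal \<nu> (conj_goals Gs)]" for j
        using that c conv.refl[OF g(2)] by (auto simp: less_Suc_eq_0_disj)
    qed (auto intro: gder.topR)
    then show ?thesis using g l A by (auto intro: eventually_der_prog)
  next
    case 2
    then have "ts = []" "A' = B" using BACKCHAIN.hyps(2,3) by auto
    then have c': "gconv ct (psi_tm \<nu> B) (psi_tm \<nu> A) atm" using c by simp
    have As: "\<forall>A \<in> set (map (psi_tm \<nu>) L). mt A atm"
      using mt(1)[of _ "Base SAtm"] BACKCHAIN.prems(2) by auto
    show ?thesis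
      using eventually_der_member[OF As _ c'] 2(2) by (simp add: psi_atoms_eq_alist)
  qed
qed

theorem hh_provable:
  assumes "hh sg \<Sigma> (\<Delta> @ map DAtom L) G" "\<forall>A \<in> set L. has_type sg (svt \<Sigma>) [] A (Base SAtm)"
    "wf_goal sg (set us) (set es) \<Sigma> [] G" "\<forall>h \<in> \<Sigma>. inhabited sg (snd h)"
  shows "provable ct D (psi_atoms \<nu> L \<rhd> psi_goal \<nu> G)"
proof -
  obtain n where n: "der (FAt Seq [num n, psi_atoms \<nu> L, psi_goal \<nu> G])"
    using hh_eventually_der[OF assms(1) HOL.refl assms(2-)] by (auto simp: eventually_der_def)
  show ?thesis
    unfolding provable_def entails_def
    by (rule gder.exR[of _ _ "num n"]) (use n der_nat in \<open>auto intro!: gder.andR has_type_num simp: inst_Cons sub_ren\<close>)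
qed

end

subsection \<open>From proofs in the meta-logic to derivations in the specification logic\<close>

text \<open>The meta-logic has more terms of specification types than the specification logic, even up to
  conversion: they may mention further nominal constants, and an intermediate term of a conversion may
  mention any constant. The following retraction removes them, mapping the additional base types to the
  inhabited type \<open>SAtm \<rightarrow>\<^sub>t SAtm\<close>.\<close>

abbreviation (input) idty :: "'b sty" where
  "idty \<equiv> Base SAtm \<rightarrow>\<^sub>t Base SAtm"

abbreviation (input) idtm :: "('c, 'v, 'b sbase) tm" where
  "idtm \<equiv> Lam (Base SAtm) (Bd 0)"

primrec ret_base :: "'b mbase \<Rightarrow> 'b sty" where
  "ret_base (Spec b) = Base b"
| "ret_base Frm = idty"
| "ret_base Nt = idty"
| "ret_base AtmList = idty"

text \<open>Constants of the signature are kept; for the others only the type of the image matters.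
  Formulas, numbers and lists built from them collapse to the identity.\<close>

primrec ret_con :: "('c, 'b) mcon \<Rightarrow> ('c, 'v, 'b sbase) tm" where
  "ret_con (SpecC c) = Con c"
| "ret_con CTop = idtm"
| "ret_con COr = Lam idty (Lam idty idtm)"
| "ret_con CAnd = Lam idty (Lam idty idtm)"
| "ret_con CImp = Lam (Base SAtm) (Lam idty idtm)"
| "ret_con (CAll \<tau>) = Lam (\<tau> \<rightarrow>\<^sub>t idty) idtm"
| "ret_con (CEx \<tau>) = Lam (\<tau> \<rightarrow>\<^sub>t idty) idtm"
| "ret_con CAt = Lam (Base SAtm) idtm"
| "ret_con CZ = idtm"
| "ret_con CS = Lam idty idtm"
| "ret_con CNil = idtm"
| "ret_con CCons = Lam (Base SAtm) (Lam idty idtm)"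

abbreviation ret_ty :: "'b mty \<Rightarrow> 'b sty" where
  "ret_ty \<equiv> bind_ty ret_base"

lemma ret_psi_ty [simp]: "ret_ty (psi_ty \<tau>) = \<tau>"
  by (simp add: psi_ty_eq_bind bind_ty_bind_ty)

lemma has_type_ret_con:
  assumes "msig sg us es c = Some \<tau>"
  shows "has_type sg vt E (ret_con c) (ret_ty \<tau>)"
  using assms by (cases c) (auto simp: has_type_iffs split: if_splits)

definition ret :: "('b mbase tvar \<Rightarrow> ('c, 'b) stm) \<Rightarrow> ('c, 'b) gtm \<Rightarrow> ('c, 'b) stm" where
  "ret r = hom ret_base ret_con (case_mvar r (\<lambda>_. idtm)) Bd"

lemma ret_Nom [simp]: "ret r (Par (Nom a)) = r a"
  by (simp add: ret_def)

text \<open>Retraction undoes the encoding once \<open>r\<close> decodes the eigenvariables; the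
  values substituted for the indices are retracted along the way.\<close>

lemma ret_psi:
  assumes "has_type sg (svt \<Sigma>) E t \<tau>" "\<And>h. h \<in> \<Sigma> \<Longrightarrow> r (pn \<nu> h) = Par h"
  shows "ret r (sub xs (psi_tm \<nu> t)) = sub (\<lambda>i. ret r (xs i)) t"
proof -
  have "ret r (sub xs (psi_tm \<nu> t)) = hom Base Con (\<lambda>h. r (pn \<nu> h)) (\<lambda>i. ret r (xs i)) t"
    unfolding ret_def hom_sub psi_tm_eq_hom hom_hom by simp
  also have "\<dots> = hom Base Con Par (\<lambda>i. ret r (xs i)) t"
  proof (rule hom_cong_pars)
    fix h assume "h \<in> pars t"
    then have "h \<in> \<Sigma>" using has_type_pars[OF assms(1), of h] by (simp add: svt_def split: if_splits)
    then show "r (pn \<nu> h) = Par h" by (rule assms(2))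
  qed
  finally show ?thesis by (simp add: sub_eq_hom)
qed

lemma ret_cong: "(\<And>a. a \<in> noms t \<Longrightarrow> r a = r' a) \<Longrightarrow> ret r t = ret r' t"
  unfolding ret_def by (rule hom_cong_pars) (auto simp: noms_def split: mvar.split)

lemma nsim_simps:
  "nsim ct vt (t \<cdot> u) (t' \<cdot> u') \<longleftrightarrow> nsim ct vt t t' \<and> (\<exists>\<sigma>. conv ct vt [] u u' \<sigma>)"
  "nsim ct vt (Con c) (Con c') \<longleftrightarrow> c = c'"
  "\<not> nsim ct vt (Con c) (t \<cdot> u)" "\<not> nsim ct vt (t \<cdot> u) (Con c)"
  by (auto intro: nsim.intros elim: nsim.cases)

text \<open>Every encoded goal starts with a logical constant, whatever its indices are replaced by,
  so its outermost connective can be read off modulo conversion.\<close>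

lemma rigid_psi_goal: "rigid (sub xs (psi_goal \<nu> G))"
  by (cases G) auto

context encoding
begin

text \<open>Images are required at inhabited types only, since nominal constants exist at no
  others.\<close>

definition rok :: "'b evar set \<Rightarrow> ('b mbase tvar \<Rightarrow> ('c, 'b) stm) \<Rightarrow> bool" where
  "rok \<Sigma> r \<longleftrightarrow> (\<forall>a. inhabited ct (snd a) \<longrightarrow> has_type sg (svt \<Sigma>) [] (r a) (ret_ty (snd a)))"

lemma ret_conv:
  assumes "gconv ct t u \<tau>" "rok \<Sigma> r"
  shows "conv sg (svt \<Sigma>) [] (ret r t) (ret r u) (ret_ty \<tau>)"
  unfolding ret_def
  by (rule hom_conv[OF assms(1)])
    (use assms(2) in \<open>auto simp: rok_def mvt_def intro: has_type_ret_con split: mvar.splits if_splits\<close>)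

lemma ret_has_type: "mt t \<tau> \<Longrightarrow> rok \<Sigma> r \<Longrightarrow> has_type sg (svt \<Sigma>) [] (ret r t) (ret_ty \<tau>)"
  using ret_conv conv.refl conv_has_type by blast

text \<open>Provides default values for nominal constants that stand for no eigenvariable: a closed
  inhabitant is retracted.\<close>

lemma inhabited_ret: "inhabited ct \<tau> \<Longrightarrow> \<exists>t. has_type sg (svt \<Sigma>) [] t (ret_ty \<tau>)"
proof -
  assume "inhabited ct \<tau>"
  then obtain t :: "(('c, 'b) mcon, unit, 'b mbase) tm" where t: "has_type ct (\<lambda>_. None) [] t \<tau>"
    by (auto simp: inhabited_def)
  have "has_type sg (svt \<Sigma>) [] (hom ret_base ret_con (\<lambda>_. idtm) Bd t) (ret_ty \<tau>)"
    by (rule has_type_hom[OF t]) (auto intro: has_type_ret_con)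
  then show ?thesis by blast
qed

text \<open>\<open>\<Sigma>\<^sub>0\<close> contains the eigenvariables of the sequent under consideration; those introduced by
  \<open>GENERIC\<close> are represented by the indices bound in \<open>E\<close>, which are instantiated by \<open>xs\<close>.\<close>

definition Jseq :: "'b evar set \<Rightarrow> ('c, 'b) gtm \<Rightarrow> ('c, 'b) gtm \<Rightarrow> bool" where
  "Jseq \<Sigma>\<^sub>0 l g \<longleftrightarrow> (\<forall>\<Sigma> r E xs As G. finite \<Sigma> \<longrightarrow> \<Sigma>\<^sub>0 \<subseteq> \<Sigma> \<longrightarrow> rok \<Sigma> r \<longrightarrow> (\<forall>h \<in> \<Sigma>\<^sub>0. r (pn \<nu> h) = Par h) \<longrightarrow>
    wf_goal sg (set us) (set es) \<Sigma>\<^sub>0 E G \<longrightarrow> (\<forall>i < length E. mt (xs i) (psi_ty (E ! i))) \<longrightarrow>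
    (\<forall>A \<in> set As. mt A atm) \<longrightarrow> gconv ct l (alist As) atmlist \<longrightarrow> gconv ct g (sub xs (psi_goal \<nu> G)) frm \<longrightarrow>
    hh sg \<Sigma> (\<Delta> @ map DAtom (map (ret r) As)) (gsub (\<lambda>i. ret r (xs i)) G))"

text \<open>Stated for every explicit list to which \<open>l\<close> converts, because the model
  determines lists only modulo conversion.\<close>

definition Jmember :: "('c, 'b) gtm \<Rightarrow> ('c, 'b) gtm \<Rightarrow> bool" where
  "Jmember a l \<longleftrightarrow> (\<forall>As. (\<forall>A \<in> set As. mt A atm) \<longrightarrow> gconv ct l (alist As) atmlist \<longrightarrow>
    (\<exists>A \<in> set As. gconv ct a A atm))"

definition Jprog :: "('c, 'b) gtm \<Rightarrow> ('c, 'b) gtm \<Rightarrow> bool" where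
  "Jprog a b \<longleftrightarrow> (\<exists>C \<in> set \<Delta>. \<exists>\<tau>s Gs A ys. flat C = (\<tau>s, Gs, A) \<and> list_all2 mt ys (map psi_ty \<tau>s) \<and>
    gconv ct a (sub (inst ys) (psi_tm \<nu> A)) atm \<and> gconv ct b (sub (inst ys) (psi_goal \<nu> (conj_goals Gs))) frm)"

text \<open>Heights are discarded and \<open>Nat\<close> is interpreted as always true: the
  induction runs over the fixed point \<open>M\<close>, not over the height.\<close>

definition J :: "'b evar set \<Rightarrow> pred \<Rightarrow> ('c, 'b) gtm list \<Rightarrow> bool" where
  "J \<Sigma>\<^sub>0 p ts \<longleftrightarrow> (case p of Nat \<Rightarrow> True | Member \<Rightarrow> Jmember (ts ! 0) (ts ! 1)
    | Seq \<Rightarrow> Jseq \<Sigma>\<^sub>0 (ts ! 1) (ts ! 2) | Prog \<Rightarrow> Jprog (ts ! 0) (ts ! 1))"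

section \<open>The invariant is closed under the clauses\<close>

lemma gconv_retype: "gconv ct t u \<sigma> \<Longrightarrow> mt t \<tau> \<or> mt u \<tau> \<Longrightarrow> gconv ct t u \<tau>"
  using conv_type_unique by metis

text \<open>Lists are rigid terms of base type, so \<open>CCons\<close> is injective and distinct
  from \<open>CNil\<close> modulo conversion.\<close>

lemma gconv_CCons:
  assumes "gconv ct (Con CCons \<cdot> a \<cdot> l) (alist As) atmlist" "mt a atm" "mt l atmlist"
  obtains As' A where "As = As' @ [A]" "gconv ct a A atm" "gconv ct l (alist As') atmlist"
proof (cases As rule: rev_cases)
  case Nil
  have "rigid (Con CCons \<cdot> a \<cdot> l)" by blast
  then have "nsim ct (mvt ct {}) (Con CCons \<cdot> a \<cdot> l) (alist As)"
    using conv_rigid_nsim[OF assms(1)] Nil by simp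
  then show thesis using Nil by (simp add: nsim_simps)
next
  case (snoc As' A)
  have "rigid (Con CCons \<cdot> a \<cdot> l)" "rigid (Con CCons \<cdot> A \<cdot> alist As')" by blast+
  then have "nsim ct (mvt ct {}) (Con CCons \<cdot> a \<cdot> l) (Con CCons \<cdot> A \<cdot> alist As')"
    using conv_rigid_nsim[OF assms(1)] snoc by simp
  then show thesis using that[OF snoc] gconv_retype assms(2,3) by (auto simp: nsim_simps)
qed

lemma step_J_member: "step ct D (J \<Sigma>\<^sub>0) Member args \<Longrightarrow> J \<Sigma>\<^sub>0 Member args"
proof -
  assume s: "step ct D (J \<Sigma>\<^sub>0) Member args"
  then have ty: "list_all2 mt args [atm, atmlist]" by (simp add: step_def)
  then obtain a l where args: "args = [a, l]" "mt a atm" "mt l atmlist" by (auto simp: list_all2_Cons2)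
  have len: "\<forall>(\<tau>s, ts, B) \<in> set (member_clauses :: ('c, 'b) gclause list). length ts = length [atm, atmlist :: 'b mty]"
    by (auto simp: member_clauses_def)
  obtain \<tau>s ts B vs where
    cl: "(\<tau>s, ts, B) \<in> set member_clauses" "list_all2 mt vs \<tau>s"
    and c: "\<And>j. j < length ts \<Longrightarrow> \<exists>\<tau>. gconv ct (sub (ext vs (inst args)) (ts ! j)) (args ! j) \<tau>"
    and B: "sem ct (J \<Sigma>\<^sub>0) Par (ext vs (inst args)) B"
    by (rule step_clausesE[OF s spec_defn.simps(2) len]) blast
  have "Jmember a l"
    unfolding Jmember_def
  proof (intro allI impI)
    fix As assume As: "\<forall>A \<in> set As. mt A atm" and l: "gconv ct l (alist As) atmlist"
    from cl(1) consider
      "\<tau>s = [atm, atmlist]" "ts = [Bd 0, Con CCons \<cdot> Bd 0 \<cdot> Bd 1]" |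
      "\<tau>s = [atm, atm, atmlist]" "ts = [Bd 0, Con CCons \<cdot> Bd 1 \<cdot> Bd 2]" "B = FAt Member [Bd 0, Bd 2]"
      by (auto simp: member_clauses_def)
    then show "\<exists>A \<in> set As. gconv ct a A atm"
    proof cases
      case 1
      then obtain a' l' where vs: "vs = [a', l']" "mt a' atm" "mt l' atmlist" using cl(2) by (auto simp: list_all2_Cons2)
      have "\<exists>\<tau>. gconv ct a' a \<tau>" "\<exists>\<tau>. gconv ct (Con CCons \<cdot> a' \<cdot> l') l \<tau>"
        using c[of 0] c[of 1] 1 args by (auto simp: vs ext_Cons)
      then have "gconv ct a' a atm" "gconv ct (Con CCons \<cdot> a' \<cdot> l') (alist As) atmlist"
        using gconv_retype args l conv.trans by blast+
      then obtain As' A where As': "As = As' @ [A]" "gconv ct a' A atm"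
        using gconv_CCons[OF _ vs(2,3)] by metis
      then have "gconv ct a A atm" using \<open>gconv ct a' a atm\<close> conv.sym conv.trans by metis
      then show ?thesis using As'(1) by simp
    next
      case 2
      then obtain a' b' l' where vs: "vs = [a', b', l']" "mt a' atm" "mt b' atm" "mt l' atmlist"
        using cl(2) by (auto simp: list_all2_Cons2)
      have "\<exists>\<tau>. gconv ct a' a \<tau>" "\<exists>\<tau>. gconv ct (Con CCons \<cdot> b' \<cdot> l') l \<tau>"
        using c[of 0] c[of 1] 2 args by (auto simp: vs ext_Cons numeral_eq_Suc)
      then have a: "gconv ct a' a atm" and "gconv ct (Con CCons \<cdot> b' \<cdot> l') (alist As) atmlist"
        using gconv_retype args l conv.trans by blast+
      then obtain As' A where As': "As = As' @ [A]" "gconv ct l' (alist As') atmlist"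
        using gconv_CCons[OF _ vs(3,4)] by metis
      have "Jmember a' l'" using B 2 by (simp add: J_def vs ext_Cons numeral_eq_Suc)
      then obtain A' where "A' \<in> set As'" "gconv ct a' A' atm"
        using As' As unfolding Jmember_def by auto
      then have "A' \<in> set As" "gconv ct a A' atm" using As'(1) conv.trans[OF conv.sym[OF a]] by auto
      then show ?thesis by blast
    qed
  qed
  then show ?thesis by (simp add: J_def args)
qed

lemma step_J_prog: "step ct D (J \<Sigma>\<^sub>0) Prog args \<Longrightarrow> J \<Sigma>\<^sub>0 Prog args"
proof -
  assume s: "step ct D (J \<Sigma>\<^sub>0) Prog args"
  then have ty: "list_all2 mt args [atm, frm]" by (simp add: step_def)
  then obtain a b where args: "args = [a, b]" "mt a atm" "mt b frm" by (auto simp: list_all2_Cons2)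
  have len: "\<forall>(\<tau>s, ts, B) \<in> set (prog_clauses \<nu> \<Delta> :: ('c, 'b) gclause list). length ts = length [atm, frm :: 'b mty]"
    by (auto simp: prog_clauses_def split: prod.splits)
  obtain \<tau>s ts B vs where
    cl: "(\<tau>s, ts, B) \<in> set (prog_clauses \<nu> \<Delta>)" "list_all2 mt vs \<tau>s"
    and c: "\<And>j. j < length ts \<Longrightarrow> \<exists>\<tau>. gconv ct (sub (ext vs (inst args)) (ts ! j)) (args ! j) \<tau>"
    by (rule step_clausesE[OF s spec_defn.simps(4) len]) blast
  from cl(1) obtain C \<tau>s' Gs A where C: "C \<in> set \<Delta>" "flat C = (\<tau>s', Gs, A)" and
    ts: "\<tau>s = map psi_ty \<tau>s'" "ts = [psi_tm \<nu> A, psi_goal \<nu> (conj_goals Gs)]"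
    by (auto simp: prog_clauses_def split: prod.splits)
  have e: "ext vs (inst args) i = inst vs i" if "i < length (map psi_ty \<tau>s')" for i
    using that list_all2_lengthD[OF cl(2)] ts(1) by (simp add: ext_def inst_def)
  have "sub (ext vs (inst args)) (psi_tm \<nu> A) = sub (inst vs) (psi_tm \<nu> A)"
    by (rule sub_cong_typed[OF psi_goal_closed_type(2)[OF wf_\<Delta>_flat(2)[OF C]] e])
  moreover have "sub (ext vs (inst args)) (psi_goal \<nu> (conj_goals Gs)) = sub (inst vs) (psi_goal \<nu> (conj_goals Gs))"
    by (rule sub_cong_typed[OF psi_goal_closed_type(1)[OF wf_\<Delta>_flat(1)[OF C]] e])
  ultimately have "\<exists>\<tau>. gconv ct (sub (inst vs) (psi_tm \<nu> A)) a \<tau>"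
    "\<exists>\<tau>. gconv ct (sub (inst vs) (psi_goal \<nu> (conj_goals Gs))) b \<tau>"
    using c[of 0] c[of 1] by (auto simp: ts args)
  then have "gconv ct a (sub (inst vs) (psi_tm \<nu> A)) atm" "gconv ct b (sub (inst vs) (psi_goal \<nu> (conj_goals Gs))) frm"
    using gconv_retype args conv.sym by blast+
  then have "Jprog a b" using C cl(2) ts(1) unfolding Jprog_def by blast
  then show ?thesis by (simp add: J_def args)
qed

lemma JseqD:
  assumes "Jseq \<Sigma>\<^sub>0 l g" "finite \<Sigma>" "\<Sigma>\<^sub>0 \<subseteq> \<Sigma>" "rok \<Sigma> r" "\<forall>h \<in> \<Sigma>\<^sub>0. r (pn \<nu> h) = Par h"
    "wf_goal sg (set us) (set es) \<Sigma>\<^sub>0 E G" "\<And>i. i < length E \<Longrightarrow> mt (xs i) (psi_ty (E ! i))"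
    "\<forall>A \<in> set As. mt A atm" "gconv ct l (alist As) atmlist" "gconv ct g (sub xs (psi_goal \<nu> G)) frm"
  shows "hh sg \<Sigma> (\<Delta> @ map DAtom (map (ret r) As)) (gsub (\<lambda>i. ret r (xs i)) G)"
  using assms unfolding Jseq_def by blast

text \<open>The pattern of the clause is rigid, so it determines the outermost connective of
  \<open>G\<close>, and the corresponding rule applies with witnesses retracted by \<open>r\<close>.
  Goals remain typed over \<open>\<Sigma>\<^sub>0\<close>; what changes is \<open>\<Sigma>\<close>,
  \<open>r\<close>, the hypotheses and the values of the indices.\<close>

lemma step_J_seq:
  assumes "finite \<Sigma>\<^sub>0" and s: "step ct D (J \<Sigma>\<^sub>0) Seq args"
  shows "J \<Sigma>\<^sub>0 Seq args"
proof -
  have ty: "list_all2 mt args [nt, atmlist, frm]" using s by (simp add: step_def)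
  then obtain n l g where args: "args = [n, l, g]" "mt n nt" "mt l atmlist" "mt g frm"
    by (auto simp: list_all2_Cons2)
  have len: "\<forall>(\<tau>s, ts, B) \<in> set (seq_clauses us es :: ('c, 'b) gclause list).
      length ts = length [nt, atmlist, frm :: 'b mty]"
    by (auto simp: seq_clauses_def)
  obtain \<tau>s ts B vs where
    cl: "(\<tau>s, ts, B) \<in> set (seq_clauses us es)" "list_all2 mt vs \<tau>s"
    and c: "\<And>j. j < length ts \<Longrightarrow> \<exists>\<tau>. gconv ct (sub (ext vs (inst args)) (ts ! j)) (args ! j) \<tau>"
    and B: "sem ct (J \<Sigma>\<^sub>0) Par (ext vs (inst args)) B"
    by (rule step_clausesE[OF s spec_defn.simps(3) len]) blast
  let ?e = "ext vs (inst args)"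
  obtain t \<tau>s' where ts: "ts = [Con CS \<cdot> Bd 0, Bd 1, t]" "\<tau>s = nt # atmlist # \<tau>s'"
    using cl(1) by (auto simp: seq_clauses_def)
  obtain v0 v1 ws where vs: "vs = v0 # v1 # ws" "mt v0 nt" "mt v1 atmlist" "list_all2 mt ws \<tau>s'"
    using cl(2) by (auto simp: ts list_all2_Cons2)
  have "\<exists>\<tau>. gconv ct v1 l \<tau>" "\<exists>\<tau>. gconv ct (sub ?e t) g \<tau>"
    using c[of 1] c[of 2] by (auto simp: ts vs args ext_Cons numeral_eq_Suc)
  then have v1: "gconv ct v1 l atmlist" and tg: "gconv ct (sub ?e t) g frm"
    using gconv_retype args by blast+
  have "Jseq \<Sigma>\<^sub>0 l g"
    unfolding Jseq_def
  proof (intro allI impI)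
    fix \<Sigma> r E xs As G
    assume fin: "finite \<Sigma>" and sub: "\<Sigma>\<^sub>0 \<subseteq> \<Sigma>" and rok: "rok \<Sigma> r" and r: "\<forall>h \<in> \<Sigma>\<^sub>0. r (pn \<nu> h) = Par h"
      and G: "wf_goal sg (set us) (set es) \<Sigma>\<^sub>0 E G" and xs: "\<forall>i < length E. mt (xs i) (psi_ty (E ! i))"
      and As: "\<forall>A \<in> set As. mt A atm" and l: "gconv ct l (alist As) atmlist"
      and g: "gconv ct g (sub xs (psi_goal \<nu> G)) frm"
    have l': "gconv ct v1 (alist As) atmlist" using v1 l by (rule conv.trans)
    have g': "gconv ct (sub ?e t) (sub xs (psi_goal \<nu> G)) frm" using tg g by (rule conv.trans)
    have ns: "rigid (sub ?e t) \<Longrightarrow> nsim ct (mvt ct {}) (sub ?e t) (sub xs (psi_goal \<nu> G))"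
      using conv_rigid_nsim[OF g' _ rigid_psi_goal] .
    note IH = JseqD[OF _ fin sub rok r _ _ As l']
    let ?\<Delta> = "\<Delta> @ map DAtom (map (ret r) As)" and ?xs = "\<lambda>i. ret r (xs i)"
    consider
      (top) "t = Con CTop" |
      (or1) "\<tau>s' = [frm, frm]" "t = Con COr \<cdot> Bd 2 \<cdot> Bd 3" "B = FAt Seq [Bd 0, Bd 1, Bd 2]" |
      (or2) "\<tau>s' = [frm, frm]" "t = Con COr \<cdot> Bd 2 \<cdot> Bd 3" "B = FAt Seq [Bd 0, Bd 1, Bd 3]" |
      (conj) "\<tau>s' = [frm, frm]" "t = Con CAnd \<cdot> Bd 2 \<cdot> Bd 3"
        "B = FAnd (FAt Seq [Bd 0, Bd 1, Bd 2]) (FAt Seq [Bd 0, Bd 1, Bd 3])" |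
      (imp) "\<tau>s' = [atm, frm]" "t = Con CImp \<cdot> Bd 2 \<cdot> Bd 3"
        "B = FAt Seq [Bd 0, Con CCons \<cdot> Bd 2 \<cdot> Bd 1, Bd 3]" |
      (all) \<tau> where "\<tau> \<in> set us" "\<tau>s' = [psi_ty \<tau> \<rightarrow>\<^sub>t frm]" "t = Con (CAll \<tau>) \<cdot> Bd 2"
        "B = FNab (psi_ty \<tau>) (FAt Seq [Bd 1, Bd 2, Bd 3 \<cdot> Bd 0])" |
      (ex) \<tau> where "\<tau> \<in> set es" "\<tau>s' = [psi_ty \<tau> \<rightarrow>\<^sub>t frm]" "t = Con (CEx \<tau>) \<cdot> Bd 2"
        "B = FEx (psi_ty \<tau>) (FAt Seq [Bd 1, Bd 2, Bd 3 \<cdot> Bd 0])" |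
      (mem) "\<tau>s' = [atm]" "t = Con CAt \<cdot> Bd 2" "B = FAt Member [Bd 2, Bd 1]" |
      (prog) "\<tau>s' = [atm]" "t = Con CAt \<cdot> Bd 2"
        "B = FEx frm (FAnd (FAt Prog [Bd 3, Bd 0]) (FAt Seq [Bd 1, Bd 2, Bd 0]))"
      using cl(1) unfolding seq_clauses_def ts set_append set_map list.set Un_iff insert_iff image_iff
        prod.inject list.inject empty_iff
      by (elim disjE bexE conjE) (metis (no_types))+
    then show "hh sg \<Sigma> ?\<Delta> (gsub ?xs G)"
    proof cases
      case top
      then have "nsim ct (mvt ct {}) (Con CTop) (sub xs (psi_goal \<nu> G))" using ns by simp
      then have "G = GTop" by (cases G) (auto simp: nsim_simps)
      then show ?thesis by (simp add: hh.TRUE)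
    next
      case or1
      then obtain b d where ws: "ws = [b, d]" "mt b frm" "mt d frm" using vs(4) by (auto simp: list_all2_Cons2)
      have "nsim ct (mvt ct {}) (Con COr \<cdot> b \<cdot> d) (sub xs (psi_goal \<nu> G))"
        using ns or1(2) by (simp add: vs ws ext_Cons numeral_eq_Suc rigid_App)
      then obtain G1 G2 where G12: "G = GOr G1 G2" "\<exists>\<tau>. gconv ct b (sub xs (psi_goal \<nu> G1)) \<tau>"
        by (cases G) (auto simp: nsim_simps)
      have "Jseq \<Sigma>\<^sub>0 v1 b" using B or1(3) by (simp add: J_def vs ws ext_Cons numeral_eq_Suc)
      then have "hh sg \<Sigma> ?\<Delta> (gsub ?xs G1)"
        by (rule IH) (use G G12 xs ws gconv_retype in auto)
      then show ?thesis by (simp add: G12 hh.OR1)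
    next
      case or2
      then obtain b d where ws: "ws = [b, d]" "mt b frm" "mt d frm" using vs(4) by (auto simp: list_all2_Cons2)
      have "nsim ct (mvt ct {}) (Con COr \<cdot> b \<cdot> d) (sub xs (psi_goal \<nu> G))"
        using ns or2(2) by (simp add: vs ws ext_Cons numeral_eq_Suc rigid_App)
      then obtain G1 G2 where G12: "G = GOr G1 G2" "\<exists>\<tau>. gconv ct d (sub xs (psi_goal \<nu> G2)) \<tau>"
        by (cases G) (auto simp: nsim_simps)
      have "Jseq \<Sigma>\<^sub>0 v1 d" using B or2(3) by (simp add: J_def vs ws ext_Cons numeral_eq_Suc)
      then have "hh sg \<Sigma> ?\<Delta> (gsub ?xs G2)"
        by (rule IH) (use G G12 xs ws gconv_retype in auto)
      then show ?thesis by (simp add: G12 hh.OR2)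
    next
      case conj
      then obtain b d where ws: "ws = [b, d]" "mt b frm" "mt d frm" using vs(4) by (auto simp: list_all2_Cons2)
      have "nsim ct (mvt ct {}) (Con CAnd \<cdot> b \<cdot> d) (sub xs (psi_goal \<nu> G))"
        using ns conj(2) by (simp add: vs ws ext_Cons numeral_eq_Suc rigid_App)
      then obtain G1 G2 where G12: "G = GAnd G1 G2" "\<exists>\<tau>. gconv ct b (sub xs (psi_goal \<nu> G1)) \<tau>"
        "\<exists>\<tau>. gconv ct d (sub xs (psi_goal \<nu> G2)) \<tau>"
        by (cases G) (auto simp: nsim_simps)
      have J: "Jseq \<Sigma>\<^sub>0 v1 b" "Jseq \<Sigma>\<^sub>0 v1 d" using B conj(3) by (simp_all add: J_def vs ws ext_Cons numeral_eq_Suc)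
      have "hh sg \<Sigma> ?\<Delta> (gsub ?xs G1)"
        by (rule IH[OF J(1)]) (use G G12 xs ws gconv_retype in auto)
      moreover have "hh sg \<Sigma> ?\<Delta> (gsub ?xs G2)"
        by (rule IH[OF J(2)]) (use G G12 xs ws gconv_retype in auto)
      ultimately show ?thesis by (simp add: G12 hh.AND)
    next
      case imp
      then obtain b d where ws: "ws = [b, d]" "mt b atm" "mt d frm" using vs(4) by (auto simp: list_all2_Cons2)
      have "nsim ct (mvt ct {}) (Con CImp \<cdot> b \<cdot> d) (sub xs (psi_goal \<nu> G))"
        using ns imp(2) by (simp add: vs ws ext_Cons numeral_eq_Suc rigid_App)
      then obtain A G1 where G12: "G = GImp A G1" "\<exists>\<tau>. gconv ct b (sub xs (psi_tm \<nu> A)) \<tau>"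
        "\<exists>\<tau>. gconv ct d (sub xs (psi_goal \<nu> G1)) \<tau>"
        by (cases G) (auto simp: nsim_simps)
      then have b: "gconv ct b (sub xs (psi_tm \<nu> A)) atm" using ws gconv_retype by blast
      have J: "Jseq \<Sigma>\<^sub>0 (Con CCons \<cdot> b \<cdot> v1) d" using B imp(3) by (simp add: J_def vs ws ext_Cons numeral_eq_Suc)
      have "gconv ct (Con CCons \<cdot> b \<cdot> v1) (alist (As @ [sub xs (psi_tm \<nu> A)])) atmlist"
        unfolding alist_snoc
        by (intro conv.app[where \<sigma> = atmlist] conv.app[where \<sigma> = atm] conv.refl b l') (simp add: has_type_iffs)
      then have "hh sg \<Sigma> (\<Delta> @ map DAtom (map (ret r) (As @ [sub xs (psi_tm \<nu> A)]))) (gsub ?xs G1)"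
        by (intro JseqD[OF J fin sub rok r])
          (use G G12 xs As ws gconv_retype conv_has_type[OF b] in auto)
      moreover have "ret r (sub xs (psi_tm \<nu> A)) = sub ?xs A"
        by (rule ret_psi[where \<Sigma> = \<Sigma>\<^sub>0]) (use G G12(1) r in auto)
      ultimately show ?thesis by (simp add: G12(1) hh.AUGMENT)
    next
      case (all \<tau>)
      then obtain b where ws: "ws = [b]" "mt b (psi_ty \<tau> \<rightarrow>\<^sub>t frm)" using vs(4) by (auto simp: list_all2_Cons2)
      have "nsim ct (mvt ct {}) (Con (CAll \<tau>) \<cdot> b) (sub xs (psi_goal \<nu> G))"
        using ns all(3) by (simp add: vs ws ext_Cons numeral_eq_Suc rigid_App)
      then obtain G1 where G1: "G = GAll \<tau> G1" "\<exists>\<sigma>. gconv ct b (Lam (psi_ty \<tau>) (sub (up xs) (psi_goal \<nu> G1))) \<sigma>"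
        by (cases G) (auto simp: nsim_simps)
      then have b: "gconv ct b (Lam (psi_ty \<tau>) (sub (up xs) (psi_goal \<nu> G1))) (psi_ty \<tau> \<rightarrow>\<^sub>t frm)"
        using ws gconv_retype by blast
      from B all(4) obtain X where X: "finite X" "\<And>a. snd a = psi_ty \<tau> \<Longrightarrow> a \<notin> X \<Longrightarrow> Jseq \<Sigma>\<^sub>0 v1 (b \<cdot> Par (Nom a))"
        by (auto simp: J_def vs ws ext_Cons numeral_eq_Suc)
      \<comment> \<open>The new constant must avoid the exceptional set of \<nabla>, the values and
        hypotheses whose retractions have to survive the change of \<open>r\<close>, and the
        constants that encode \<open>\<Sigma>\<^sub>0\<close>.\<close>
      let ?X = "X \<union> (\<Union>i < length E. noms (xs i)) \<union> (\<Union>A \<in> set As. noms A) \<union> pn \<nu> ` \<Sigma>\<^sub>0"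
      have "finite ?X" using X(1) assms(1) by simp
      then obtain k where k: "\<forall>a. shift k a \<notin> ?X" using exists_shift_avoiding by metis
      obtain a where a: "snd a = psi_ty \<tau>" "a \<notin> ?X" using k[rule_format, of "(0, psi_ty \<tau>)"] by (metis snd_shift snd_conv)
      obtain k' where k': "\<forall>a. shift k' a \<notin> \<Sigma>" using exists_shift_avoiding[OF fin] by metis
      obtain d where d: "snd d = \<tau>" "d \<notin> \<Sigma>" using k'[rule_format, of "(0, \<tau>)"] by (metis snd_shift snd_conv)
      \<comment> \<open>The eigenvariable \<open>d\<close> of GENERIC is the retraction of
        \<open>a\<close>; within the goal it remains an index with value \<open>a\<close>.\<close>
      let ?r = "r(a := Par d)" and ?xs' = "case_nat (Par (Nom a)) xs"
      have rok': "rok (insert d \<Sigma>) ?r"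
        unfolding rok_def
      proof (intro allI impI)
        fix a' :: "'b mbase tvar" assume inh: "inhabited ct (snd a')"
        show "has_type sg (svt (insert d \<Sigma>)) [] (?r a') (ret_ty (snd a'))"
        proof (cases "a' = a")
          case True
          then show ?thesis using a d by (simp add: has_type_Par_iff svt_def)
        next
          case False
          have "has_type sg (svt \<Sigma>) [] (r a') (ret_ty (snd a'))" using rok inh unfolding rok_def by blast
          then have "has_type sg (svt (insert d \<Sigma>)) [] (r a') (ret_ty (snd a'))"
            by (rule has_type_mono) (erule svt_mono, blast)
          then show ?thesis using False by simp
        qed
      qed
      have pa: "mt (Par (Nom a)) (psi_ty \<tau>)"
        using us_inhabited all(1) a(1) by (auto simp: has_type_Par_iff mvt_Nom intro: psi_inhabited)
      have "has_type ct (mvt ct {}) [psi_ty \<tau>] (sub (up xs) (psi_goal \<nu> G1)) frm"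
        using conv_has_type[OF b] by (auto simp: has_type_Lam_iff)
      from conv.trans[OF conv.app[OF b conv.refl[OF pa]] conv.beta[OF this pa]]
      have ba: "gconv ct (b \<cdot> Par (Nom a)) (sub ?xs' (psi_goal \<nu> G1)) frm" by (simp add: sub_inst_up)
      have J: "Jseq \<Sigma>\<^sub>0 v1 (b \<cdot> Par (Nom a))" using X(2) a by blast
      have "hh sg (insert d \<Sigma>) (\<Delta> @ map DAtom (map (ret ?r) As)) (gsub (\<lambda>i. ret ?r (?xs' i)) G1)"
      proof (rule JseqD[OF J _ _ rok' _ _ _ As l' ba])
        show "\<forall>h \<in> \<Sigma>\<^sub>0. ?r (pn \<nu> h) = Par h" using r a(2) by auto
        show "wf_goal sg (set us) (set es) \<Sigma>\<^sub>0 (\<tau> # E) G1" using G G1(1) by simp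
        show "mt (?xs' i) (psi_ty ((\<tau> # E) ! i))" if "i < length (\<tau> # E)" for i
          using that xs pa by (auto simp: less_Suc_eq_0_disj)
      qed (use fin sub in auto)
      moreover have "map (ret ?r) As = map (ret r) As"
        using a(2) by (auto intro!: ret_cong)
      moreover have "gsub (\<lambda>i. ret ?r (?xs' i)) G1 = gsub (case_nat (Par d) ?xs) G1"
      proof (rule gsub_cong)
        show "wf_goal sg (set us) (set es) \<Sigma>\<^sub>0 (\<tau> # E) G1" using G G1(1) by simp
        show "ret ?r (?xs' i) = case_nat (Par d) ?xs i" if "i < length (\<tau> # E)" for i
          using that a(2) by (auto simp: less_Suc_eq_0_disj intro!: ret_cong)
      qed
      ultimately have "hh sg (insert d \<Sigma>) ?\<Delta> (gsub (inst [Par d]) (gsub (up ?xs) G1))"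
        by (simp add: gsub_inst_up)
      then show ?thesis using d by (auto simp: G1(1) intro: hh.GENERIC)
    next
      case (ex \<tau>)
      then obtain b where ws: "ws = [b]" "mt b (psi_ty \<tau> \<rightarrow>\<^sub>t frm)" using vs(4) by (auto simp: list_all2_Cons2)
      have "nsim ct (mvt ct {}) (Con (CEx \<tau>) \<cdot> b) (sub xs (psi_goal \<nu> G))"
        using ns ex(3) by (simp add: vs ws ext_Cons numeral_eq_Suc rigid_App)
      then obtain G1 where G1: "G = GEx \<tau> G1" "\<exists>\<sigma>. gconv ct b (Lam (psi_ty \<tau>) (sub (up xs) (psi_goal \<nu> G1))) \<sigma>"
        by (cases G) (auto simp: nsim_simps)
      then have b: "gconv ct b (Lam (psi_ty \<tau>) (sub (up xs) (psi_goal \<nu> G1))) (psi_ty \<tau> \<rightarrow>\<^sub>t frm)"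
        using ws gconv_retype by blast
      from B ex(4) obtain u where u: "mt u (psi_ty \<tau>)" and J: "Jseq \<Sigma>\<^sub>0 v1 (b \<cdot> u)"
        by (auto simp: J_def vs ws ext_Cons numeral_eq_Suc)
      let ?xs' = "case_nat u xs"
      have "has_type ct (mvt ct {}) [psi_ty \<tau>] (sub (up xs) (psi_goal \<nu> G1)) frm"
        using conv_has_type[OF b] by (auto simp: has_type_Lam_iff)
      from conv.trans[OF conv.app[OF b conv.refl[OF u]] conv.beta[OF this u]]
      have bu: "gconv ct (b \<cdot> u) (sub ?xs' (psi_goal \<nu> G1)) frm" by (simp add: sub_inst_up)
      have "hh sg \<Sigma> ?\<Delta> (gsub (\<lambda>i. ret r (?xs' i)) G1)"
      proof (rule IH[OF J _ _ bu])
        show "wf_goal sg (set us) (set es) \<Sigma>\<^sub>0 (\<tau> # E) G1" using G G1(1) by simp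
        show "mt (?xs' i) (psi_ty ((\<tau> # E) ! i))" if "i < length (\<tau> # E)" for i
          using that xs u by (auto simp: less_Suc_eq_0_disj)
      qed
      moreover have "(\<lambda>i. ret r (?xs' i)) = case_nat (ret r u) ?xs"
        by (auto simp: fun_eq_iff split: nat.split)
      ultimately have "hh sg \<Sigma> ?\<Delta> (gsub (inst [ret r u]) (gsub (up ?xs) G1))"
        by (simp add: gsub_inst_up)
      moreover have "has_type sg (svt \<Sigma>) [] (ret r u) \<tau>" using ret_has_type[OF u rok] by simp
      ultimately show ?thesis by (auto simp: G1(1) intro: hh.INSTANCE)
    next
      case mem
      then obtain a where ws: "ws = [a]" "mt a atm" using vs(4) by (auto simp: list_all2_Cons2)
      have "nsim ct (mvt ct {}) (Con CAt \<cdot> a) (sub xs (psi_goal \<nu> G))"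
        using ns mem(2) by (simp add: vs ws ext_Cons numeral_eq_Suc rigid_App)
      then obtain A where A: "G = GAtom A" "\<exists>\<sigma>. gconv ct a (sub xs (psi_tm \<nu> A)) \<sigma>"
        by (cases G) (auto simp: nsim_simps)
      then have a: "gconv ct a (sub xs (psi_tm \<nu> A)) atm" using ws gconv_retype by blast
      have "Jmember a v1" using B mem(3) by (simp add: J_def vs ws ext_Cons numeral_eq_Suc)
      then obtain A' where A': "A' \<in> set As" "gconv ct a A' atm" using As l' by (auto simp: Jmember_def)
      \<comment> \<open>The conversion known so far lives in the meta-logic; its retraction is the
        one that BACKCHAIN asks for.\<close>
      from ret_conv[OF conv.trans[OF conv.sym[OF A'(2)] a] rok]
      have cv: "conv sg (svt \<Sigma>) [] (ret r A') (sub ?xs A) (Base SAtm)"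
        using ret_psi[where \<Sigma> = \<Sigma>\<^sub>0 and r = r and \<nu> = \<nu> and xs = xs and t = A and E = E and \<tau> = "Base SAtm"] G A(1) r by simp
      show ?thesis
        unfolding A(1) gsub.simps
        by (rule hh.BACKCHAIN[where D = "DAtom (ret r A')" and ts = "[]" and \<tau>s = "[]" and Gs = "[]" and A' = "ret r A'"])
          (use A' cv in auto)
    next
      case prog
      then obtain a where ws: "ws = [a]" "mt a atm" using vs(4) by (auto simp: list_all2_Cons2)
      have "nsim ct (mvt ct {}) (Con CAt \<cdot> a) (sub xs (psi_goal \<nu> G))"
        using ns prog(2) by (simp add: vs ws ext_Cons numeral_eq_Suc rigid_App)
      then obtain A where A: "G = GAtom A" "\<exists>\<sigma>. gconv ct a (sub xs (psi_tm \<nu> A)) \<sigma>"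
        by (cases G) (auto simp: nsim_simps)
      then have a: "gconv ct a (sub xs (psi_tm \<nu> A)) atm" using ws gconv_retype by blast
      from B prog(3) obtain b where Jp: "Jprog a b" and J: "Jseq \<Sigma>\<^sub>0 v1 b"
        by (auto simp: J_def vs ws ext_Cons numeral_eq_Suc)
      from Jp obtain C \<sigma>s Gs A' ys where C: "C \<in> set \<Delta>" "flat C = (\<sigma>s, Gs, A')"
        and ys: "list_all2 mt ys (map psi_ty \<sigma>s)" and a': "gconv ct a (sub (inst ys) (psi_tm \<nu> A')) atm"
        and b: "gconv ct b (sub (inst ys) (psi_goal \<nu> (conj_goals Gs))) frm"
        unfolding Jprog_def by blast
      have len: "length ys = length \<sigma>s" using list_all2_lengthD[OF ys] by simp
      \<comment> \<open>The body of the clause is itself a goal whose indices are the clause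
        variables, so the invariant applies to it uninstantiated, with \<open>ys\<close> as
        values.\<close>
      have hhc: "hh sg \<Sigma> ?\<Delta> (gsub (\<lambda>i. ret r (inst ys i)) (conj_goals Gs))"
        by (rule IH[OF J wf_\<Delta>_flat(1)[OF C] _ b]) (use ys len in \<open>auto simp: inst_def list_all2_conv_all_nth\<close>)
      have eq: "(\<lambda>i. ret r (inst ys i)) = inst (map (ret r) ys)"
        by (auto simp: inst_def fun_eq_iff ret_def)
      from ret_conv[OF conv.trans[OF conv.sym[OF a'] a] rok]
      have cv: "conv sg (svt \<Sigma>) [] (sub (inst (map (ret r) ys)) A') (sub ?xs A) (Base SAtm)"
        using ret_psi[where \<Sigma> = \<Sigma>\<^sub>0 and r = r and \<nu> = \<nu> and xs = xs and t = A and E = E and \<tau> = "Base SAtm"] G A(1) r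
          ret_psi[OF wf_\<Delta>_flat(2)[OF C, of \<Sigma>\<^sub>0], of r \<nu> "inst ys"] eq by simp
      have tys: "list_all2 (has_type sg (svt \<Sigma>) []) (map (ret r) ys) \<sigma>s"
        using ys len ret_has_type[OF _ rok] by (fastforce simp: list_all2_conv_all_nth)
      show ?thesis
        unfolding A(1) gsub.simps
        by (rule hh.BACKCHAIN[OF _ C(2) tys cv]) (use C(1) hh_conj_goals[OF hhc] eq in auto)
    qed
  qed
  then show ?thesis by (simp add: J_def args)
qed

text \<open>\<open>J\<close> is a pre-fixed point. Finiteness of \<open>\<Sigma>\<^sub>0\<close>
  enters through the fresh constant in the universal case.\<close>

lemma M_le_J: "finite \<Sigma>\<^sub>0 \<Longrightarrow> M \<le> J \<Sigma>\<^sub>0"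
proof (rule M_lowerbound, intro le_funI le_boolI)
  fix p args assume "finite \<Sigma>\<^sub>0" "step ct D (J \<Sigma>\<^sub>0) p args"
  then show "J \<Sigma>\<^sub>0 p args"
    using step_J_member step_J_prog step_J_seq by (cases p) (simp add: J_def, blast+)
qed

text \<open>Soundness makes \<open>seq\<close> true in the model at some height; the invariant is
  then read at \<open>\<Sigma>\<close> itself, with an empty context of indices.\<close>

theorem provable_hh:
  assumes \<Sigma>: "finite \<Sigma>" "\<forall>h \<in> \<Sigma>. inhabited sg (snd h)"
    and L: "\<forall>A \<in> set L. has_type sg (svt \<Sigma>) [] A (Base SAtm)"
    and G: "wf_goal sg (set us) (set es) \<Sigma> [] G"
    and prov: "provable ct D (psi_atoms \<nu> L \<rhd> psi_goal \<nu> G)"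
  shows "hh sg \<Sigma> (\<Delta> @ map DAtom L) G"
proof -
  let ?l = "psi_atoms \<nu> L" and ?g = "psi_goal \<nu> G"
  have l: "mt ?l atmlist" and g: "mt ?g frm" using mt_psi[OF \<Sigma>(2)] L G by blast+
  have wf: "wf_form ct D {} [] (?l \<rhd> ?g)"
    using has_type_ren_Suc[OF l] has_type_ren_Suc[OF g] by (auto simp: entails_def has_type_iffs)
  let ?\<theta> = "\<lambda>h. Par (Eig h)"
  have "valid {} {#} (?l \<rhd> ?g)"
    using prov wf by (intro gder_sound) (auto simp: provable_def)
  then have "tr ?\<theta> (?l \<rhd> ?g)" by (auto simp: valid_def gsubst_def)
  moreover have "fresh_ren (\<lambda>a. a) ?\<theta> (?l \<rhd> ?g)"
    using wf_form_Eig[OF wf] unfolding fresh_ren_def by auto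
  ultimately have "sem ct M (cmb (\<lambda>a. a) ?\<theta>) Bd (?l \<rhd> ?g)" using tr_iff[OF wf] by blast
  then obtain n where "M Seq [n, ?l, ?g]"
    by (auto simp: entails_def cmb_id hom_ren)
  then have "J \<Sigma> Seq [n, ?l, ?g]" using M_le_J[OF \<Sigma>(1)] by (auto simp: le_fun_def)
  then have J: "Jseq \<Sigma> ?l ?g" by (simp add: J_def)
  \<comment> \<open>Constants of eigenvariables are decoded. Any other constant gets an arbitrary
    inhabitant of its retracted type, which exists whenever the constant does.\<close>
  define r where "r a = (if a \<in> pn \<nu> ` \<Sigma> then Par (inv_into \<Sigma> (pn \<nu>) a)
    else SOME t. has_type sg (svt \<Sigma>) [] t (ret_ty (snd a)))" for a
  have inj: "inj_on (pn \<nu>) \<Sigma>" using inj_pn[OF bij_\<nu>] by (rule inj_on_subset) simp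
  have r: "r (pn \<nu> h) = Par h" if "h \<in> \<Sigma>" for h
    using that inj by (simp add: r_def)
  have rok: "rok \<Sigma> r"
    unfolding rok_def
  proof (intro allI impI)
    fix a :: "'b mbase tvar" assume inh: "inhabited ct (snd a)"
    show "has_type sg (svt \<Sigma>) [] (r a) (ret_ty (snd a))"
    proof (cases "a \<in> pn \<nu> ` \<Sigma>")
      case True
      then obtain h where h: "h \<in> \<Sigma>" "a = pn \<nu> h" by blast
      then show ?thesis using r by (simp add: has_type_Par_iff svt_def)
    next
      case False
      have "has_type sg (svt \<Sigma>) [] (SOME t. has_type sg (svt \<Sigma>) [] t (ret_ty (snd a))) (ret_ty (snd a))"
        by (rule someI_ex[OF inhabited_ret[OF inh]])
      then show ?thesis using False by (simp add: r_def)
    qed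
  qed
  have ret_id: "ret r (psi_tm \<nu> A) = A" if "A \<in> set L" for A
    using ret_psi[of sg \<Sigma> "[]" A "Base SAtm" r \<nu> Bd] L r that by (simp add: ret_def)
  have As: "\<forall>A \<in> set (map (psi_tm \<nu>) L). mt A atm"
    using mt_psi(1)[OF \<Sigma>(2), of _ "Base SAtm"] L by auto
  have "hh sg \<Sigma> (\<Delta> @ map DAtom (map (ret r) (map (psi_tm \<nu>) L))) (gsub (\<lambda>i. ret r (Bd i)) G)"
    by (rule JseqD[OF J \<Sigma>(1) _ rok _ G _ As])
      (use r conv.refl[OF l] conv.refl[OF g] in \<open>auto simp: psi_atoms_eq_alist\<close>)
  moreover have "map (ret r) (map (psi_tm \<nu>) L) = L" using ret_id by (simp add: map_idI)
  moreover have "(\<lambda>i. ret r (Bd i)) = Bd" by (simp add: ret_def)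
  ultimately show ?thesis by (simp only: gsub_Bd)
qed

end

theorem theorem6p3:
  fixes sg :: "'c \<Rightarrow> 'b sty option"
    and us es :: "'b sty list"
    and \<nu> :: "'b sty \<Rightarrow> nat \<Rightarrow> nat"
    and \<Sigma> :: "'b evar set"
    and \<Delta> :: "('c, 'b) dclause list"
    and \<L> :: "('c, 'b) stm list"
    and G :: "('c, 'b) goal"
  assumes "spec_sig sg"
    and "\<forall>\<tau> \<in> set us. obj_ty \<tau> \<and> inhabited sg \<tau>"
    and "\<forall>\<tau> \<in> set es. obj_ty \<tau>"
    and "\<forall>\<tau>. bij (\<nu> \<tau>)"
    and "finite \<Sigma>"
    and "\<forall>h \<in> \<Sigma>. obj_ty (snd h) \<and> inhabited sg (snd h)"
    and "\<forall>D \<in> set \<Delta>. wf_clause sg (set us) (set es) {} [] D"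
    and "\<forall>A \<in> set \<L>. has_type sg (svt \<Sigma>) [] A (Base SAtm)"
    and "wf_goal sg (set us) (set es) \<Sigma> [] G"
  shows "hh sg \<Sigma> (\<Delta> @ map DAtom \<L>) G \<longleftrightarrow>
    provable (msig sg (set us) (set es)) (spec_defn \<nu> us es \<Delta>) (psi_atoms \<nu> \<L> \<rhd> psi_goal \<nu> G)"
proof -
  interpret encoding sg us es \<nu> \<Delta>
    by standard (use assms(2,4,7) in blast)+
  have \<Sigma>: "\<forall>h \<in> \<Sigma>. inhabited sg (snd h)" using assms(6) by blast
  show ?thesis
    using hh_provable[OF _ assms(8,9) \<Sigma>] provable_hh[OF assms(5) \<Sigma> assms(8,9)] by blast
qed

end
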